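(* Let $X$ be a non-negative random variable with distribution $F_X$ such that $\mathbb{E}[\log(1+\lambda X)]<\infty$ for all $\lambda>0$. Let $0<\sigma\le1$, let $Y_\sigma$ be a Bernoulli random variable with success probability $\sigma$ independent of $X$, and assume that $F_{XY_\sigma}$ has no jump of size one. Then the random variable $M_1(F_{XY_\sigma})\overset{d}{=}\beta_{\sigma,1-\sigma}M_\sigma(F_X)$ has density $$\xi_{F_{XY_\sigma}}(x)=\frac{x^{\sigma-1}}{\pi}\sin\big(\pi F_{XY_\sigma}(x)\big)\,e^{-\sigma\Phi_{F_X}(x)},\qquad x>0,$$ where $$\sin(\pi F_{XY_\sigma}(x))=\begin{cases}\sin(\pi\sigma[1-F_X(x)]), & F_X(x)>0,\\ \sin(\pi(1-\sigma)), & F_X(x)=0.\end{cases}$$ Since $\mathrm{GGC}(\sigma,F_X)=\mathrm{GGC}(1,F_{XY_\sigma})$, it follows that the random variable $G_\sigma M_\sigma(F_X)\overset{d}{=}G_1M_1(F_{XY_\sigma})$ has density $$g_{\sigma,F_X}(x)=\frac1\pi\int_0^\infty e^{-x/y}\,y^{\sigma-2}\sin\big(\pi F_{XY_\sigma}(y)\big)\,e^{-\sigma\Phi_{F_X}(y)}\,dy,\qquad x>0.$$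
   Context: $F_R$ denotes both the distribution and the cdf of a random variable $R$. In particular $F_{XY_\sigma}(x)=\sigma F_X(x)+(1-\sigma)\mathbb{I}(x\ge0)$. For a distribution $F_X$ on $[0,\infty)$, $$\Phi_{F_X}(t)=\mathbb{E}\big[\log(|t-X|)\,\mathbb{I}(t\ne X)\big].$$ Dirichlet process and Dirichlet mean: for $\theta>0$ and a probability distribution $F$ on $[0,\infty)$, a Dirichlet process $P_\theta$ with total mass $\theta$ and parameter $F$ is a random probability measure on $[0,\infty)$ such that for every finite measurable partition $(C_1,\dots,C_k)$ of $[0,\infty)$ the vector $(P_\theta(C_1),\dots,P_\theta(C_k))$ is Dirichlet distributed with parameters $(\theta F(C_1),\dots,\theta F(C_k))$. The Dirichlet mean is $M_\theta(F)\overset{d}{=}\int_0^\infty x\,P_\theta(dx)$; it is finite if and only if $\int_0^\infty\log(1+\lambda x)F(dx)<\infty$ for $\lambda>0$. $G_a$ denotes a gamma$(a,1)$ random variable and $\beta_{a,b}$ a beta$(a,b)$ random variable, with $\beta_{1,0}:=1$. $\mathrm{GGC}(\theta,F)$ denotes the law of $G_\theta M_\theta(F)$. In all products of random variables the factors are independent. Densities are with respect to Lebesgue measure, as usual determined up to null sets. *)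

theory Defs
  imports "HOL-Probability.Probability"
begin

section \<open>Gamma, beta and Dirichlet laws\<close>

definition gamma_density :: "real \<Rightarrow> real \<Rightarrow> real" where
  "gamma_density a x = (if 0 < x then x powr (a - 1) * exp (- x) / Gamma a else 0)"

text \<open>The boundary case \<open>a = 0\<close> is the point mass at zero; it is needed for Dirichlet vectors,
  whose parameters may vanish.\<close>

definition gamma_law :: "real \<Rightarrow> real measure" where
  "gamma_law a = (if a = 0 then return borel 0 else density lborel (\<lambda>x. ennreal (gamma_density a x)))"

definition beta_density :: "real \<Rightarrow> real \<Rightarrow> real \<Rightarrow> real" where
  "beta_density a b x =
     (if 0 < x \<and> x < 1 then x powr (a - 1) * (1 - x) powr (b - 1) / Beta a b else 0)"

text \<open>The boundary case \<open>b = 0\<close> is the convention \<open>\<beta>\<^bsub>1,0\<^esub> = 1\<close>.\<close>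

definition beta_law :: "real \<Rightarrow> real \<Rightarrow> real measure" where
  "beta_law a b = (if b = 0 then return borel 1 else density lborel (\<lambda>x. ennreal (beta_density a b x)))"

text \<open>Ferguson's definition: normalise independent gamma variables. Unlike the density on the
  simplex, it also covers parameters some (but not all) of which are zero.\<close>

definition dirichlet_law :: "'i set \<Rightarrow> ('i \<Rightarrow> real) \<Rightarrow> ('i \<Rightarrow> real) measure" where
  "dirichlet_law I a =
     distr (\<Pi>\<^sub>M i\<in>I. gamma_law (a i)) (\<Pi>\<^sub>M i\<in>I. borel) (\<lambda>g. \<lambda>i\<in>I. g i / (\<Sum>j\<in>I. g j))"

section \<open>Dirichlet processes on the half-line and their means\<close>

text \<open>A probability measure on \<open>[0,\<infinity>)\<close> is represented as a Borel probability measure on the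
  real line that gives mass one to \<open>{0..}\<close>, so that \<^const>\<open>cdf\<close> applies to it.\<close>

definition dirichlet_process ::
  "'w measure \<Rightarrow> real \<Rightarrow> real measure \<Rightarrow> ('w \<Rightarrow> real measure) \<Rightarrow> bool" where
  "dirichlet_process \<Omega> \<theta> F P \<longleftrightarrow>
     0 < \<theta> \<and>
     F \<in> space (prob_algebra borel) \<and> measure F {0..} = 1 \<and>
     P \<in> \<Omega> \<rightarrow>\<^sub>M prob_algebra borel \<and> (\<forall>\<omega>\<in>space \<Omega>. measure (P \<omega>) {0..} = 1) \<and>
     (\<forall>(k::nat) C. (\<forall>i<k. C i \<in> sets borel) \<and> disjoint_family_on C {..<k} \<and> (\<Union>i<k. C i) = {0..} \<longrightarrow>
        distr \<Omega> (\<Pi>\<^sub>M i\<in>{..<k}. borel) (\<lambda>\<omega>. \<lambda>i\<in>{..<k}. measure (P \<omega>) (C i))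
          = dirichlet_law {..<k} (\<lambda>i. \<theta> * measure F (C i)))"

text \<open>The Bochner integral is zero at those \<open>\<omega>\<close> for which the mean is infinite.\<close>

definition random_mean :: "('w \<Rightarrow> real measure) \<Rightarrow> 'w \<Rightarrow> real" where
  "random_mean P \<omega> = (\<integral>x. x \<partial>P \<omega>)"

section \<open>Functionals of a distribution\<close>

text \<open>The Bochner integral is zero at those \<open>t\<close> for which the expectation is \<open>-\<infinity>\<close>. If \<open>F\<close> has a
  finite logarithmic moment, these \<open>t\<close> form a Lebesgue null set, since \<open>ln\<close> is locally integrable.\<close>

definition Phi :: "real measure \<Rightarrow> real \<Rightarrow> real" where
  "Phi F t = (\<integral>x. ln \<bar>t - x\<bar> * of_bool (t \<noteq> x) \<partial>F)"

definition cdf_jump :: "real measure \<Rightarrow> real \<Rightarrow> real" where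
  "cdf_jump F x = cdf F x - Lim (at_left x) (cdf F)"

end

theory Submission
  imports Defs "HOL-Complex_Analysis.Conformal_Mappings"
begin

text \<open>
  The law of a Dirichlet mean \<open>M = M\<^sub>\<theta>(F)\<close> is known through the Markov-Krein identity
  \<open>E (1 + l M)\<^sup>-\<^sup>\<theta> = exp (- \<theta> \<integral> ln (1 + l x) F(dx))\<close> for \<open>l > 0\<close>, which is \<open>markov_krein\<close> below. For finitely
  many cells it expresses that normalised gamma variables are independent of their sum; the general
  case follows by monotone approximation, and \<open>l \<rightarrow> 0\<close> shows that the mean is almost surely finite.

  The two variables \<open>M\<^sub>1(F\<^sub>X\<^sub>Y)\<close> and \<open>\<beta> M\<^sub>\<sigma>(F\<^sub>X)\<close> have the same Stieltjes transform
  \<open>E (1 + l M)\<^sup>-\<^sup>1 = exp (- \<integral> ln (1 + l x) F\<^sub>X\<^sub>Y(dx))\<close>. For the first this is the identity with \<open>\<theta> = 1\<close>. For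
  the second, averaging \<open>(1 + l \<beta> m)\<^sup>-\<^sup>1\<close> over the beta variable yields \<open>(1 + l m)\<^sup>-\<^sup>\<sigma>\<close>, and
  \<open>\<sigma> \<integral> ln (1 + l x) F\<^sub>X(dx)\<close> is the integral under \<open>F\<^sub>X\<^sub>Y\<close>, the mixture of \<open>F\<^sub>X\<close> and the point mass at zero,
  where the logarithm vanishes. The beta average is a consequence of \<open>G\<^sub>1 \<beta> = G\<^sub>\<sigma>\<close> in law, and so is the
  equality of the laws of \<open>G\<^sub>\<sigma> M\<^sub>\<sigma>(F\<^sub>X)\<close> and \<open>G\<^sub>1 M\<^sub>1(F\<^sub>X\<^sub>Y)\<close>.

  It remains to invert the Stieltjes transform, in \<open>stieltjes_inversion\<close>. The identity
  \<open>\<integral> 1 / (s + x) \<mu>(dx) = exp (- \<integral> ln (s + x) F(dx))\<close> extends from \<open>s > 0\<close> to the plane slit along the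
  negative axis. At \<open>s = - t + \<i> \<epsilon>\<close> the imaginary part of the left-hand side is a Poisson integral of \<open>\<mu>\<close>,
  which recovers \<open>\<mu>\<close> as \<open>\<epsilon> \<rightarrow> 0\<close>; that of the right-hand side tends to
  \<open>exp (- \<Phi>\<^sub>F(t)) sin (pi F(t))\<close> for almost all \<open>t\<close>. Pointwise convergence alone would leave room for a
  singular part of \<open>\<mu>\<close>. It is excluded by local domination: a point has a neighbourhood of \<open>F\<close>-mass \<open>p < 1\<close>
  because there is no jump of size one, and by Jensen's inequality the right-hand side is at most a
  multiple of \<open>1 + \<integral> \<bar>t - x\<bar>\<^sup>-\<^sup>p F(dx)\<close> there, which is integrable in \<open>t\<close>.

  The inversion formula applies to both variables with the same right-hand side. It therefore yields the
  density and the equality of their laws at once.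
\<close>

section \<open>Gamma laws\<close>

text \<open>A nonnegative function with a known integral is absolutely integrable, so substitution becomes an
  identity of nonnegative integrals.\<close>

lemma nn_integral_change_of_variables:
  fixes f g g' :: "real \<Rightarrow> real"
  assumes S: "S \<in> sets lebesgue"
    and der: "\<And>x. x \<in> S \<Longrightarrow> (g has_real_derivative g' x) (at x within S)"
    and inj: "inj_on g S"
    and nn: "\<And>x. x \<in> g ` S \<Longrightarrow> 0 \<le> f x"
    and I: "(f has_integral b) (g ` S)"
  shows "(\<integral>\<^sup>+x. ennreal (\<bar>g' x\<bar> * f (g x)) * indicator S x \<partial>lborel) = ennreal b"
proof -
  have "f absolutely_integrable_on (g ` S) \<and> integral (g ` S) f = b"
    using nonnegative_absolutely_integrable_1[of f "g ` S", OF _ nn] I by (auto simp: integrable_on_def)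
  then have "(\<lambda>x. \<bar>g' x\<bar> * f(g x)) absolutely_integrable_on S" "integral S (\<lambda>x. \<bar>g' x\<bar> * f (g x)) = b"
    using has_absolute_integral_change_of_variables_1'[OF S der inj, of f b] by auto
  then have "((\<lambda>x. \<bar>g' x\<bar> * f(g x)) has_integral b) S"
    by (metis absolutely_integrable_on_def has_integral_integral)
  then show ?thesis
    by (intro nn_integral_has_integral_lebesgue') (auto simp: nn)
qed

lemma Gamma_integral_real_open:
  assumes "0 < (a::real)"
  shows "((\<lambda>t. t powr (a - 1) / exp t) has_integral Gamma a) {0<..}"
proof (rule iffD1[OF has_integral_spike_set_eq Gamma_integral_real[OF assms]])
  have *: "{x \<in> {0..} - {0<..}. x powr (a - 1) / exp x \<noteq> 0} = {}" by (auto simp: not_less)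
  show "negligible {x \<in> {0..} - {0<..}. x powr (a - 1) / exp x \<noteq> 0}" unfolding * by simp
  have *: "{x \<in> {0<..} - {0..}. x powr (a - 1) / exp x \<noteq> 0} = {}" by auto
  show "negligible {x \<in> {0<..} - {0..}. x powr (a - 1) / exp x \<noteq> 0}" unfolding * by simp
qed

lemma nn_integral_Gamma:
  fixes a p :: real
  assumes "0 < a" "0 < p"
  shows "(\<integral>\<^sup>+t. ennreal (t powr (a - 1) * exp (- p * t)) * indicator {0<..} t \<partial>lborel)
    = ennreal (Gamma a * p powr - a)"
proof -
  have "((\<lambda>t. t powr (a - 1) / exp t) has_integral Gamma a) {0<..}"
    by (rule Gamma_integral_real_open) fact
  moreover have "(*) p ` {0<..} = {0<..}"
    using \<open>0 < p\<close> by (auto simp: image_iff intro!: bexI[of _ "_ / p"])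
  ultimately have "(\<integral>\<^sup>+t. ennreal (\<bar>p\<bar> * ((p * t) powr (a - 1) / exp (p * t))) * indicator {0<..} t \<partial>lborel)
     = ennreal (Gamma a)"
    using \<open>0 < p\<close> by (intro nn_integral_change_of_variables) (auto intro!: derivative_eq_intros inj_onI)
  then have "ennreal (p powr - a) * (\<integral>\<^sup>+t. ennreal (\<bar>p\<bar> * ((p * t) powr (a - 1) / exp (p * t))) * indicator {0<..} t \<partial>lborel)
     = ennreal (Gamma a * p powr - a)"
    by (simp only: ennreal_mult''[OF powr_ge_zero] mult.commute)
  moreover have "ennreal (p powr - a) * (\<integral>\<^sup>+t. ennreal (\<bar>p\<bar> * ((p * t) powr (a - 1) / exp (p * t))) * indicator {0<..} t \<partial>lborel)
    = (\<integral>\<^sup>+t. ennreal (p powr - a) * (ennreal (\<bar>p\<bar> * ((p * t) powr (a - 1) / exp (p * t))) * indicator {0<..} t) \<partial>lborel)"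
    by (rule nn_integral_cmult[symmetric]) simp
  moreover have eq: "p powr - a * (\<bar>p\<bar> * ((p * t) powr (a - 1) / exp (p * t))) = t powr (a - 1) * exp (- p * t)" if "0 < t" for t
  proof -
    have "p powr - a * \<bar>p\<bar> * p powr (a - 1) = p powr (- a + 1 + (a - 1))"
      using \<open>0 < p\<close> unfolding powr_add by (simp add: powr_diff)
    then show ?thesis
      using that \<open>0 < p\<close> by (simp add: powr_mult exp_minus field_simps)
  qed
  moreover have "(\<integral>\<^sup>+t. ennreal (p powr - a) * (ennreal (\<bar>p\<bar> * ((p * t) powr (a - 1) / exp (p * t))) * indicator {0<..} t) \<partial>lborel)
    = (\<integral>\<^sup>+t. ennreal (t powr (a - 1) * exp (- p * t)) * indicator {0<..} t \<partial>lborel)"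
    by (intro nn_integral_cong, unfold mult.assoc[symmetric] ennreal_mult'[OF powr_ge_zero, symmetric])
      (use eq[unfolded mult.assoc[symmetric]] in \<open>auto simp: indicator_def\<close>)
  ultimately show ?thesis by simp
qed

text \<open>The gamma integral after the substitution \<open>t \<mapsto> p / t\<close>. It undoes the scaling of the total mass in
  the computation for Dirichlet vectors.\<close>

lemma nn_integral_inverse_Gamma:
  fixes a p :: real
  assumes "0 < a" "0 < p"
  shows "(\<integral>\<^sup>+t. ennreal (t powr (- a - 1) * exp (- p / t)) * indicator {0<..} t \<partial>lborel)
    = ennreal (Gamma a * p powr - a)"
proof -
  have "((\<lambda>t. t powr (a - 1) / exp t) has_integral Gamma a) {0<..}"
    by (rule Gamma_integral_real_open) fact
  moreover have "(\<lambda>t. p / t) ` {0<..} = {0<..}"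
    using \<open>0 < p\<close> by (auto simp: image_iff intro!: bexI[of _ "p / _"])
  ultimately have "(\<integral>\<^sup>+t. ennreal (\<bar>- p / t^2\<bar> * ((p / t) powr (a - 1) / exp (p / t))) * indicator {0<..} t \<partial>lborel)
     = ennreal (Gamma a)"
    using \<open>0 < p\<close> by (intro nn_integral_change_of_variables) (auto intro!: derivative_eq_intros inj_onI simp: field_simps power2_eq_square)
  then have "ennreal (p powr - a) * (\<integral>\<^sup>+t. ennreal (\<bar>- p / t^2\<bar> * ((p / t) powr (a - 1) / exp (p / t))) * indicator {0<..} t \<partial>lborel)
     = ennreal (Gamma a * p powr - a)"
    by (simp only: ennreal_mult''[OF powr_ge_zero] mult.commute)
  moreover have "ennreal (p powr - a) * (\<integral>\<^sup>+t. ennreal (\<bar>- p / t^2\<bar> * ((p / t) powr (a - 1) / exp (p / t))) * indicator {0<..} t \<partial>lborel)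
    = (\<integral>\<^sup>+t. ennreal (p powr - a) * (ennreal (\<bar>- p / t^2\<bar> * ((p / t) powr (a - 1) / exp (p / t))) * indicator {0<..} t) \<partial>lborel)"
    by (rule nn_integral_cmult[symmetric]) simp
  moreover have eq: "p powr - a * (\<bar>- p / t^2\<bar> * ((p / t) powr (a - 1) / exp (p / t))) = t powr (- a - 1) * exp (- p / t)" if "0 < t" for t
  proof -
    have "p powr - a * p * p powr (a - 1) = p powr (- a + 1 + (a - 1))"
      using \<open>0 < p\<close> unfolding powr_add by simp
    moreover have "t powr (- a - 1) = t powr (- 2 + - (a - 1))" by (rule arg_cong[where f = "(powr) t"]) simp
    then have "t powr (- a - 1) = inverse (t^2) * inverse (t powr (a - 1))"
      using that by (simp only: powr_add powr_minus powr_numeral)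
    ultimately show ?thesis
      using that \<open>0 < p\<close> by (simp add: powr_divide exp_minus field_simps)
  qed
  moreover have "(\<integral>\<^sup>+t. ennreal (p powr - a) * (ennreal (\<bar>- p / t^2\<bar> * ((p / t) powr (a - 1) / exp (p / t))) * indicator {0<..} t) \<partial>lborel)
    = (\<integral>\<^sup>+t. ennreal (t powr (- a - 1) * exp (- p / t)) * indicator {0<..} t \<partial>lborel)"
    by (intro nn_integral_cong, unfold mult.assoc[symmetric] ennreal_mult'[OF powr_ge_zero, symmetric])
      (use eq[unfolded mult.assoc[symmetric]] in \<open>auto simp: indicator_def\<close>)
  ultimately show ?thesis by simp
qed

lemma sets_gamma_law [simp, measurable_cong]: "sets (gamma_law a) = sets borel"
  by (simp add: gamma_law_def)

lemma measurable_gamma_density [measurable]: "gamma_density a \<in> borel_measurable borel"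
  unfolding gamma_density_def[abs_def] by measurable

lemma gamma_density_nonneg: "0 < a \<Longrightarrow> 0 \<le> gamma_density a x"
  by (simp add: gamma_density_def Gamma_real_pos less_imp_le)

lemma nn_integral_gamma_law:
  assumes "0 < a" "f \<in> borel_measurable borel"
  shows "(\<integral>\<^sup>+x. f x \<partial>gamma_law a) = (\<integral>\<^sup>+x. ennreal (gamma_density a x) * f x \<partial>lborel)"
  using assms by (simp add: gamma_law_def nn_integral_density)

text \<open>The parameter may vanish: the point mass at zero has Laplace transform \<open>1 = (1 + s) powr 0\<close>, which
  covers partition cells of zero mass.\<close>

lemma nn_integral_gamma_law_exp:
  assumes "0 \<le> a" "- 1 < s"
  shows "(\<integral>\<^sup>+x. ennreal (exp (- s * x)) \<partial>gamma_law a) = ennreal ((1 + s) powr - a)"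
proof (cases "a = 0")
  case True
  then show ?thesis
    using assms by (simp add: gamma_law_def nn_integral_return)
next
  case False
  then have a: "0 < a" using assms by simp
  have "(\<integral>\<^sup>+x. ennreal (exp (- s * x)) \<partial>gamma_law a)
    = (\<integral>\<^sup>+x. ennreal (1 / Gamma a) * (ennreal (x powr (a - 1) * exp (- (1 + s) * x)) * indicator {0<..} x) \<partial>lborel)"
    using a by (subst nn_integral_gamma_law)
      (auto intro!: nn_integral_cong simp: gamma_density_def indicator_def algebra_simps exp_add exp_diff exp_minus
        ennreal_mult'[symmetric] Gamma_real_pos less_imp_le field_simps)
  also have "\<dots> = ennreal (1 / Gamma a) * ennreal (Gamma a * (1 + s) powr - a)"
    using nn_integral_Gamma[OF a, of "1 + s"] assms by (subst nn_integral_cmult) auto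
  also have "\<dots> = ennreal ((1 + s) powr - a)"
    using Gamma_real_pos[OF a] by (simp add: ennreal_mult'[symmetric])
  finally show ?thesis .
qed

lemma prob_space_gamma_law:
  assumes "0 \<le> a" shows "prob_space (gamma_law a)"
  using nn_integral_gamma_law_exp[OF assms, of 0] by (intro prob_spaceI) simp

lemma AE_gamma_law_pos:
  assumes "0 < a" shows "AE x in gamma_law a. 0 < x"
  unfolding gamma_law_def using assms by (auto simp: AE_density gamma_density_def)

lemma AE_gamma_law_nonneg: "0 \<le> a \<Longrightarrow> AE x in gamma_law a. 0 \<le> x"
proof (cases "a = 0")
  case True
  then show ?thesis using AE_return[of "0::real" borel "\<lambda>x. 0 \<le> x"] unfolding gamma_law_def by simp
next
  case False
  moreover assume "0 \<le> a"
  ultimately have "AE x in gamma_law a. 0 < x" by (intro AE_gamma_law_pos) simp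
  then show ?thesis by eventually_elim simp
qed

text \<open>Tilting a gamma law exponentially amounts to rescaling it, because the density is homogeneous
  apart from its exponential factor.\<close>

lemma density_gamma_law_exp:
  assumes "0 \<le> a" "0 < t"
  shows "density (gamma_law a) (\<lambda>x. ennreal (t powr a * exp (- (t - 1) * x)))
    = distr (gamma_law a) borel (\<lambda>x. x / t)" (is "?L = ?R")
proof (rule measure_eqI)
  fix A assume "A \<in> sets ?L"
  then have A[measurable]: "A \<in> sets borel" by simp
  show "emeasure ?L A = emeasure ?R A"
  proof (cases "a = 0")
    case True
    have "(\<lambda>x. x / t) -` A \<in> sets borel" by (rule measurable_sets_borel[OF _ A]) measurable
    with True assms A show ?thesis
      by (simp add: gamma_law_def emeasure_density nn_integral_return emeasure_distr split: split_indicator)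
  next
    case False
    with assms have a: "0 < a" by simp
    have "emeasure ?R A = (\<integral>\<^sup>+x. indicator A x \<partial>?R)" by simp
    also have "\<dots> = (\<integral>\<^sup>+x. indicator A (x / t) \<partial>gamma_law a)"
      by (subst nn_integral_distr) auto
    also have "\<dots> = (\<integral>\<^sup>+x. ennreal (gamma_density a x) * indicator A (x / t) \<partial>lborel)"
      using a by (subst nn_integral_gamma_law) auto
    also have "\<dots> = ennreal \<bar>t\<bar> * (\<integral>\<^sup>+x. ennreal (gamma_density a (0 + t * x)) * indicator A ((0 + t * x) / t) \<partial>lborel)"
      using \<open>0 < t\<close> by (subst nn_integral_real_affine[where c = t and t = 0]) auto
    also have "\<dots> = (\<integral>\<^sup>+x. ennreal (gamma_density a x) * (ennreal (t powr a * exp (- (t - 1) * x)) * indicator A x) \<partial>lborel)"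
      using \<open>0 < t\<close> a
      by (subst nn_integral_cmult[symmetric])
        (auto intro!: nn_integral_cong simp: gamma_density_def indicator_def zero_less_mult_iff powr_mult powr_diff exp_diff exp_minus
          algebra_simps ennreal_mult'[symmetric] Gamma_real_pos less_imp_le field_simps)
    also have "\<dots> = emeasure ?L A"
      using a by (subst nn_integral_gamma_law[symmetric]) (auto simp: emeasure_density)
    finally show ?thesis ..
  qed
qed simp

section \<open>Dirichlet vectors\<close>

text \<open>A common tilting parameter rescales all coordinates by the same factor, so the coordinates of the
  normalised vector do not change. This expresses the independence of a Dirichlet vector and its
  total mass in a form that suits integration.\<close>

lemma density_PiM_gamma_law_exp:
  assumes I: "finite I" and a: "\<And>i. 0 \<le> a i" and t: "0 < t"
  defines "G \<equiv> \<Pi>\<^sub>M i\<in>I. gamma_law (a i)"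
  shows "density G (\<lambda>g. \<Prod>i\<in>I. ennreal (t powr a i * exp (- (t - 1) * g i)))
    = distr G (\<Pi>\<^sub>M i\<in>I. borel) (\<lambda>g. \<lambda>i\<in>I. g i / t)" (is "?L = ?R")
proof -
  let ?N = "\<lambda>i. distr (gamma_law (a i)) borel (\<lambda>x. x / t)"
  interpret G: product_prob_space "\<lambda>i. gamma_law (a i)" I
    by (simp add: product_prob_space_def product_prob_space_axioms_def product_sigma_finite_def
        prob_space_gamma_law a prob_space_imp_sigma_finite)
  have "prob_space (?N i)" for i
    by (intro prob_space.prob_space_distr prob_space_gamma_law a) simp
  then interpret N: product_prob_space ?N I
    by (simp add: product_prob_space_def product_prob_space_axioms_def product_sigma_finite_def prob_space_imp_sigma_finite)
  have sets_G[measurable_cong]: "sets G = sets (\<Pi>\<^sub>M i\<in>I. borel)"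
    unfolding G_def by (intro sets_PiM_cong) auto
  have space_G: "space G = (\<Pi>\<^sub>E i\<in>I. UNIV)"
    by (simp add: sets_eq_imp_space_eq[OF sets_G] space_PiM)
  have sets_N: "sets (\<Pi>\<^sub>M i\<in>I. ?N i) = sets (\<Pi>\<^sub>M i\<in>I. borel)"
    by (intro sets_PiM_cong) auto
  have [measurable]: "(\<lambda>g. \<lambda>i\<in>I. g i / t) \<in> measurable G (\<Pi>\<^sub>M i\<in>I. borel)"
    unfolding measurable_cong_sets[OF sets_G refl] by measurable
  have "?L = PiM I ?N"
  proof (rule N.PiM_eqI[OF I])
    show "sets ?L = sets (PiM I ?N)" by (simp add: sets_G sets_N)
    fix A assume A: "\<And>i. i \<in> I \<Longrightarrow> A i \<in> sets (?N i)"
    then have [measurable]: "\<And>i. i \<in> I \<Longrightarrow> A i \<in> sets borel" by simp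
    have [measurable]: "Pi\<^sub>E I A \<in> sets G"
      unfolding sets_G by (intro sets_PiM_I_finite I) auto
    have "emeasure ?L (Pi\<^sub>E I A) = (\<integral>\<^sup>+g. (\<Prod>i\<in>I. ennreal (t powr a i * exp (- (t - 1) * g i))) * indicator (Pi\<^sub>E I A) g \<partial>G)"
      by (subst emeasure_density) (auto simp: measurable_cong_sets[OF sets_G refl])
    also have "\<dots> = (\<integral>\<^sup>+g. (\<Prod>i\<in>I. ennreal (t powr a i * exp (- (t - 1) * g i)) * indicator (A i) (g i)) \<partial>G)"
    proof (intro nn_integral_cong)
      fix g assume "g \<in> space G"
      then have "indicator (Pi\<^sub>E I A) g = (\<Prod>i\<in>I. indicator (A i) (g i) :: ennreal)"
        using I by (auto simp: space_G PiE_iff indicator_def prod_zero_iff)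
      then show "(\<Prod>i\<in>I. ennreal (t powr a i * exp (- (t - 1) * g i))) * indicator (Pi\<^sub>E I A) g
          = (\<Prod>i\<in>I. ennreal (t powr a i * exp (- (t - 1) * g i)) * indicator (A i) (g i))"
        by (simp add: prod.distrib)
    qed
    also have "\<dots> = (\<Prod>i\<in>I. \<integral>\<^sup>+x. ennreal (t powr a i * exp (- (t - 1) * x)) * indicator (A i) x \<partial>gamma_law (a i))"
      unfolding G_def using I by (intro G.product_nn_integral_prod) auto
    also have "\<dots> = (\<Prod>i\<in>I. emeasure (?N i) (A i))"
      by (intro prod.cong refl) (auto simp: emeasure_density density_gamma_law_exp[OF a t, symmetric])
    finally show "emeasure ?L (Pi\<^sub>E I A) = (\<Prod>i\<in>I. emeasure (?N i) (A i))" .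
  qed
  moreover have "?R = PiM I ?N"
  proof (rule N.PiM_eqI[OF I])
    show "sets ?R = sets (PiM I ?N)" by (simp add: sets_N)
    fix A assume A: "\<And>i. i \<in> I \<Longrightarrow> A i \<in> sets (?N i)"
    then have [measurable]: "\<And>i. i \<in> I \<Longrightarrow> A i \<in> sets borel" by simp
    have "emeasure ?R (Pi\<^sub>E I A) = emeasure G ((\<lambda>g. \<lambda>i\<in>I. g i / t) -` Pi\<^sub>E I A \<inter> space G)"
      by (intro emeasure_distr sets_PiM_I_finite I) auto
    also have "(\<lambda>g. \<lambda>i\<in>I. g i / t) -` Pi\<^sub>E I A \<inter> space G = Pi\<^sub>E I (\<lambda>i. (\<lambda>x. x / t) -` A i)"
      by (auto simp: space_G PiE_iff)
    also have "emeasure G \<dots> = (\<Prod>i\<in>I. emeasure (gamma_law (a i)) ((\<lambda>x. x / t) -` A i))"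
      unfolding G_def using I by (intro G.emeasure_PiM) (auto intro: measurable_sets_borel[where M = borel])
    also have "\<dots> = (\<Prod>i\<in>I. emeasure (?N i) (A i))"
      by (intro prod.cong refl) (auto simp: emeasure_distr sets_eq_imp_space_eq[OF sets_gamma_law])
    finally show "emeasure ?R (Pi\<^sub>E I A) = (\<Prod>i\<in>I. emeasure (?N i) (A i))" .
  qed
  ultimately show ?thesis by simp
qed

text \<open>The Markov-Krein identity for a finite partition. Write \<open>S = \<Sum>g\<^sub>i\<close> and \<open>L = \<Sum>c\<^sub>i g\<^sub>i\<close> for independent
  gamma variables \<open>g\<^sub>i\<close> with total parameter \<open>\<theta>\<close>. The left-hand side is the expectation of
  \<open>(S / (S + L))\<^sup>\<theta>\<close>. Expanding \<open>(S + L)\<^sup>-\<^sup>\<theta>\<close> as a gamma integral over \<open>t\<close>, rescaling \<open>g\<close> by \<open>1 / t\<close> for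
  each \<open>t\<close> and carrying out the integral over \<open>t\<close> turns it into the expectation of \<open>exp (- L)\<close>, which
  factorises over the coordinates.\<close>

lemma nn_integral_dirichlet_law_powr:
  fixes a c :: "'i \<Rightarrow> real"
  assumes I: "finite I" and a: "\<And>i. 0 \<le> a i" and c: "\<And>i. i \<in> I \<Longrightarrow> 0 \<le> c i" and pos: "0 < (\<Sum>i\<in>I. a i)"
  shows "(\<integral>\<^sup>+d. ennreal ((1 + (\<Sum>i\<in>I. c i * d i)) powr - (\<Sum>i\<in>I. a i)) \<partial>dirichlet_law I a)
    = ennreal (\<Prod>i\<in>I. (1 + c i) powr - a i)"
proof -
  define \<theta> where "\<theta> = (\<Sum>i\<in>I. a i)"
  define G where "G = (\<Pi>\<^sub>M i\<in>I. gamma_law (a i))"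
  define S where "S g = (\<Sum>i\<in>I. g i)" for g :: "'i \<Rightarrow> real"
  define L where "L g = (\<Sum>i\<in>I. c i * g i)" for g :: "'i \<Rightarrow> real"
  have \<theta>: "0 < \<theta>" using pos by (simp add: \<theta>_def)
  interpret G: product_prob_space "\<lambda>i. gamma_law (a i)" I
    by (simp add: product_prob_space_def product_prob_space_axioms_def product_sigma_finite_def
        prob_space_gamma_law a prob_space_imp_sigma_finite)
  have sets_G[measurable_cong]: "sets G = sets (\<Pi>\<^sub>M i\<in>I. borel)"
    unfolding G_def by (intro sets_PiM_cong) auto
  have space_G: "space G = (\<Pi>\<^sub>E i\<in>I. UNIV)"
    by (simp add: sets_eq_imp_space_eq[OF sets_G] space_PiM)
  have [measurable]: "S \<in> borel_measurable (\<Pi>\<^sub>M i\<in>I. borel)" "L \<in> borel_measurable (\<Pi>\<^sub>M i\<in>I. borel)"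
    unfolding S_def[abs_def] L_def[abs_def] by measurable
  have [measurable]: "S \<in> borel_measurable G" "L \<in> borel_measurable G"
    by (auto simp: measurable_cong_sets[OF sets_G refl])
  interpret prob_space G
    unfolding G_def by (rule prob_space_PiM) (auto intro: prob_space_gamma_law a)
  have AE_comp: "AE g in G. P (g i)" if "i \<in> I" "AE x in gamma_law (a i). P x" for i P
    unfolding G_def using that by (intro AE_PiM_component prob_space_gamma_law a) auto
  have nonneg: "AE g in G. \<forall>i\<in>I. 0 \<le> g i"
    using I by (auto simp: AE_finite_all AE_comp AE_gamma_law_nonneg a)
  obtain i where i: "i \<in> I" "0 < a i"
    using pos a by (metis less_eq_real_def less_irrefl sum.neutral)
  have S_pos: "AE g in G. 0 < S g"
    using nonneg AE_comp[OF i(1) AE_gamma_law_pos[OF i(2)]]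
  proof eventually_elim
    case (elim g)
    then have "g i \<le> S g" unfolding S_def using I i by (intro member_le_sum) auto
    with elim show ?case by simp
  qed
  have L_nonneg: "AE g in G. 0 \<le> L g"
    using nonneg by eventually_elim (auto simp: L_def c intro!: sum_nonneg)

  have tilt: "(\<integral>\<^sup>+g. ennreal (exp (- (t - 1) * S g)) * f g \<partial>G) = ennreal (t powr - \<theta>) * (\<integral>\<^sup>+g. f (\<lambda>i\<in>I. g i / t) \<partial>G)"
    if t: "0 < t" and f[measurable]: "f \<in> borel_measurable (\<Pi>\<^sub>M i\<in>I. borel)" for f :: "('i \<Rightarrow> real) \<Rightarrow> ennreal" and t
  proof -
    have [measurable]: "(\<lambda>g. \<lambda>i\<in>I. g i / t) \<in> measurable G (\<Pi>\<^sub>M i\<in>I. borel)" "f \<in> borel_measurable G"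
      unfolding measurable_cong_sets[OF sets_G refl] by measurable
    have P: "(\<Prod>i\<in>I. ennreal (t powr a i * exp (- (t - 1) * g i))) = ennreal (t powr \<theta> * exp (- (t - 1) * S g))" for g
      using I t by (subst prod_ennreal) (auto simp: prod.distrib S_def \<theta>_def powr_sum exp_sum sum_distrib_left)
    have "(\<integral>\<^sup>+g. f (\<lambda>i\<in>I. g i / t) \<partial>G) = (\<integral>\<^sup>+g. f g \<partial>distr G (\<Pi>\<^sub>M i\<in>I. borel) (\<lambda>g. \<lambda>i\<in>I. g i / t))"
      by (subst nn_integral_distr) auto
    also have "\<dots> = (\<integral>\<^sup>+g. ennreal (t powr \<theta> * exp (- (t - 1) * S g)) * f g \<partial>G)"
      unfolding G_def density_PiM_gamma_law_exp[OF I a t, symmetric] P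
      by (subst nn_integral_density) (auto simp: G_def[symmetric])
    also have "\<dots> = ennreal (t powr \<theta>) * (\<integral>\<^sup>+g. ennreal (exp (- (t - 1) * S g)) * f g \<partial>G)"
      by (subst nn_integral_cmult[symmetric]) (auto simp: ennreal_mult' mult.assoc)
    finally have "ennreal (t powr - \<theta>) * (\<integral>\<^sup>+g. f (\<lambda>i\<in>I. g i / t) \<partial>G) =
       ennreal (t powr - \<theta> * t powr \<theta>) * (\<integral>\<^sup>+g. ennreal (exp (- (t - 1) * S g)) * f g \<partial>G)"
      by (simp add: ennreal_mult' mult.assoc)
    then show ?thesis using t by (simp add: powr_add[symmetric])
  qed

  have dirichlet: "dirichlet_law I a = distr G (\<Pi>\<^sub>M i\<in>I. borel) (\<lambda>g. \<lambda>i\<in>I. g i / S g)"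
    by (simp add: dirichlet_law_def G_def S_def[abs_def])
  have "(\<integral>\<^sup>+d. ennreal ((1 + (\<Sum>i\<in>I. c i * d i)) powr - \<theta>) \<partial>dirichlet_law I a)
      = (\<integral>\<^sup>+g. ennreal ((1 + (\<Sum>i\<in>I. c i * (g i / S g))) powr - \<theta>) \<partial>G)"
    unfolding dirichlet
    by (subst nn_integral_distr) (auto simp: measurable_cong_sets[OF sets_G refl] intro!: nn_integral_cong)
  also have "\<dots> = (\<integral>\<^sup>+g. \<integral>\<^sup>+t. ennreal (1 / Gamma \<theta> * S g powr \<theta> * (t powr (\<theta> - 1) * exp (- (S g + L g) * t))) * indicator {0<..} t \<partial>lborel \<partial>G)"
  proof (intro nn_integral_cong_AE, use S_pos L_nonneg in eventually_elim)
    case (elim g)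
    then have *: "0 < S g + L g" by simp
    have "(\<integral>\<^sup>+t. ennreal (1 / Gamma \<theta> * S g powr \<theta> * (t powr (\<theta> - 1) * exp (- (S g + L g) * t))) * indicator {0<..} t \<partial>lborel)
      = (\<integral>\<^sup>+t. ennreal (1 / Gamma \<theta> * S g powr \<theta>) * (ennreal (t powr (\<theta> - 1) * exp (- (S g + L g) * t)) * indicator {0<..} t) \<partial>lborel)"
      using Gamma_real_pos[OF \<theta>] by (intro nn_integral_cong, subst ennreal_mult') (auto simp: mult.assoc)
    also have "\<dots> = ennreal (1 / Gamma \<theta> * S g powr \<theta>) * ennreal (Gamma \<theta> * (S g + L g) powr - \<theta>)"
      using nn_integral_Gamma[OF \<theta> *] by (subst nn_integral_cmult) auto
    also have "\<dots> = ennreal (((S g + L g) / S g) powr - \<theta>)"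
      using Gamma_real_pos[OF \<theta>] elim
      by (simp add: ennreal_mult'[symmetric] powr_divide powr_minus field_simps)
    also have "(S g + L g) / S g = 1 + (\<Sum>i\<in>I. c i * (g i / S g))"
      using elim by (simp add: add_divide_distrib L_def sum_divide_distrib)
    finally show ?case ..
  qed
  also have "\<dots> = (\<integral>\<^sup>+t. \<integral>\<^sup>+g. ennreal (1 / Gamma \<theta> * S g powr \<theta> * (t powr (\<theta> - 1) * exp (- (S g + L g) * t))) * indicator {0<..} t \<partial>G \<partial>lborel)"
    by (rule pair_sigma_finite.Fubini'[symmetric, OF pair_sigma_finite.intro]) 
      (auto intro: prob_space_imp_sigma_finite prob_space_axioms lborel.sigma_finite_measure_axioms)
  also have "\<dots> = (\<integral>\<^sup>+t. \<integral>\<^sup>+g. ennreal (1 / Gamma \<theta> * exp (- L g) * S g powr \<theta> * (t powr (- \<theta> - 1) * exp (- S g / t))) * indicator {0<..} t \<partial>G \<partial>lborel)"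
  proof (rule nn_integral_cong)
    fix t :: real
    show "(\<integral>\<^sup>+g. ennreal (1 / Gamma \<theta> * S g powr \<theta> * (t powr (\<theta> - 1) * exp (- (S g + L g) * t))) * indicator {0<..} t \<partial>G)
      = (\<integral>\<^sup>+g. ennreal (1 / Gamma \<theta> * exp (- L g) * S g powr \<theta> * (t powr (- \<theta> - 1) * exp (- S g / t))) * indicator {0<..} t \<partial>G)"
    proof (cases "0 < t")
      case t: True
      let ?f = "\<lambda>g. ennreal (1 / Gamma \<theta> * S g powr \<theta> * (t powr (\<theta> - 1) * exp (- S g - L g * t)))"
      have "(\<integral>\<^sup>+g. ennreal (1 / Gamma \<theta> * S g powr \<theta> * (t powr (\<theta> - 1) * exp (- (S g + L g) * t))) * indicator {0<..} t \<partial>G)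
        = (\<integral>\<^sup>+g. ennreal (exp (- (t - 1) * S g)) * ?f g \<partial>G)"
        using t Gamma_real_pos[OF \<theta>]
        by (intro nn_integral_cong) (simp add: ennreal_mult'[symmetric] exp_add[symmetric] algebra_simps exp_minus exp_diff field_simps)
      also have "\<dots> = ennreal (t powr - \<theta>) * (\<integral>\<^sup>+g. ?f (\<lambda>i\<in>I. g i / t) \<partial>G)"
        using t by (rule tilt) measurable
      also have "\<dots> = (\<integral>\<^sup>+g. ennreal (t powr - \<theta>) * ?f (\<lambda>i\<in>I. g i / t) \<partial>G)"
        by (rule nn_integral_cmult[symmetric]) (simp add: measurable_cong_sets[OF sets_G refl])
      also have "\<dots> = (\<integral>\<^sup>+g. ennreal (1 / Gamma \<theta> * exp (- L g) * S g powr \<theta> * (t powr (- \<theta> - 1) * exp (- S g / t))) * indicator {0<..} t \<partial>G)"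
      proof (intro nn_integral_cong_AE, use S_pos in eventually_elim)
        case (elim g)
        have "S (\<lambda>i\<in>I. g i / t) = S g / t" "L (\<lambda>i\<in>I. g i / t) = L g / t"
          by (simp_all add: S_def L_def sum_divide_distrib)
        moreover have "t powr (- \<theta> - 1) = t powr - \<theta> * (t powr (\<theta> - 1) * t powr - \<theta>)"
          using t by (simp add: powr_add[symmetric] powr_diff)
        moreover have "(S g / t) powr \<theta> = S g powr \<theta> * t powr - \<theta>"
          using t elim by (simp add: powr_divide powr_minus_divide)
        moreover have "exp (- (S g / t) - L g / t * t) = exp (- S g / t) * exp (- L g)"
          using t by (simp add: exp_add[symmetric])
        ultimately show ?case
          using t by (simp only: ennreal_mult'[OF powr_ge_zero, symmetric]) (simp add: mult_ac)
      qed
      finally show ?thesis .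
    qed simp
  qed
  also have "\<dots> = (\<integral>\<^sup>+g. \<integral>\<^sup>+t. ennreal (1 / Gamma \<theta> * exp (- L g) * S g powr \<theta> * (t powr (- \<theta> - 1) * exp (- S g / t))) * indicator {0<..} t \<partial>lborel \<partial>G)"
    by (rule pair_sigma_finite.Fubini'[OF pair_sigma_finite.intro])
      (auto intro: prob_space_imp_sigma_finite prob_space_axioms lborel.sigma_finite_measure_axioms)
  also have "\<dots> = (\<integral>\<^sup>+g. ennreal (exp (- L g)) \<partial>G)"
  proof (intro nn_integral_cong_AE, use S_pos in eventually_elim)
    case (elim g)
    have "(\<integral>\<^sup>+t. ennreal (1 / Gamma \<theta> * exp (- L g) * S g powr \<theta> * (t powr (- \<theta> - 1) * exp (- S g / t))) * indicator {0<..} t \<partial>lborel)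
      = (\<integral>\<^sup>+t. ennreal (1 / Gamma \<theta> * exp (- L g) * S g powr \<theta>) * (ennreal (t powr (- \<theta> - 1) * exp (- S g / t)) * indicator {0<..} t) \<partial>lborel)"
      using Gamma_real_pos[OF \<theta>] by (intro nn_integral_cong, subst ennreal_mult') (auto simp: mult.assoc)
    also have "\<dots> = ennreal (1 / Gamma \<theta> * exp (- L g) * S g powr \<theta>) * ennreal (Gamma \<theta> * S g powr - \<theta>)"
      using nn_integral_inverse_Gamma[OF \<theta> elim] by (subst nn_integral_cmult) auto
    also have "\<dots> = ennreal (exp (- L g))"
      using Gamma_real_pos[OF \<theta>] elim
      by (simp add: ennreal_mult'[symmetric] powr_minus field_simps)
    finally show ?case .
  qed
  also have "\<dots> = (\<integral>\<^sup>+g. (\<Prod>i\<in>I. ennreal (exp (- c i * g i))) \<partial>G)"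
    using I by (intro nn_integral_cong) (simp add: L_def prod_ennreal exp_sum[symmetric] sum_negf)
  also have "\<dots> = (\<Prod>i\<in>I. \<integral>\<^sup>+x. ennreal (exp (- c i * x)) \<partial>gamma_law (a i))"
    unfolding G_def using I by (intro G.product_nn_integral_prod) auto
  also have "\<dots> = (\<Prod>i\<in>I. ennreal ((1 + c i) powr - a i))"
    using a c by (intro prod.cong refl nn_integral_gamma_law_exp) (auto simp: less_le_trans[of "-1" 0])
  also have "\<dots> = ennreal (\<Prod>i\<in>I. (1 + c i) powr - a i)"
    using I by (intro prod_ennreal) auto
  finally show ?thesis unfolding \<theta>_def .
qed

section \<open>The Markov-Krein identity for Dirichlet means\<close>

text \<open>The function \<open>h\<close> is arbitrary so that the same partition serves for \<open>s\<close> under the random measure and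
  for \<open>ln (1 + s)\<close> under its parameter.\<close>

lemma integral_simple_partition:
  fixes s h :: "real \<Rightarrow> real" and e :: "nat \<Rightarrow> real"
  assumes N: "prob_space N" "sets N = sets borel" "measure N {0..} = 1"
    and s: "s \<in> borel_measurable borel" and e: "range s = e ` {..<k}" "inj_on e {..<k}"
  shows "(\<integral>x. h (s x) \<partial>N) = (\<Sum>i<k. h (e i) * measure N (s -` {e i} \<inter> {0..}))"
proof -
  interpret prob_space N by fact
  note [measurable_cong] = N(2)
  note [measurable] = s
  have [measurable]: "s -` {c} \<inter> {0..} \<in> sets borel" for c
    by (intro sets.Int measurable_sets_borel[OF s]) auto
  have ge: "AE x in N. x \<in> {0..}"
    using N by (subst AE_in_set_eq_1) auto
  have *: "h (s x) = (\<Sum>i<k. h (e i) * indicator (s -` {e i} \<inter> {0..}) x)" if x: "x \<in> {0..}" for x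
  proof -
    obtain j where j: "j < k" "s x = e j" using e by (metis (no_types, lifting) imageE lessThan_iff rangeI)
    have "(\<Sum>i<k. h (e i) * indicator (s -` {e i} \<inter> {0..}) x) = (\<Sum>i<k. if i = j then h (e j) else 0)"
      using x j e(2) by (intro sum.cong) (auto simp: indicator_def inj_on_def)
    then show ?thesis using j by simp
  qed
  have "(\<integral>x. (\<Sum>i<k. h (e i) * indicator (s -` {e i} \<inter> {0..}) x) \<partial>N) = (\<Sum>i<k. h (e i) * measure N (s -` {e i} \<inter> {0..}))"
    by (subst Bochner_Integration.integral_sum) (auto simp: N(2) less_top[symmetric])
  also have "(\<integral>x. (\<Sum>i<k. h (e i) * indicator (s -` {e i} \<inter> {0..}) x) \<partial>N) = (\<integral>x. h (s x) \<partial>N)"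
  proof (rule integral_cong_AE)
    have "simple_function borel s"
      using e s by (simp add: simple_function_def) (auto intro!: measurable_sets_borel[OF s])
    then have "simple_function borel (\<lambda>x. h (s x))" by (rule simple_function_compose1)
    then show "(\<lambda>x. h (s x)) \<in> borel_measurable N"
      by (simp add: measurable_cong_sets[OF N(2) refl] borel_measurable_simple_function)
    show "AE x in N. (\<Sum>i<k. h (e i) * indicator (s -` {e i} \<inter> {0..}) x) = h (s x)"
      using ge by eventually_elim (simp add: *)
  qed measurable
  finally show ?thesis .
qed

text \<open>A simple function is constant on the cells of a finite partition, and the masses of the cells form
  a Dirichlet vector.\<close>

lemma dirichlet_process_simple:
  fixes s :: "real \<Rightarrow> real"
  assumes \<Omega>: "prob_space \<Omega>" and D: "dirichlet_process \<Omega> \<theta> F P"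
    and s: "simple_function borel s" "\<And>x. 0 \<le> s x"
  shows "(\<integral>\<^sup>+\<omega>. ennreal ((1 + (\<integral>x. s x \<partial>P \<omega>)) powr - \<theta>) \<partial>\<Omega>) = ennreal (exp (- \<theta> * (\<integral>x. ln (1 + s x) \<partial>F)))"
proof -
  have \<theta>: "0 < \<theta>" and F: "prob_space F" "sets F = sets borel" "measure F {0..} = 1"
    and P[measurable]: "P \<in> \<Omega> \<rightarrow>\<^sub>M prob_algebra borel" and P1: "\<And>\<omega>. \<omega> \<in> space \<Omega> \<Longrightarrow> measure (P \<omega>) {0..} = 1"
    using D by (auto simp: dirichlet_process_def space_prob_algebra)
  have P': "prob_space (P \<omega>)" "sets (P \<omega>) = sets borel" if "\<omega> \<in> space \<Omega>" for \<omega>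
    using measurable_space[OF P that] by (auto simp: space_prob_algebra)
  have s_meas: "s \<in> borel_measurable borel" by (rule borel_measurable_simple_function[OF s(1)])
  have "finite (range s)" using s(1) by (simp add: simple_function_def)
  from finite_imp_nat_seg_image_inj_on[OF this] obtain k :: nat and e
    where e: "range s = e ` {..<k}" "inj_on e {..<k}"
    unfolding lessThan_def by blast
  have e_nonneg: "0 \<le> e i" if "i < k" for i
    using e(1) s(2) that by (metis imageI lessThan_iff rangeE)
  define C where "C i = s -` {e i} \<inter> {0..}" for i
  have C[measurable]: "C i \<in> sets borel" for i
    unfolding C_def by (intro sets.Int measurable_sets_borel[OF s_meas]) auto
  have dj: "disjoint_family_on C {..<k}"
    using e(2) by (auto simp: disjoint_family_on_def C_def inj_on_def)
  have un: "(\<Union>i<k. C i) = {0..}"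
    using e(1) by (force simp: C_def)
  have law: "distr \<Omega> (\<Pi>\<^sub>M i\<in>{..<k}. borel) (\<lambda>\<omega>. \<lambda>i\<in>{..<k}. measure (P \<omega>) (C i))
          = dirichlet_law {..<k} (\<lambda>i. \<theta> * measure F (C i))"
  proof -
    have all: "\<forall>(k::nat) C. (\<forall>i<k. C i \<in> sets borel) \<and> disjoint_family_on C {..<k} \<and> (\<Union>i<k. C i) = {0..} \<longrightarrow>
        distr \<Omega> (\<Pi>\<^sub>M i\<in>{..<k}. borel) (\<lambda>\<omega>. \<lambda>i\<in>{..<k}. measure (P \<omega>) (C i))
          = dirichlet_law {..<k} (\<lambda>i. \<theta> * measure F (C i))"
      using D unfolding dirichlet_process_def by (elim conjE)
    have "(\<forall>i<k. C i \<in> sets borel) \<and> disjoint_family_on C {..<k} \<and> (\<Union>i<k. C i) = {0..}"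
      by (intro conjI allI impI C dj un)
    then show ?thesis by (rule mp[OF spec[OF spec[OF all]]])
  qed
  have tot: "(\<Sum>i<k. \<theta> * measure F (C i)) = \<theta>"
  proof -
    interpret F: prob_space F by fact
    have "(\<Sum>i<k. measure F (C i)) = measure F (\<Union>i<k. C i)"
      by (rule F.finite_measure_finite_Union[symmetric]) (use dj in \<open>simp_all add: F(2) image_subset_iff\<close>)
    then show ?thesis using un F(3) by (simp add: sum_distrib_left[symmetric])
  qed
  have [measurable]: "(\<lambda>\<omega>. measure (P \<omega>) (C i)) \<in> borel_measurable \<Omega>" for i
    by measurable
  have "(\<integral>\<^sup>+\<omega>. ennreal ((1 + (\<integral>x. s x \<partial>P \<omega>)) powr - \<theta>) \<partial>\<Omega>)
    = (\<integral>\<^sup>+\<omega>. ennreal ((1 + (\<Sum>i<k. e i * measure (P \<omega>) (C i))) powr - \<theta>) \<partial>\<Omega>)"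
    using integral_simple_partition[OF P' P1 s_meas e, of _ "\<lambda>x. x"]
    by (intro nn_integral_cong) (simp add: C_def)
  also have "\<dots> = (\<integral>\<^sup>+d. ennreal ((1 + (\<Sum>i<k. e i * d i)) powr - \<theta>) \<partial>distr \<Omega> (\<Pi>\<^sub>M i\<in>{..<k}. borel) (\<lambda>\<omega>. \<lambda>i\<in>{..<k}. measure (P \<omega>) (C i)))"
    by (subst nn_integral_distr) auto
  also have "\<dots> = ennreal (\<Prod>i<k. (1 + e i) powr - (\<theta> * measure F (C i)))"
    unfolding law using nn_integral_dirichlet_law_powr[of "{..<k}" "\<lambda>i. \<theta> * measure F (C i)" e] \<theta> e_nonneg
    by (simp add: tot)
  also have "(\<Prod>i<k. (1 + e i) powr - (\<theta> * measure F (C i))) = (\<Prod>i<k. exp (- \<theta> * (ln (1 + e i) * measure F (C i))))"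
    by (intro prod.cong refl) (use e_nonneg in \<open>auto simp: powr_def add_nonneg_eq_0_iff mult_ac\<close>)
  also have "\<dots> = exp (- \<theta> * (\<Sum>i<k. ln (1 + e i) * measure F (C i)))"
    by (simp add: exp_sum sum_distrib_left)
  also have "(\<Sum>i<k. ln (1 + e i) * measure F (C i)) = (\<integral>x. ln (1 + s x) \<partial>F)"
    using integral_simple_partition[OF F s_meas e, of "\<lambda>x. ln (1 + x)"] by (simp add: C_def)
  finally show ?thesis .
qed

lemma powr_minus_le_one:
  "y powr - a \<le> 1" if "1 \<le> y" "0 \<le> a" for y a :: real
  using ge_one_powr_ge_zero[OF that] by (simp add: powr_minus inverse_le_1_iff)

lemma random_mean_nonneg:
  assumes "dirichlet_process \<Omega> \<theta> F P" "\<omega> \<in> space \<Omega>"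
  shows "0 \<le> random_mean P \<omega>"
proof -
  have P: "P \<in> \<Omega> \<rightarrow>\<^sub>M prob_algebra borel" and P1: "measure (P \<omega>) {0..} = 1"
    using assms by (auto simp: dirichlet_process_def)
  interpret prob_space "P \<omega>" using measurable_space[OF P assms(2)] by (simp add: space_prob_algebra)
  have "sets (P \<omega>) = sets borel" using measurable_space[OF P assms(2)] by (simp add: space_prob_algebra)
  then have "AE x in P \<omega>. x \<in> {0..}" using P1 by (subst AE_in_set_eq_1) auto
  then show ?thesis unfolding random_mean_def by (intro integral_nonneg_AE) auto
qed

text \<open>Simple functions increase to the identity, so their random means \<open>m\<^sub>i\<close> increase to the mean of the
  process or to infinity. In the second case \<open>(1 + l m\<^sub>i)\<^sup>-\<^sup>\<theta>\<close> tends to zero, while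
  \<^const>\<open>random_mean\<close> is zero by convention; hence the limit is written with the function \<open>V l\<close> that
  vanishes where the mean is infinite. As \<open>l\<close> tends to zero, \<open>V l\<close> tends to the indicator of a finite
  mean and the right-hand side to one, by the logarithmic moment. So the mean is almost surely
  finite, and \<open>V l\<close> is the integrand of the statement.\<close>

lemma markov_krein:
  assumes \<Omega>: "prob_space \<Omega>" and D: "dirichlet_process \<Omega> \<theta> F P"
    and log: "\<And>l. 0 < l \<Longrightarrow> integrable F (\<lambda>x. ln (1 + l * x))"
    and mean: "random_mean P \<in> borel_measurable \<Omega>" and l: "0 < l"
  shows "(\<integral>\<^sup>+\<omega>. ennreal ((1 + l * random_mean P \<omega>) powr - \<theta>) \<partial>\<Omega>) = ennreal (exp (- \<theta> * (\<integral>x. ln (1 + l * x) \<partial>F)))"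
proof -
  interpret prob_space \<Omega> by fact
  note [measurable] = mean
  have \<theta>: "0 < \<theta>" and F: "prob_space F" "sets F = sets borel" "measure F {0..} = 1"
    and P[measurable]: "P \<in> \<Omega> \<rightarrow>\<^sub>M prob_algebra borel" and P1: "\<And>\<omega>. \<omega> \<in> space \<Omega> \<Longrightarrow> measure (P \<omega>) {0..} = 1"
    using D by (auto simp: dirichlet_process_def space_prob_algebra)
  have P': "prob_space (P \<omega>)" "sets (P \<omega>) = sets borel" if "\<omega> \<in> space \<Omega>" for \<omega>
    using measurable_space[OF P that] by (auto simp: space_prob_algebra)
  interpret F: prob_space F by fact
  have F_ge: "AE x in F. 0 \<le> x"
    using F(2,3) F.AE_in_set_eq_1[of "{0..}"] by auto
  have P_ge: "AE x in P \<omega>. 0 \<le> x" if "\<omega> \<in> space \<Omega>" for \<omega>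
    using P'[OF that] P1[OF that] prob_space.AE_in_set_eq_1[of "P \<omega>" "{0..}"] by auto

  obtain f :: "nat \<Rightarrow> real \<Rightarrow> real" where f: "incseq f" "\<And>i. simple_function borel (f i)"
    "\<And>x. bdd_above (range (\<lambda>i. f i x))" "\<And>i x. 0 \<le> f i x" "(\<lambda>x. max 0 x) = (SUP i. f i)"
    using borel_measurable_implies_simple_function_sequence_real[of "\<lambda>x::real. max 0 x" borel] by auto
  have f_meas[measurable]: "f i \<in> borel_measurable borel" for i
    by (rule borel_measurable_simple_function[OF f(2)])
  have f_mono: "incseq (\<lambda>i. f i x)" for x
    using f(1) by (auto simp: incseq_def le_fun_def)
  have f_lim: "(\<lambda>i. f i x) \<longlonglongrightarrow> max 0 x" for x
  proof -
    have "(\<lambda>i. f i x) \<longlonglongrightarrow> (SUP i. f i x)"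
      by (rule LIMSEQ_incseq_SUP) (use f(3) f_mono in auto)
    then show ?thesis using fun_cong[OF f(5), of x] by (simp add: image_image)
  qed
  have f_le: "f i x \<le> max 0 x" for i x
    using incseq_le[OF f_mono f_lim] .
  have f_bdd: "\<exists>B. \<forall>x. f i x \<le> B" for i
  proof -
    have "finite (range (f i))" using f(2)[of i] by (simp add: simple_function_def)
    then show ?thesis by (intro exI[of _ "Max (range (f i))"]) auto
  qed
  have f_int: "integrable (P \<omega>) (f i)" if "\<omega> \<in> space \<Omega>" for \<omega> i
  proof -
    interpret P: prob_space "P \<omega>" using P' that by auto
    obtain B where "\<And>x. f i x \<le> B" using f_bdd by blast
    then show ?thesis
      using f(4) by (intro P.integrable_const_bound[of _ B]) (auto simp: measurable_cong_sets[OF P'(2)[OF that] refl])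
  qed
  define m where "m i \<omega> = (\<integral>x. f i x \<partial>P \<omega>)" for i \<omega>
  have m_nonneg: "0 \<le> m i \<omega>" for i \<omega> unfolding m_def using f(4) by (intro integral_nonneg_AE) auto
  have m_mono: "incseq (\<lambda>i. m i \<omega>)" if "\<omega> \<in> space \<Omega>" for \<omega>
    unfolding m_def using f_mono that by (intro incseq_SucI integral_mono f_int) (auto simp: incseq_Suc_iff)

  define J where "J \<omega> \<longleftrightarrow> integrable (P \<omega>) (\<lambda>x. x)" for \<omega>
  define V where "V l \<omega> = (if J \<omega> then (1 + l * random_mean P \<omega>) powr - \<theta> else 0)" for l \<omega>
  have V_lim: "(\<lambda>i. (1 + l * m i \<omega>) powr - \<theta>) \<longlonglongrightarrow> V l \<omega>" if \<omega>: "\<omega> \<in> space \<Omega>" and l: "0 < l" for l \<omega>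
  proof (cases "J \<omega>")
    case True
    have "(\<lambda>i. m i \<omega>) \<longlonglongrightarrow> (\<integral>x. max 0 x \<partial>P \<omega>)"
      unfolding m_def
    proof (rule integral_dominated_convergence)
      show "integrable (P \<omega>) (\<lambda>x. \<bar>x\<bar>)" using True by (auto simp: J_def)
      show "AE x in P \<omega>. norm (f i x) \<le> \<bar>x\<bar>" for i
      proof (intro AE_I2)
        fix x show "norm (f i x) \<le> \<bar>x\<bar>" using f_le[of i x] f(4)[of i x] by (simp add: max_def split: if_splits)
      qed
    qed (use f_lim in \<open>auto simp: measurable_cong_sets[OF P'(2)[OF \<omega>] refl]\<close>)
    also have "(\<integral>x. max 0 x \<partial>P \<omega>) = random_mean P \<omega>"
      unfolding random_mean_def using P_ge[OF \<omega>]
      by (intro integral_cong_AE) (auto simp: measurable_cong_sets[OF P'(2)[OF \<omega>] refl])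
    finally have "(\<lambda>i. (1 + l * m i \<omega>) powr - \<theta>) \<longlonglongrightarrow> (1 + l * random_mean P \<omega>) powr - \<theta>"
      using l random_mean_nonneg[OF D \<omega>] by (intro tendsto_intros) (auto simp: add_nonneg_eq_0_iff)
    then show ?thesis using True by (simp add: V_def)
  next
    case False
    have "filterlim (\<lambda>i. m i \<omega>) at_top sequentially"
    proof (rule ccontr)
      assume "\<not> ?thesis"
      then obtain B where B: "\<not> (\<forall>\<^sub>F i in sequentially. B \<le> m i \<omega>)"
        unfolding filterlim_at_top by blast
      have "m i \<omega> \<le> B" for i
      proof (rule ccontr)
        assume "\<not> m i \<omega> \<le> B"
        then have "\<forall>j\<ge>i. B \<le> m j \<omega>" using incseqD[OF m_mono[OF \<omega>], of i] by fastforce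
        then show False using B by (auto simp: eventually_sequentially)
      qed
      then obtain L where L: "(\<lambda>i. m i \<omega>) \<longlonglongrightarrow> L"
        using incseq_convergent[OF m_mono[OF \<omega>], of B] by metis
      have "integrable (P \<omega>) (\<lambda>x. max 0 x)"
      proof (rule integrable_monotone_convergence)
        show "integrable (P \<omega>) (f i)" for i by (rule f_int[OF \<omega>])
        show "(\<lambda>i. integral\<^sup>L (P \<omega>) (f i)) \<longlonglongrightarrow> L" using L by (simp add: m_def)
      qed (use f_mono f_lim in \<open>auto simp: measurable_cong_sets[OF P'(2)[OF \<omega>] refl] mono_def incseq_def\<close>)
      then have "integrable (P \<omega>) (\<lambda>x. x)"
        by (rule integrable_cong_AE_imp) (use P_ge[OF \<omega>] in \<open>auto simp: measurable_cong_sets[OF P'(2)[OF \<omega>] refl]\<close>)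
      then show False using False by (simp add: J_def)
    qed
    then have "filterlim (\<lambda>i. 1 + l * m i \<omega>) at_top sequentially"
      using l by (intro filterlim_tendsto_add_at_top[OF tendsto_const] filterlim_tendsto_pos_mult_at_top[OF tendsto_const])
    then show ?thesis using False \<theta> by (auto simp: V_def intro: tendsto_neg_powr)
  qed
  have step: "(\<integral>\<^sup>+\<omega>. ennreal ((1 + l * m i \<omega>) powr - \<theta>) \<partial>\<Omega>) = ennreal (exp (- \<theta> * (\<integral>x. ln (1 + l * f i x) \<partial>F)))" if "0 < l" for l i
  proof -
    have "simple_function borel (\<lambda>x. l * f i x)" by (rule simple_function_compose1[OF f(2)])
    from dirichlet_process_simple[OF \<Omega> D this] show ?thesis using that f(4) by (simp add: m_def)
  qed
  have m_meas[measurable]: "m i \<in> borel_measurable \<Omega>" for i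
  proof -
    obtain B where B: "\<And>x. f i x \<le> B" using f_bdd by blast
    have "(\<lambda>\<omega>. \<integral>x. f i x \<partial>P \<omega>) \<in> borel_measurable \<Omega>"
      by (rule measurable_compose[OF measurable_prob_algebraD[OF P] integral_measurable_subprob_algebra])
        (use B f(4) in \<open>auto intro!: exI[of _ B]\<close>)
    then show ?thesis by (simp add: m_def[abs_def])
  qed
  have V_meas[measurable]: "V l \<in> borel_measurable \<Omega>" if "0 < l" for l
    by (rule borel_measurable_LIMSEQ_real[OF V_lim]) (use that in auto)
  have ln_lim: "(\<lambda>i. \<integral>x. ln (1 + l * f i x) \<partial>F) \<longlonglongrightarrow> (\<integral>x. ln (1 + l * x) \<partial>F)" if l: "0 < l" for l
  proof (rule integral_dominated_convergence)
    show "integrable F (\<lambda>x. ln (1 + l * x))" by (rule log[OF l])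
    show "AE x in F. (\<lambda>i. ln (1 + l * f i x)) \<longlonglongrightarrow> ln (1 + l * x)"
      using F_ge
    proof eventually_elim
      case (elim x)
      then show ?case using l f_lim[of x] by (intro tendsto_intros) (auto simp: add_nonneg_eq_0_iff max_def split: if_splits)
    qed
    show "AE x in F. norm (ln (1 + l * f i x)) \<le> ln (1 + l * x)" for i
      using F_ge
    proof eventually_elim
      case (elim x)
      then have "f i x \<le> x" "0 \<le> f i x" using f_le[of i x] f(4) by auto
      then show ?case using l by (auto intro!: ln_mono simp: add_pos_nonneg)
    qed
  qed (auto simp: measurable_cong_sets[OF F(2) refl])
  have V_int: "(\<integral>\<omega>. V l \<omega> \<partial>\<Omega>) = exp (- \<theta> * (\<integral>x. ln (1 + l * x) \<partial>F))" if l: "0 < l" for l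
  proof (rule LIMSEQ_unique)
    show "(\<lambda>i. \<integral>\<omega>. (1 + l * m i \<omega>) powr - \<theta> \<partial>\<Omega>) \<longlonglongrightarrow> (\<integral>\<omega>. V l \<omega> \<partial>\<Omega>)"
    proof (rule integral_dominated_convergence)
      show "AE \<omega> in \<Omega>. norm ((1 + l * m i \<omega>) powr - \<theta>) \<le> 1" for i
        using l \<theta> m_nonneg[of i] by (intro AE_I2) (auto intro!: powr_minus_le_one)
    qed (use l V_lim in auto)
    have "(\<integral>\<omega>. (1 + l * m i \<omega>) powr - \<theta> \<partial>\<Omega>) = exp (- \<theta> * (\<integral>x. ln (1 + l * f i x) \<partial>F))" for i
      using step[OF l, of i] by (subst integral_eq_nn_integral) auto
    then show "(\<lambda>i. \<integral>\<omega>. (1 + l * m i \<omega>) powr - \<theta> \<partial>\<Omega>) \<longlonglongrightarrow> exp (- \<theta> * (\<integral>x. ln (1 + l * x) \<partial>F))"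
      by (simp add: ln_lim[OF l] tendsto_intros)
  qed
  have V_nonneg: "0 \<le> V l \<omega>" for l \<omega> by (simp add: V_def)
  have V_le: "norm (V l \<omega>) \<le> 1" if "0 < l" "\<omega> \<in> space \<Omega>" for l \<omega>
    using that \<theta> random_mean_nonneg[OF D that(2)]
    by (auto simp: V_def intro!: powr_minus_le_one)

  define c :: "nat \<Rightarrow> real" where "c n = inverse (real (Suc n))" for n
  have c_pos: "0 < c n" for n by (simp add: c_def)
  have c_lim: "c \<longlonglongrightarrow> 0" unfolding c_def[abs_def] by (rule LIMSEQ_inverse_real_of_nat)
  have V0: "(\<lambda>n. V (c n) \<omega>) \<longlonglongrightarrow> (if J \<omega> then 1 else 0)" for \<omega>
  proof (cases "J \<omega>")
    case True
    have "(\<lambda>n. (1 + c n * random_mean P \<omega>) powr - \<theta>) \<longlonglongrightarrow> (1 + 0 * random_mean P \<omega>) powr - \<theta>"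
      by (intro tendsto_intros c_lim) auto
    then show ?thesis using True by (simp add: V_def)
  qed (simp add: V_def)
  have J_meas[measurable]: "(\<lambda>\<omega>. if J \<omega> then 1 else 0 :: real) \<in> borel_measurable \<Omega>"
    by (rule borel_measurable_LIMSEQ_real[OF V0]) (auto simp: c_pos)
  have J_int: "(\<integral>\<omega>. (if J \<omega> then 1 else 0) \<partial>\<Omega>) = (1::real)"
  proof (rule LIMSEQ_unique)
    show "(\<lambda>n. \<integral>\<omega>. V (c n) \<omega> \<partial>\<Omega>) \<longlonglongrightarrow> (\<integral>\<omega>. (if J \<omega> then 1 else 0) \<partial>\<Omega>)"
    proof (rule integral_dominated_convergence)
      show "AE \<omega> in \<Omega>. norm (V (c n) \<omega>) \<le> 1" for n
        by (intro AE_I2 V_le c_pos)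
    qed (use V0 in \<open>auto simp: c_pos\<close>)
    have "(\<lambda>n. \<integral>x. ln (1 + c n * x) \<partial>F) \<longlonglongrightarrow> (\<integral>x. 0 \<partial>F)"
    proof (rule integral_dominated_convergence)
      show "integrable F (\<lambda>x. ln (1 + 1 * x))" by (rule log) simp
      have "(\<lambda>n. ln (1 + c n * x)) \<longlonglongrightarrow> ln (1 + 0 * x)" for x
        by (intro tendsto_intros c_lim) auto
      then show "AE x in F. (\<lambda>n. ln (1 + c n * x)) \<longlonglongrightarrow> 0" by simp
      show "AE x in F. norm (ln (1 + c n * x)) \<le> ln (1 + 1 * x)" for n
        using F_ge
      proof eventually_elim
        case (elim x)
        have "c n \<le> 1" by (simp add: c_def field_simps)
        then have "c n * x \<le> 1 * x" using elim by (rule mult_right_mono)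
        moreover have "0 \<le> c n * x" using elim c_pos[of n] by simp
        ultimately show ?case by (auto intro!: ln_mono simp: add_pos_nonneg)
      qed
    qed (auto simp: measurable_cong_sets[OF F(2) refl])
    then have "(\<lambda>n. exp (- \<theta> * (\<integral>x. ln (1 + c n * x) \<partial>F))) \<longlonglongrightarrow> exp (- \<theta> * 0)"
      by (intro tendsto_intros) simp
    then show "(\<lambda>n. \<integral>\<omega>. V (c n) \<omega> \<partial>\<Omega>) \<longlonglongrightarrow> 1"
      by (simp add: V_int c_pos)
  qed
  have "AE \<omega> in \<Omega>. (if J \<omega> then 0 else 1 :: real) = 0"
  proof (subst integral_nonneg_eq_0_iff_AE[symmetric])
    have eq: "(if J \<omega> then 0 else 1) = 1 - (if J \<omega> then 1 else 0 :: real)" for \<omega> by simp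
    have int: "integrable \<Omega> (\<lambda>\<omega>. if J \<omega> then 1 else 0 :: real)"
      by (rule integrable_const_bound[of _ 1]) auto
    show "integrable \<Omega> (\<lambda>\<omega>. if J \<omega> then 0 else 1 :: real)"
      unfolding eq using int by (intro Bochner_Integration.integrable_diff) auto
    show "(\<integral>\<omega>. (if J \<omega> then 0 else 1) \<partial>\<Omega>) = (0::real)"
      unfolding eq using int J_int by (subst Bochner_Integration.integral_diff) (auto simp: prob_space)
  qed auto
  then have AEJ: "AE \<omega> in \<Omega>. J \<omega>" by (auto elim!: eventually_mono split: if_splits)
  have "(\<integral>\<^sup>+\<omega>. ennreal ((1 + l * random_mean P \<omega>) powr - \<theta>) \<partial>\<Omega>) = (\<integral>\<^sup>+\<omega>. ennreal (V l \<omega>) \<partial>\<Omega>)"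
    using AEJ by (intro nn_integral_cong_AE) (auto simp: V_def)
  also have "\<dots> = ennreal (\<integral>\<omega>. V l \<omega> \<partial>\<Omega>)"
    using l V_le by (intro nn_integral_eq_integral integrable_const_bound[of _ 1]) (auto simp: V_nonneg)
  also have "\<dots> = ennreal (exp (- \<theta> * (\<integral>x. ln (1 + l * x) \<partial>F)))"
    by (simp add: V_int[OF l])
  finally show ?thesis .
qed

section \<open>Analytic continuation of Stieltjes and logarithmic transforms\<close>

text \<open>Dominated convergence for difference quotients, which the mean value inequality bounds by \<open>K\<close>.\<close>

lemma has_field_derivative_lebesgue_integral:
  fixes h h' :: "complex \<Rightarrow> 'a \<Rightarrow> complex" and K :: "'a \<Rightarrow> real"
  assumes r: "0 < r"
    and int: "\<And>s. s \<in> ball z r \<Longrightarrow> integrable N (h s)"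
    and meas: "h' z \<in> borel_measurable N"
    and der: "AE x in N. \<forall>s\<in>ball z r. ((\<lambda>s. h s x) has_field_derivative h' s x) (at s) \<and> norm (h' s x) \<le> K x"
    and K: "integrable N K"
  shows "((\<lambda>s. \<integral>x. h s x \<partial>N) has_field_derivative (\<integral>x. h' z x \<partial>N)) (at z)"
  unfolding has_field_derivative_iff tendsto_at_iff_sequentially
proof (intro allI impI)
  fix X :: "nat \<Rightarrow> complex" assume X: "\<forall>i. X i \<in> UNIV - {z}" "X \<longlonglongrightarrow> z"
  have zr: "z \<in> ball z r" using r by simp
  have "eventually (\<lambda>i. X i \<in> ball z r) sequentially"
    by (rule topological_tendstoD[OF X(2) open_ball zr])
  then obtain n where n: "\<And>i. n \<le> i \<Longrightarrow> X i \<in> ball z r" by (auto simp: eventually_sequentially)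
  have "(\<lambda>i. \<integral>x. (h (X (i + n)) x - h z x) / (X (i + n) - z) \<partial>N) \<longlonglongrightarrow> (\<integral>x. h' z x \<partial>N)"
  proof (rule integral_dominated_convergence[OF meas _ K])
    show "(\<lambda>x. (h (X (i + n)) x - h z x) / (X (i + n) - z)) \<in> borel_measurable N" for i
      using int[OF n[of "i + n"]] int[OF zr] by (intro borel_measurable_divide borel_measurable_diff) auto
    show "AE x in N. (\<lambda>i. (h (X (i + n)) x - h z x) / (X (i + n) - z)) \<longlonglongrightarrow> h' z x"
      using der
    proof eventually_elim
      case (elim x)
      then have "((\<lambda>y. (h y x - h z x) / (y - z)) \<longlongrightarrow> h' z x) (at z)"
        using zr by (simp add: has_field_derivative_iff)
      then have "((\<lambda>y. (h y x - h z x) / (y - z)) \<circ> X) \<longlonglongrightarrow> h' z x"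
        using X unfolding tendsto_at_iff_sequentially by blast
      then show ?case by (auto simp: o_def dest: LIMSEQ_ignore_initial_segment[where k = n])
    qed
    show "AE x in N. norm ((h (X (i + n)) x - h z x) / (X (i + n) - z)) \<le> K x" for i
      using der
    proof eventually_elim
      case (elim x)
      have "norm (h (X (i + n)) x - h z x) \<le> K x * norm (X (i + n) - z)"
        by (rule field_differentiable_bound[of "ball z r" "\<lambda>s. h s x" "\<lambda>s. h' s x"])
          (use elim zr n in \<open>auto intro: has_field_derivative_at_within\<close>)
      then show ?case using X(1) by (simp add: norm_divide divide_le_eq)
    qed
  qed
  moreover have "(\<integral>x. (h (X (i + n)) x - h z x) / (X (i + n) - z) \<partial>N)
      = ((\<integral>x. h (X (i + n)) x \<partial>N) - (\<integral>x. h z x \<partial>N)) / (X (i + n) - z)" for i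
    using int[OF n[of "i + n"]] int[OF zr] by simp
  ultimately show "((\<lambda>y. ((\<integral>x. h y x \<partial>N) - (\<integral>x. h z x \<partial>N)) / (y - z)) \<circ> X) \<longlonglongrightarrow> (\<integral>x. h' z x \<partial>N)"
    by - (rule LIMSEQ_offset[where k = n], simp only: o_def)
qed

text \<open>Laws on \<open>[0, \<infinity>)\<close> are represented as Borel laws on the real line, which leaves \<^const>\<open>cdf\<close> and Lebesgue
  measure applicable.\<close>

locale half_line_law = prob_space F for F :: "real measure" +
  assumes sets_F [measurable_cong, simp]: "sets F = sets borel"
    and AE_nonneg: "AE x in F. 0 \<le> x"
begin

lemma space_F [simp]: "space F = UNIV"
  using sets_eq_imp_space_eq[OF sets_F] by simp

lemma measurable_F [simp]: "measurable F M = measurable borel M"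
  by (rule measurable_cong_sets) simp_all

end

locale log_moment_law = half_line_law +
  assumes integrable_ln: "integrable F (\<lambda>x. ln (1 + x))"

text \<open>The kernels \<open>1 / (s + x)\<close> and \<open>Ln (s + x)\<close> are uniformly well-behaved in \<open>x \<ge> 0\<close> as long as \<open>s\<close> stays
  away from the cut.\<close>

lemma slit_plane_ball:
  assumes "z \<notin> \<real>\<^sub>\<le>\<^sub>0"
  obtains r where "0 < r" "ball z r \<subseteq> - \<real>\<^sub>\<le>\<^sub>0"
    "\<And>s x. s \<in> ball z r \<Longrightarrow> 0 \<le> x \<Longrightarrow> r \<le> norm (s + complex_of_real x)"
proof -
  have "open (- \<real>\<^sub>\<le>\<^sub>0 :: complex set)" by (simp add: open_Compl)
  then obtain e where e: "0 < e" "ball z e \<subseteq> - \<real>\<^sub>\<le>\<^sub>0"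
    using assms openE by blast
  show ?thesis
  proof (rule that)
    show "0 < e / 2" using e by simp
    have "ball z (e / 2) \<subseteq> ball z e" using e by (intro subset_ball) simp
    then show "ball z (e / 2) \<subseteq> - \<real>\<^sub>\<le>\<^sub>0" using e by blast
    fix s and x :: real assume s: "s \<in> ball z (e / 2)" and x: "0 \<le> x"
    have "- complex_of_real x \<in> \<real>\<^sub>\<le>\<^sub>0" using x by (simp add: complex_nonpos_Reals_iff)
    then have "- complex_of_real x \<notin> ball z e" using e(2) by blast
    then have "e \<le> norm (z + complex_of_real x)" by (simp add: dist_norm)
    also have "\<dots> \<le> norm (s + complex_of_real x) + norm (z - s)"
      using norm_triangle_ineq[of "s + complex_of_real x" "z - s"] by (simp add: add.commute)
    finally show "e / 2 \<le> norm (s + complex_of_real x)"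
      using s by (simp add: dist_norm)
  qed
qed

lemma (in half_line_law) integrable_inverse_shift:
  assumes "z \<notin> \<real>\<^sub>\<le>\<^sub>0" shows "integrable F (\<lambda>x. 1 / (z + complex_of_real x))"
proof -
  obtain r where r: "0 < r" "\<And>s x. s \<in> ball z r \<Longrightarrow> 0 \<le> x \<Longrightarrow> r \<le> norm (s + complex_of_real x)"
    using slit_plane_ball[OF assms] by metis
  have "AE x in F. norm (1 / (z + complex_of_real x)) \<le> 1 / r"
    using AE_nonneg
  proof eventually_elim
    case (elim x)
    with r(2)[of z x] r(1) show ?case by (simp add: norm_divide frac_le)
  qed
  then show ?thesis by (intro integrable_const_bound) auto
qed

lemma (in half_line_law) holomorphic_inverse_shift:
  "(\<lambda>z. \<integral>x. 1 / (z + complex_of_real x) \<partial>F) holomorphic_on - \<real>\<^sub>\<le>\<^sub>0"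
proof (rule holomorphic_onI)
  fix z :: complex assume "z \<in> - \<real>\<^sub>\<le>\<^sub>0"
  then have z: "z \<notin> \<real>\<^sub>\<le>\<^sub>0" by simp
  obtain r where r: "0 < r" "ball z r \<subseteq> - \<real>\<^sub>\<le>\<^sub>0"
    "\<And>s x. s \<in> ball z r \<Longrightarrow> 0 \<le> x \<Longrightarrow> r \<le> norm (s + complex_of_real x)"
    using slit_plane_ball[OF z] by metis
  have "((\<lambda>s. \<integral>x. 1 / (s + complex_of_real x) \<partial>F) has_field_derivative (\<integral>x. - 1 / (z + complex_of_real x)^2 \<partial>F)) (at z)"
  proof (rule has_field_derivative_lebesgue_integral[OF r(1)])
    show "AE x in F. \<forall>s\<in>ball z r. ((\<lambda>s. 1 / (s + complex_of_real x)) has_field_derivative - 1 / (s + complex_of_real x)^2) (at s) \<and>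
       norm (- 1 / (s + complex_of_real x)^2) \<le> 1 / r^2"
      using AE_nonneg
    proof (eventually_elim, intro ballI conjI)
      fix x :: real and s assume x: "0 \<le> x" and s: "s \<in> ball z r"
      have *: "r \<le> norm (s + complex_of_real x)" by (rule r(3)[OF s x])
      then have "s + complex_of_real x \<noteq> 0" using r(1) by auto
      then show "((\<lambda>s. 1 / (s + complex_of_real x)) has_field_derivative - 1 / (s + complex_of_real x)^2) (at s)"
        by (auto intro!: derivative_eq_intros simp: power2_eq_square)
      show "norm (- 1 / (s + complex_of_real x)^2) \<le> 1 / r^2"
        using * r(1) by (simp add: norm_divide norm_power frac_le power_mono)
    qed
  qed (use r(2) in \<open>auto intro!: integrable_inverse_shift\<close>)
  then show "(\<lambda>z. \<integral>x. 1 / (z + complex_of_real x) \<partial>F) field_differentiable at z within - \<real>\<^sub>\<le>\<^sub>0"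
    by (rule field_differentiable_at_within[OF field_differentiable_def[THEN meta_eq_to_obj_eq, THEN iffD2, OF exI]])
qed

lemma (in log_moment_law) integrable_Ln_shift:
  assumes "z \<notin> \<real>\<^sub>\<le>\<^sub>0" shows "integrable F (\<lambda>x. Ln (z + complex_of_real x))"
proof -
  obtain r where r: "0 < r" "\<And>s x. s \<in> ball z r \<Longrightarrow> 0 \<le> x \<Longrightarrow> r \<le> norm (s + complex_of_real x)"
    using slit_plane_ball[OF assms] by metis
  define C where "C = \<bar>ln r\<bar> + ln (1 + norm z) + pi"
  have "AE x in F. norm (Ln (z + complex_of_real x)) \<le> norm (C + ln (1 + x))"
    using AE_nonneg
  proof eventually_elim
    case (elim x)
    let ?w = "z + complex_of_real x"
    have r_le: "r \<le> norm ?w" using r elim by auto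
    then have w: "?w \<noteq> 0" "0 < norm ?w" using r(1) by auto
    have "norm ?w \<le> norm z + x" using norm_triangle_ineq[of z "of_real x"] elim by simp
    also have "\<dots> \<le> (1 + norm z) * (1 + x)" using elim by (simp add: algebra_simps)
    finally have "ln (norm ?w) \<le> ln ((1 + norm z) * (1 + x))"
      using w by (intro ln_mono) (auto intro!: mult_pos_pos add_pos_nonneg elim)
    also have "\<dots> = ln (1 + norm z) + ln (1 + x)"
      using elim by (intro ln_mult_pos add_pos_nonneg) auto
    finally have 1: "ln (norm ?w) \<le> ln (1 + norm z) + ln (1 + x)" .
    have 2: "ln r \<le> ln (norm ?w)" using r_le r(1) w by (intro ln_mono) auto
    have 3: "0 \<le> ln (1 + norm z)" "0 \<le> ln (1 + x)" using elim by auto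
    have "norm (Ln ?w) \<le> \<bar>Re (Ln ?w)\<bar> + \<bar>Im (Ln ?w)\<bar>" by (rule cmod_le)
    also have "\<bar>Im (Ln ?w)\<bar> \<le> pi" using mpi_less_Im_Ln[OF w(1)] Im_Ln_le_pi[OF w(1)] by simp
    also have "\<bar>Re (Ln ?w)\<bar> \<le> \<bar>ln r\<bar> + ln (1 + norm z) + ln (1 + x)"
      unfolding Re_Ln[OF w(1)] using 1 2 3 by linarith
    finally show ?case using 3 by (simp add: C_def)
  qed
  then show ?thesis
    by (rule Bochner_Integration.integrable_bound[rotated 2]) (auto intro!: integrable_ln)
qed

lemma (in log_moment_law) holomorphic_Ln_shift:
  "(\<lambda>z. \<integral>x. Ln (z + complex_of_real x) \<partial>F) holomorphic_on - \<real>\<^sub>\<le>\<^sub>0"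
proof (rule holomorphic_onI)
  fix z :: complex assume "z \<in> - \<real>\<^sub>\<le>\<^sub>0"
  then have z: "z \<notin> \<real>\<^sub>\<le>\<^sub>0" by simp
  obtain r where r: "0 < r" "ball z r \<subseteq> - \<real>\<^sub>\<le>\<^sub>0"
    "\<And>s x. s \<in> ball z r \<Longrightarrow> 0 \<le> x \<Longrightarrow> r \<le> norm (s + complex_of_real x)"
    using slit_plane_ball[OF z] by metis
  have "((\<lambda>s. \<integral>x. Ln (s + complex_of_real x) \<partial>F) has_field_derivative (\<integral>x. 1 / (z + complex_of_real x) \<partial>F)) (at z)"
  proof (rule has_field_derivative_lebesgue_integral[OF r(1)])
    show "AE x in F. \<forall>s\<in>ball z r. ((\<lambda>s. Ln (s + complex_of_real x)) has_field_derivative 1 / (s + complex_of_real x)) (at s) \<and>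
       norm (1 / (s + complex_of_real x)) \<le> 1 / r"
      using AE_nonneg
    proof (eventually_elim, intro ballI conjI)
      fix x :: real and s assume x: "0 \<le> x" and s: "s \<in> ball z r"
      have *: "r \<le> norm (s + complex_of_real x)" by (rule r(3)[OF s x])
      have "s \<notin> \<real>\<^sub>\<le>\<^sub>0" using r(2) s by blast
      then have "s + complex_of_real x \<notin> \<real>\<^sub>\<le>\<^sub>0" using x by (auto simp: complex_nonpos_Reals_iff)
      then show "((\<lambda>s. Ln (s + complex_of_real x)) has_field_derivative 1 / (s + complex_of_real x)) (at s)"
        by (auto intro!: derivative_eq_intros simp: inverse_eq_divide)
      show "norm (1 / (s + complex_of_real x)) \<le> 1 / r"
        using * r(1) by (simp add: norm_divide frac_le)
    qed
  qed (use r(2) in \<open>auto intro!: integrable_Ln_shift\<close>)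
  then show "(\<lambda>z. \<integral>x. Ln (z + complex_of_real x) \<partial>F) field_differentiable at z within - \<real>\<^sub>\<le>\<^sub>0"
    by (rule field_differentiable_at_within[OF field_differentiable_def[THEN meta_eq_to_obj_eq, THEN iffD2, OF exI]])
qed

text \<open>Both sides are holomorphic off the cut and agree on the positive axis.\<close>

lemma stieltjes_log_continuation:
  assumes \<mu>: "half_line_law \<mu>" and F: "log_moment_law F"
    and eq: "\<And>s. 0 < s \<Longrightarrow> (\<integral>x. 1 / (s + x) \<partial>\<mu>) = exp (- (\<integral>x. ln (s + x) \<partial>F))"
    and z: "z \<notin> \<real>\<^sub>\<le>\<^sub>0"
  shows "(\<integral>x. 1 / (z + complex_of_real x) \<partial>\<mu>) = exp (- (\<integral>x. Ln (z + complex_of_real x) \<partial>F))"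
proof -
  interpret \<mu>: half_line_law \<mu> by fact
  interpret F: log_moment_law F by fact
  let ?D = "\<lambda>z. (\<integral>x. 1 / (z + complex_of_real x) \<partial>\<mu>) - exp (- (\<integral>x. Ln (z + complex_of_real x) \<partial>F))"
  let ?S = "- \<real>\<^sub>\<le>\<^sub>0 :: complex set"
  have "?D z = 0"
  proof (rule analytic_continuation[where f = ?D and S = ?S and U = "complex_of_real ` {0<..}" and \<xi> = 1 and w = z])
    show "?D holomorphic_on ?S"
      by (intro holomorphic_intros \<mu>.holomorphic_inverse_shift F.holomorphic_Ln_shift)
    show "open ?S" by (simp add: open_Compl)
    have "?S = - (complex_of_real ` {..0})"
      by (auto simp: nonpos_Reals_def)
    then show "connected ?S" by (metis starlike_slotted_complex_plane_left starlike_imp_connected)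
    show "complex_of_real ` {0<..} \<subseteq> ?S" by (auto simp: complex_nonpos_Reals_iff)
    show "1 \<in> ?S" by (simp add: complex_nonpos_Reals_iff)
    show "1 islimpt complex_of_real ` {0<..}"
      unfolding islimpt_approachable
    proof (intro allI impI)
      fix e :: real assume "0 < e"
      have "dist (complex_of_real (1 + e / 2)) (complex_of_real 1) < e"
        unfolding dist_of_real using \<open>0 < e\<close> by (simp add: dist_real_def)
      then show "\<exists>y\<in>complex_of_real ` {0<..}. y \<noteq> 1 \<and> dist y 1 < e"
        using \<open>0 < e\<close> by (intro bexI[of _ "complex_of_real (1 + e / 2)"]) (auto simp: complex_eq_iff)
    qed
    show "?D w = 0" if "w \<in> complex_of_real ` {0<..}" for w
    proof -
      from that obtain s where "w = complex_of_real s" "s \<in> {0<..}" by (rule imageE)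
      then have s: "0 < s" "w = complex_of_real s" by auto
      have "(\<integral>x. 1 / (w + complex_of_real x) \<partial>\<mu>) = (\<integral>x. complex_of_real (1 / (s + x)) \<partial>\<mu>)"
        using s by simp
      then have 1: "(\<integral>x. 1 / (w + complex_of_real x) \<partial>\<mu>) = complex_of_real (\<integral>x. 1 / (s + x) \<partial>\<mu>)"
        by (simp only: integral_complex_of_real)
      have "(\<integral>x. Ln (w + complex_of_real x) \<partial>F) = (\<integral>x. complex_of_real (ln (s + x)) \<partial>F)"
      proof (rule integral_cong_AE)
        show "AE x in F. Ln (w + complex_of_real x) = complex_of_real (ln (s + x))"
          using F.AE_nonneg
        proof eventually_elim
          case (elim x)
          with s show ?case by (simp add: Ln_of_real[symmetric])
        qed
      qed (use s in auto)
      then have 2: "(\<integral>x. Ln (w + complex_of_real x) \<partial>F) = complex_of_real (\<integral>x. ln (s + x) \<partial>F)"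
        by (simp only: integral_complex_of_real)
      show ?thesis unfolding 1 2 eq[OF s(1)] by (simp flip: exp_of_real)
    qed
  qed (use z in auto)
  then show ?thesis by simp
qed

section \<open>Logarithmic potentials of laws on the half-line\<close>

text \<open>The bound is uniform in the position \<open>x\<close> of the singularity, so it survives averaging over \<open>x\<close>.\<close>

lemma nn_integral_abs_powr_le:
  fixes q x a b :: real
  assumes q: "0 \<le> q" "q < 1" and ab: "a \<le> b"
  shows "(\<integral>\<^sup>+t. ennreal (\<bar>t - x\<bar> powr - q) * indicator {a..b} t \<partial>lborel) \<le> ennreal ((b - a) + 2 / (1 - q))"
proof -
  let ?p = "\<lambda>u::real. ennreal (u powr - q) * indicator {0..1} u"
  have "((\<lambda>u. u powr - q) has_integral (1 powr (- q + 1) / (- q + 1))) {0..1}"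
    using q by (intro has_integral_powr_from_0) auto
  then have U: "integral\<^sup>N lborel ?p = ennreal (1 / (1 - q))"
    using nn_integral_has_integral_lebesgue'[of "{0..1}" "\<lambda>u. u powr - q"] by simp
  have "(\<integral>\<^sup>+t. ennreal (\<bar>t - x\<bar> powr - q) * indicator {a..b} t \<partial>lborel)
    \<le> (\<integral>\<^sup>+t. indicator {a..b} t + (?p (t - x) + ?p (x - t)) \<partial>lborel)"
  proof (intro nn_integral_mono)
    fix t
    show "ennreal (\<bar>t - x\<bar> powr - q) * indicator {a..b} t \<le> indicator {a..b} t + (?p (t - x) + ?p (x - t))"
    proof (cases "\<bar>t - x\<bar> \<le> 1")
      case True
      then show ?thesis
        by (cases "x \<le> t") (auto simp: indicator_def intro: add_increasing add_increasing2)
    next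
      case False
      then have "\<bar>t - x\<bar> powr - q \<le> 1"
        using q ge_one_powr_ge_zero[of "\<bar>t - x\<bar>" q] by (simp add: powr_minus inverse_le_1_iff)
      then have "ennreal (\<bar>t - x\<bar> powr - q) \<le> 1"
        by (metis ennreal_1 ennreal_leI)
      then show ?thesis by (auto simp: indicator_def intro: add_increasing2)
    qed
  qed
  also have "\<dots> = emeasure lborel {a..b} + ((\<integral>\<^sup>+t. ?p (t - x) \<partial>lborel) + (\<integral>\<^sup>+t. ?p (x - t) \<partial>lborel))"
    by (subst nn_integral_add, measurable) (subst nn_integral_add, auto)
  also have "(\<integral>\<^sup>+t. ?p (t - x) \<partial>lborel) = ennreal (1 / (1 - q))"
    using nn_integral_real_affine[of "\<lambda>t. ?p (t - x)" 1 x] U by simp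
  also have "(\<integral>\<^sup>+t. ?p (x - t) \<partial>lborel) = ennreal (1 / (1 - q))"
    using nn_integral_real_affine[of "\<lambda>t. ?p (x - t)" "-1" x] U by simp
  also have "emeasure lborel {a..b} + (ennreal (1 / (1 - q)) + ennreal (1 / (1 - q))) = ennreal ((b - a) + 2 / (1 - q))"
    using ab q by (simp add: ennreal_plus[symmetric] del: ennreal_plus)
  finally show ?thesis .
qed

text \<open>A localised form of Jensen's inequality: the mass \<open>prob I\<close> of the localising set appears in the
  exponent on the right. For \<open>k = - ln \<bar>t - x\<bar>\<close> the right-hand side thus involves
  \<open>\<bar>t - x\<bar> powr - prob I\<close>, which is locally integrable in \<open>t\<close> as soon as \<open>prob I < 1\<close>. When
  \<open>prob I = 0\<close>, the summand \<open>1\<close> is the bound.\<close>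

lemma (in prob_space) exp_integral_indicator_le:
  fixes k :: "'a \<Rightarrow> real"
  assumes k: "integrable M k" and I[measurable]: "I \<in> sets M"
  shows "ennreal (exp (\<integral>x. k x * indicator I x \<partial>M))
    \<le> 1 + ennreal (1 / prob I) * (\<integral>\<^sup>+x. ennreal (exp (prob I * k x)) * indicator I x \<partial>M)"
proof -
  define p where "p = prob I"
  define A where "A = (\<integral>x. k x * indicator I x \<partial>M)"
  define E where "E = (\<integral>\<^sup>+x. ennreal (exp (p * k x)) * indicator I x \<partial>M)"
  note [measurable] = borel_measurable_integrable[OF k]
  have "ennreal (exp A) \<le> 1 + ennreal (1 / p) * E"
  proof (cases "p = 0")
    case True
    then have "AE x in M. x \<notin> I" unfolding p_def by (simp add: prob_eq_0 I)
    then have "A = (\<integral>x. 0 \<partial>M)" unfolding A_def by (intro integral_cong_AE) (auto simp: indicator_def elim!: eventually_mono)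
    then show ?thesis by simp
  next
    case False
    then have p: "0 < p" by (simp add: p_def zero_less_measure_iff measure_nonneg less_le)
    show ?thesis
    proof (cases "E = \<top>")
      case True
      then show ?thesis using p by (simp add: ennreal_mult_top)
    next
      case False
      let ?f = "\<lambda>x. exp (p * k x) * indicator I x"
      have E_eq: "E = (\<integral>\<^sup>+x. ennreal (?f x) \<partial>M)"
        unfolding E_def by (intro nn_integral_cong) (auto simp: indicator_def)
      have int: "integrable M ?f"
        using False by (intro integrableI_nonneg) (auto simp: E_eq less_top)
      have ki: "integrable M (\<lambda>x. k x * indicator I x)" using k by (rule integrable_real_mult_indicator[OF I])
      have "exp A * p = (\<integral>x. exp A * (1 - A) * indicator I x + exp A * p * (k x * indicator I x) \<partial>M)"
      proof -
        have "(\<integral>x. exp A * (1 - A) * indicator I x + exp A * p * (k x * indicator I x) \<partial>M)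
           = exp A * (1 - A) * p + exp A * p * A"
          using ki by (subst Bochner_Integration.integral_add) (auto simp: A_def p_def less_top[symmetric])
        then show ?thesis by (simp add: algebra_simps)
      qed
      also have "\<dots> \<le> (\<integral>x. ?f x \<partial>M)"
      proof (intro integral_mono)
        fix x
        \<comment> \<open>The tangent of the exponential at \<open>A\<close>: integrated over \<open>I\<close>, it gives \<open>exp A * p\<close>.\<close>
        have "exp A * (1 + (p * k x - A)) \<le> exp A * exp (p * k x - A)"
          by (intro mult_left_mono exp_ge_add_one_self) auto
        also have "\<dots> = exp (p * k x)" by (simp add: exp_add[symmetric])
        finally show "exp A * (1 - A) * indicator I x + exp A * p * (k x * indicator I x) \<le> ?f x"
          by (auto simp: indicator_def algebra_simps)
      qed (use ki int in \<open>auto simp: less_top[symmetric]\<close>)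
      finally have "exp A \<le> 1 / p * (\<integral>x. ?f x \<partial>M)" using p by (simp add: field_simps)
      then have "ennreal (exp A) \<le> ennreal (1 / p) * ennreal (\<integral>x. ?f x \<partial>M)"
        using p by (subst ennreal_mult'[symmetric]) (auto intro: ennreal_leI)
      also have "ennreal (\<integral>x. ?f x \<partial>M) = E"
        unfolding E_eq using int by (intro nn_integral_eq_integral[symmetric]) auto
      finally show ?thesis by (simp add: add_increasing)
    qed
  qed
  then show ?thesis by (simp add: A_def E_def p_def)
qed

context half_line_law
begin

lemma AE_lborel_no_atom: "AE t in lborel. measure F {t} = 0"
proof (rule AE_I')
  show "{t. measure F {t} \<noteq> 0} \<in> null_sets lborel"
    by (rule countable_imp_null_set_lborel[OF countable_support])
qed auto

lemma nn_integral_abs_powr_Icc_le: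
  assumes "0 \<le> q" "q < 1" "a \<le> b"
  shows "(\<integral>\<^sup>+t. (\<integral>\<^sup>+x. ennreal (\<bar>t - x\<bar> powr - q) \<partial>F) * indicator {a..b} t \<partial>lborel) \<le> ennreal ((b - a) + 2 / (1 - q))"
proof -
  have "(\<integral>\<^sup>+t. (\<integral>\<^sup>+x. ennreal (\<bar>t - x\<bar> powr - q) \<partial>F) * indicator {a..b} t \<partial>lborel)
      = (\<integral>\<^sup>+t. (\<integral>\<^sup>+x. ennreal (\<bar>t - x\<bar> powr - q) * indicator {a..b} t \<partial>F) \<partial>lborel)"
    by (intro nn_integral_cong nn_integral_multc[symmetric]) simp
  also have "\<dots> = (\<integral>\<^sup>+x. (\<integral>\<^sup>+t. ennreal (\<bar>t - x\<bar> powr - q) * indicator {a..b} t \<partial>lborel) \<partial>F)"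
    by (rule pair_sigma_finite.Fubini'[symmetric, OF pair_sigma_finite.intro])
      (auto intro: sigma_finite_measure_axioms lborel.sigma_finite_measure_axioms)
  also have "\<dots> \<le> (\<integral>\<^sup>+x. ennreal ((b - a) + 2 / (1 - q)) \<partial>F)"
    by (intro nn_integral_mono nn_integral_abs_powr_le assms)
  also have "\<dots> = ennreal ((b - a) + 2 / (1 - q))"
    using emeasure_space_1 by simp
  finally show ?thesis .
qed

text \<open>By Tonelli, the integral over \<open>t\<close> in any bounded interval is finite.\<close>

lemma AE_nn_integral_abs_powr_finite:
  assumes "0 \<le> q" "q < 1"
  shows "AE t in lborel. (\<integral>\<^sup>+x. ennreal (\<bar>t - x\<bar> powr - q) \<partial>F) \<noteq> \<infinity>"
proof -
  let ?g = "\<lambda>t. \<integral>\<^sup>+x. ennreal (\<bar>t - x\<bar> powr - q) \<partial>F"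
  have [measurable]: "?g \<in> borel_measurable borel" by measurable
  have "AE t in lborel. ?g t * indicator {- real n..real n} t \<noteq> \<infinity>" for n
    using nn_integral_abs_powr_Icc_le[OF assms, of "- real n" "real n"]
    by (intro nn_integral_PInf_AE) (auto simp: top_unique dest: neq_top_trans[rotated])
  then have "AE t in lborel. \<forall>n. ?g t * indicator {- real n..real n} t \<noteq> \<infinity>"
    by (simp add: AE_all_countable)
  then show ?thesis
  proof eventually_elim
    case (elim t)
    obtain n where "\<bar>t\<bar> \<le> real n" using real_arch_simple by blast
    then show ?case using elim[rule_format, of n] by (auto simp: indicator_def abs_le_iff split: if_splits)
  qed
qed

end

text \<open>For small \<open>\<bar>u\<bar>\<close>, apply \<open>ln y \<le> y\<close> to \<open>y = \<bar>u\<bar> powr - (1 / 2)\<close>.\<close>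

lemma abs_ln_le: "\<bar>ln \<bar>u\<bar>\<bar> \<le> 2 * \<bar>u\<bar> powr - (1 / 2) + ln (1 + \<bar>u\<bar>)" for u :: real
proof (cases "u = 0")
  case False
  then have u: "0 < \<bar>u\<bar>" by simp
  have "ln (\<bar>u\<bar> powr - (1 / 2)) \<le> \<bar>u\<bar> powr - (1 / 2)"
    using u by (intro less_imp_le ln_less_self) simp
  then have 1: "- ln \<bar>u\<bar> \<le> 2 * \<bar>u\<bar> powr - (1 / 2)" using u by (simp add: ln_powr)
  have 2: "ln \<bar>u\<bar> \<le> ln (1 + \<bar>u\<bar>)" using u by simp
  have "0 \<le> ln (1 + \<bar>u\<bar>)" "0 \<le> 2 * \<bar>u\<bar> powr - (1 / 2)" by auto
  with 1 2 show ?thesis by linarith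
qed simp

context log_moment_law
begin

lemma integrable_ln_abs_shift: "integrable F (\<lambda>x. ln (1 + \<bar>x - t\<bar>))"
proof (rule Bochner_Integration.integrable_bound)
  show "integrable F (\<lambda>x. ln (1 + \<bar>t\<bar>) + ln (1 + x))" by (simp add: integrable_ln)
  show "AE x in F. norm (ln (1 + \<bar>x - t\<bar>)) \<le> norm (ln (1 + \<bar>t\<bar>) + ln (1 + x))"
    using AE_nonneg
  proof eventually_elim
    case (elim x)
    have "0 \<le> \<bar>t\<bar> * x" using elim by simp
    moreover have "\<bar>x - t\<bar> \<le> x + \<bar>t\<bar>" using elim by linarith
    ultimately have "1 + \<bar>x - t\<bar> \<le> (1 + \<bar>t\<bar>) * (1 + x)"
      by (simp add: algebra_simps)
    then have "ln (1 + \<bar>x - t\<bar>) \<le> ln ((1 + \<bar>t\<bar>) * (1 + x))" by (intro ln_mono) auto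
    also have "\<dots> = ln (1 + \<bar>t\<bar>) + ln (1 + x)" using elim by (intro ln_mult_pos) auto
    finally show ?case using elim by simp
  qed
qed simp

text \<open>The logarithmic singularity is weaker than \<open>\<bar>x - t\<bar> powr - (1 / 2)\<close>; at infinity the logarithmic moment
  takes over.\<close>

lemma AE_integrable_ln_abs: "AE t in lborel. integrable F (\<lambda>x. ln \<bar>x - t\<bar>)"
  using AE_nn_integral_abs_powr_finite[of "1 / 2", simplified]
proof eventually_elim
  case (elim t)
  have "integrable F (\<lambda>x. \<bar>x - t\<bar> powr - (1 / 2))"
    using elim by (intro integrableI_nonneg) (auto simp: less_top abs_minus_commute)
  then have "integrable F (\<lambda>x. 2 * \<bar>x - t\<bar> powr - (1 / 2) + ln (1 + \<bar>x - t\<bar>))"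
    using integrable_ln_abs_shift[of t] by simp
  then show ?case
    by (rule Bochner_Integration.integrable_bound) (use abs_ln_le in \<open>auto intro: order_trans[OF _ abs_ge_self]\<close>)
qed

text \<open>At \<open>x = t\<close> both integrands vanish, since \<open>ln 0 = 0\<close>.\<close>

lemma Phi_eq: "Phi F t = (\<integral>x. ln \<bar>x - t\<bar> \<partial>F)"
  unfolding Phi_def by (intro Bochner_Integration.integral_cong) (auto simp: abs_minus_commute)

end

text \<open>Left of the origin, \<open>Ln\<close> is discontinuous, but its limit from the upper half-plane is that of
  \<open>Ln (- z) + \<i> * pi\<close>.\<close>

lemma Im_Ln_tendsto_upper:
  fixes u :: real
  assumes e: "\<And>n. 0 < e n" "e \<longlonglongrightarrow> 0" and u: "u \<noteq> 0"
  shows "(\<lambda>n. Im (Ln (Complex u (e n)))) \<longlonglongrightarrow> (if u < 0 then pi else 0)"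
proof (cases "u < 0")
  case False
  have "(\<lambda>n. Complex u (e n)) \<longlonglongrightarrow> Complex u 0" by (intro tendsto_intros e)
  then have "(\<lambda>n. Im (Ln (Complex u (e n)))) \<longlonglongrightarrow> Im (Ln (Complex u 0))"
    by (rule tendsto_Im[OF tendsto_Ln]) (use False u in \<open>auto simp: complex_nonpos_Reals_iff\<close>)
  moreover have "Complex u 0 = complex_of_real u" by (simp add: complex_eq_iff)
  ultimately show ?thesis using False u by (simp add: Ln_of_real)
next
  case True
  have "(\<lambda>n. Complex (- u) (- e n)) \<longlonglongrightarrow> Complex (- u) (- 0)" by (intro tendsto_intros e)
  then have "(\<lambda>n. Im (Ln (Complex (- u) (- e n)) + \<i> * pi)) \<longlonglongrightarrow> Im (Ln (Complex (- u) (- 0)) + \<i> * pi)"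
    by (rule tendsto_Im[OF tendsto_add[OF tendsto_Ln tendsto_const]]) (use True in \<open>auto simp: complex_nonpos_Reals_iff\<close>)
  moreover have "Complex (- u) (- 0) = complex_of_real (- u)" by (simp add: complex_eq_iff)
  moreover have "Ln (Complex u (e n)) = Ln (Complex (- u) (- e n)) + \<i> * pi" for n
  proof -
    have "Complex u (e n) = - Complex (- u) (- e n)" by (simp add: complex_eq_iff)
    moreover have "Complex (- u) (- e n) \<noteq> 0" using True by (simp add: complex_eq_iff)
    ultimately show ?thesis using Ln_minus[of "Complex (- u) (- e n)"] e(1)[of n] by simp
  qed
  ultimately show ?thesis using True by (simp add: Ln_of_real del: of_real_minus)
qed

lemma arctan_tendsto_sgn:
  "(\<lambda>n. arctan (u * real (Suc n))) \<longlonglongrightarrow> pi / 2 * sgn u"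
proof -
  have *: "(\<lambda>n. arctan (v * real (Suc n))) \<longlonglongrightarrow> pi / 2" if "0 < v" for v :: real
  proof -
    have "filterlim (\<lambda>n. real (Suc n)) at_top sequentially"
      by (rule filterlim_compose[OF filterlim_real_sequentially filterlim_Suc])
    then have "filterlim (\<lambda>n. v * real (Suc n)) at_top sequentially"
      by (rule filterlim_tendsto_pos_mult_at_top[OF tendsto_const that])
    then show ?thesis by (rule filterlim_compose[OF tendsto_arctan_at_top])
  qed
  consider "u = 0" | "0 < u" | "u < 0" by linarith
  then show ?thesis
  proof cases
    case 2
    then show ?thesis using *[of u] by (simp only: sgn_pos mult_1_right)
  next
    case 3
    then have "(\<lambda>n. - arctan (- u * real (Suc n))) \<longlonglongrightarrow> - (pi / 2)" by (intro tendsto_minus *) simp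
    then show ?thesis using 3 by (simp only: sgn_neg mult_minus_right mult_1_right arctan_minus mult_minus_left minus_minus)
  qed simp
qed

section \<open>Boundary behaviour at the cut\<close>

context log_moment_law
begin

lemma Complex_shift: "Complex (x - t) \<epsilon> = Complex (- t) \<epsilon> + complex_of_real x"
  by (simp add: complex_eq_iff)

lemma upper_half_plane_not_nonpos_Real: "0 < \<epsilon> \<Longrightarrow> Complex u \<epsilon> \<notin> \<real>\<^sub>\<le>\<^sub>0"
  by (simp add: complex_nonpos_Reals_iff)

lemma integrable_Ln_Complex: "0 < \<epsilon> \<Longrightarrow> integrable F (\<lambda>x. Ln (Complex (x - t) \<epsilon>))"
  unfolding Complex_shift by (intro integrable_Ln_shift upper_half_plane_not_nonpos_Real)

lemma Re_Ln_Complex: "0 < \<epsilon> \<Longrightarrow> Re (Ln (Complex u \<epsilon>)) = ln (cmod (Complex u \<epsilon>))"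
  by (intro Re_Ln) (auto simp: complex_eq_iff)

lemma integrable_ln_cmod:
  assumes "0 < \<epsilon>" shows "integrable F (\<lambda>x. ln (cmod (Complex (x - t) \<epsilon>)))"
  using integrable_bounded_linear[OF bounded_linear_Re integrable_Ln_Complex[OF assms, of t]]
  by (simp add: Re_Ln_Complex[OF assms])

lemma integral_ln_abs_le:
  assumes "0 < \<epsilon>" "measure F {t} = 0" "integrable F (\<lambda>x. ln \<bar>x - t\<bar>)"
  shows "(\<integral>x. ln \<bar>x - t\<bar> \<partial>F) \<le> (\<integral>x. ln (cmod (Complex (x - t) \<epsilon>)) \<partial>F)"
proof (rule integral_mono_AE[OF assms(3) integrable_ln_cmod[OF assms(1)]])
  have "AE x in F. x \<notin> {t}" using assms(2) by (subst prob_eq_0[symmetric]) auto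
  then show "AE x in F. ln \<bar>x - t\<bar> \<le> ln (cmod (Complex (x - t) \<epsilon>))"
  proof eventually_elim
    case (elim x)
    then have "0 < \<bar>x - t\<bar>" by simp
    moreover have "\<bar>x - t\<bar> \<le> cmod (Complex (x - t) \<epsilon>)"
      using abs_Re_le_cmod[of "Complex (x - t) \<epsilon>"] by simp
    ultimately show ?case by (intro ln_mono) auto
  qed
qed

text \<open>On approach to the cut from above, the modulus of \<open>x - t + \<i> e\<close> tends to \<open>\<bar>x - t\<bar>\<close> and its argument
  to \<open>pi\<close> or \<open>0\<close> according to whether \<open>x < t\<close> or \<open>x > t\<close>. The arguments average to
  \<open>pi * cdf F t\<close>.\<close>

lemma boundary_limit:
  assumes e: "\<And>n. 0 < e n" "\<And>n. e n \<le> 1" "e \<longlonglongrightarrow> 0"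
    and t: "measure F {t} = 0" and ln: "integrable F (\<lambda>x. ln \<bar>x - t\<bar>)"
  shows "(\<lambda>n. exp (- (\<integral>x. ln (cmod (Complex (x - t) (e n))) \<partial>F)) * sin (\<integral>x. Im (Ln (Complex (x - t) (e n))) \<partial>F))
    \<longlonglongrightarrow> exp (- Phi F t) * sin (pi * cdf F t)"
proof -
  have no_atom: "AE x in F. x \<notin> {t}" using t by (subst prob_eq_0[symmetric]) auto
  have "(\<lambda>n. \<integral>x. ln (cmod (Complex (x - t) (e n))) \<partial>F) \<longlonglongrightarrow> (\<integral>x. ln \<bar>x - t\<bar> \<partial>F)"
  proof (rule integral_dominated_convergence)
    show "integrable F (\<lambda>x. \<bar>ln \<bar>x - t\<bar>\<bar> + ln (1 + \<bar>x - t\<bar>))"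
      using ln integrable_ln_abs_shift[of t] by simp
    show "AE x in F. (\<lambda>n. ln (cmod (Complex (x - t) (e n)))) \<longlonglongrightarrow> ln \<bar>x - t\<bar>"
      using no_atom
    proof eventually_elim
      case (elim x)
      have "(\<lambda>n. sqrt ((x - t)\<^sup>2 + (e n)\<^sup>2)) \<longlonglongrightarrow> sqrt ((x - t)\<^sup>2 + 0\<^sup>2)"
        by (intro tendsto_real_sqrt tendsto_add tendsto_const tendsto_power e(3))
      then have "(\<lambda>n. cmod (Complex (x - t) (e n))) \<longlonglongrightarrow> \<bar>x - t\<bar>"
        by (simp add: complex_norm)
      then show ?case by (rule tendsto_ln) (use elim in auto)
    qed
    show "AE x in F. norm (ln (cmod (Complex (x - t) (e n)))) \<le> \<bar>ln \<bar>x - t\<bar>\<bar> + ln (1 + \<bar>x - t\<bar>)" for n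
      using no_atom
    proof eventually_elim
      case (elim x)
      then have u: "0 < \<bar>x - t\<bar>" by simp
      have 1: "\<bar>x - t\<bar> \<le> cmod (Complex (x - t) (e n))"
        using abs_Re_le_cmod[of "Complex (x - t) (e n)"] by simp
      have "cmod (Complex (x - t) (e n)) \<le> \<bar>x - t\<bar> + \<bar>e n\<bar>"
        using cmod_le[of "Complex (x - t) (e n)"] by simp
      then have 2: "cmod (Complex (x - t) (e n)) \<le> 1 + \<bar>x - t\<bar>"
        using e(1)[of n] e(2)[of n] by simp
      have "ln \<bar>x - t\<bar> \<le> ln (cmod (Complex (x - t) (e n)))" using 1 u by (intro ln_mono) auto
      moreover have "ln (cmod (Complex (x - t) (e n))) \<le> ln (1 + \<bar>x - t\<bar>)" using 1 2 u by (intro ln_mono) auto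
      moreover have "0 \<le> ln (1 + \<bar>x - t\<bar>)" by simp
      ultimately show ?case unfolding real_norm_def by linarith
    qed
  qed (auto simp: complex_norm)
  then have 1: "(\<lambda>n. \<integral>x. ln (cmod (Complex (x - t) (e n))) \<partial>F) \<longlonglongrightarrow> Phi F t"
    by (simp add: Phi_eq)
  have "(\<lambda>n. \<integral>x. Im (Ln (Complex (x - t) (e n))) \<partial>F) \<longlonglongrightarrow> (\<integral>x. pi * indicator {..<t} x \<partial>F)"
  proof (rule integral_dominated_convergence)
    show "integrable F (\<lambda>x. pi)" by simp
    show "AE x in F. (\<lambda>n. Im (Ln (Complex (x - t) (e n)))) \<longlonglongrightarrow> pi * indicator {..<t} x"
      using no_atom
    proof eventually_elim
      case (elim x)
      then show ?case using Im_Ln_tendsto_upper[of e "x - t", OF e(1,3)] by (cases "x < t") auto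
    qed
    show "AE x in F. norm (Im (Ln (Complex (x - t) (e n)))) \<le> pi" for n
    proof (intro AE_I2)
      fix x
      have "Complex (x - t) (e n) \<noteq> 0" using e(1)[of n] by (auto simp: complex_eq_iff)
      then show "norm (Im (Ln (Complex (x - t) (e n)))) \<le> pi"
        using mpi_less_Im_Ln[of "Complex (x - t) (e n)"] Im_Ln_le_pi[of "Complex (x - t) (e n)"] by simp
    qed
    show "(\<lambda>x. Im (Ln (Complex (x - t) (e n)))) \<in> borel_measurable F" for n
      unfolding Complex_shift by measurable
  qed auto
  also have "(\<integral>x. pi * indicator {..<t} x \<partial>F) = pi * measure F {..<t}" by simp
  also have "measure F {..<t} = cdf F t"
  proof -
    have "{..t} = {..<t} \<union> {t}" by auto
    then have "measure F {..t} = measure F ({..<t} \<union> {t})" by (rule arg_cong)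
    also have "\<dots> = measure F {..<t} + measure F {t}" by (rule finite_measure_Union) auto
    finally show ?thesis using t by (simp add: cdf_def)
  qed
  finally have 2: "(\<lambda>n. \<integral>x. Im (Ln (Complex (x - t) (e n))) \<partial>F) \<longlonglongrightarrow> pi * cdf F t" .
  show ?thesis by (intro tendsto_mult tendsto_exp tendsto_minus tendsto_sin 1 2)
qed

text \<open>Here the absence of a unit atom enters. A small interval \<open>I\<close> around \<open>t0\<close> has mass \<open>p < 1\<close>. For \<open>t\<close> in
  the concentric interval of half the length, the part of the logarithmic integral outside \<open>I\<close> is
  bounded below, and the part inside \<open>I\<close> contributes at most a multiple of
  \<open>1 + \<integral> \<bar>t - x\<bar> powr - p\<close>, uniformly in \<open>\<epsilon>\<close>.\<close>

lemma local_domination: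
  assumes atom: "measure F {t0} \<noteq> 1"
  obtains r :: real and w :: "real \<Rightarrow> ennreal"
  where "0 < r" "w \<in> borel_measurable borel"
    "\<And>a b. a \<le> b \<Longrightarrow> (\<integral>\<^sup>+t. w t * indicator {a..b} t \<partial>lborel) < \<infinity>"
    "AE t in lborel. \<bar>t - t0\<bar> < r \<longrightarrow> (\<forall>\<epsilon>>0. ennreal (exp (- (\<integral>x. ln (cmod (Complex (x - t) \<epsilon>)) \<partial>F))) \<le> w t)"
proof -
  have "(\<lambda>n. measure F (ball t0 (inverse (real (Suc n))))) \<longlonglongrightarrow> measure F (\<Inter>n. ball t0 (inverse (real (Suc n))))"
    by (intro finite_Lim_measure_decseq) (auto simp: decseq_def intro!: subset_ball le_imp_inverse_le)
  also have "(\<Inter>n. ball t0 (inverse (real (Suc n)))) = {t0}"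
  proof safe
    fix x assume x: "x \<in> (\<Inter>n. ball t0 (inverse (real (Suc n))))"
    have "dist t0 x \<le> 0"
      by (rule LIMSEQ_le_const[OF LIMSEQ_inverse_real_of_nat]) (use x in \<open>auto intro: less_imp_le\<close>)
    then show "x = t0" by simp
  qed auto
  finally have lim: "(\<lambda>n. measure F (ball t0 (inverse (real (Suc n))))) \<longlonglongrightarrow> measure F {t0}" .
  have "measure F {t0} < 1" using atom prob_le_1[of "{t0}"] by linarith
  then have "eventually (\<lambda>n. measure F (ball t0 (inverse (real (Suc n)))) < 1) sequentially"
    by (rule order_tendstoD(2)[OF lim])
  then obtain n where n: "measure F (ball t0 (inverse (real (Suc n)))) < 1"
    by (auto simp: eventually_sequentially)
  define I where "I = ball t0 (inverse (real (Suc n)))"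
  define r where "r = inverse (real (Suc n)) / 2"
  define p where "p = measure F I"
  define D where "D t = (\<integral>\<^sup>+x. ennreal (\<bar>t - x\<bar> powr - p) \<partial>F)" for t
  define w where "w t = ennreal (1 / r) * (1 + ennreal (1 / p) * D t)" for t
  have r: "0 < r" "r \<le> 1" by (auto simp: r_def field_simps)
  have p: "0 \<le> p" "p < 1" using n by (auto simp: p_def I_def)
  have I[measurable]: "I \<in> sets borel" by (simp add: I_def)
  have D[measurable]: "D \<in> borel_measurable borel" unfolding D_def[abs_def] by measurable
  show ?thesis
  proof (rule that[of r w])
    show "0 < r" by fact
    show "w \<in> borel_measurable borel" unfolding w_def[abs_def] by measurable
    show "(\<integral>\<^sup>+t. w t * indicator {a..b} t \<partial>lborel) < \<infinity>" if "a \<le> b" for a b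
    proof -
      have "(\<integral>\<^sup>+t. w t * indicator {a..b} t \<partial>lborel)
         = (\<integral>\<^sup>+t. ennreal (1 / r) * (indicator {a..b} t + ennreal (1 / p) * (D t * indicator {a..b} t)) \<partial>lborel)"
        by (intro nn_integral_cong) (simp add: w_def distrib_left distrib_right mult_ac)
      also have "\<dots> = ennreal (1 / r) * (emeasure lborel {a..b} + ennreal (1 / p) * (\<integral>\<^sup>+t. D t * indicator {a..b} t \<partial>lborel))"
        by (simp add: nn_integral_cmult nn_integral_add)
      also have "\<dots> < \<infinity>"
        using le_less_trans[OF nn_integral_abs_powr_Icc_le[OF p that, folded D_def] ennreal_less_top] that
        by (simp add: ennreal_mult_less_top)
      finally show ?thesis .
    qed
    show "AE t in lborel. \<bar>t - t0\<bar> < r \<longrightarrow> (\<forall>\<epsilon>>0. ennreal (exp (- (\<integral>x. ln (cmod (Complex (x - t) \<epsilon>)) \<partial>F))) \<le> w t)"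
      using AE_integrable_ln_abs AE_lborel_no_atom
    proof (eventually_elim, intro impI allI)
      fix t \<epsilon> :: real
      assume ln: "integrable F (\<lambda>x. ln \<bar>x - t\<bar>)" and no_atom: "measure F {t} = 0"
        and t: "\<bar>t - t0\<bar> < r" and \<epsilon>: "0 < \<epsilon>"
      let ?L = "\<integral>x. ln \<bar>x - t\<bar> \<partial>F"
      have AE_neq: "AE x in F. x \<notin> {t}" using no_atom by (subst prob_eq_0[symmetric]) auto
      have far: "r \<le> \<bar>x - t\<bar>" if "x \<notin> I" for x
      proof -
        have "\<bar>t0 - x\<bar> \<le> \<bar>t - t0\<bar> + \<bar>x - t\<bar>" by linarith
        moreover have "2 * r \<le> \<bar>t0 - x\<bar>" using that by (simp add: I_def r_def dist_real_def)
        ultimately show ?thesis using t by linarith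
      qed
      have ln_I: "integrable F (\<lambda>x. ln \<bar>x - t\<bar> * indicator I x)"
        using ln by (rule integrable_real_mult_indicator[rotated]) simp
      have "(\<integral>x. ln \<bar>x - t\<bar> * indicator I x + ln r \<partial>F) \<le> ?L"
      proof (rule integral_mono)
        fix x
        show "ln \<bar>x - t\<bar> * indicator I x + ln r \<le> ln \<bar>x - t\<bar>"
        proof (cases "x \<in> I")
          case False
          then have "ln r \<le> ln \<bar>x - t\<bar>" using far[of x] r by (intro ln_mono) auto
          then show ?thesis using False by simp
        qed (use r in simp)
      qed (use ln ln_I in auto)
      then have "(\<integral>x. ln \<bar>x - t\<bar> * indicator I x \<partial>F) + ln r \<le> ?L"
        using ln_I prob_space by simp
      with integral_ln_abs_le[OF \<epsilon> no_atom ln]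
      have "- (\<integral>x. ln (cmod (Complex (x - t) \<epsilon>)) \<partial>F) \<le> - ln r + (\<integral>x. - ln \<bar>x - t\<bar> * indicator I x \<partial>F)"
        by simp
      then have "exp (- (\<integral>x. ln (cmod (Complex (x - t) \<epsilon>)) \<partial>F)) \<le> exp (- ln r + (\<integral>x. - ln \<bar>x - t\<bar> * indicator I x \<partial>F))"
        by simp
      also have "\<dots> = 1 / r * exp (\<integral>x. - ln \<bar>x - t\<bar> * indicator I x \<partial>F)"
        using r(1) by (simp only: exp_add exp_minus exp_ln divide_inverse mult_1_left)
      finally have "ennreal (exp (- (\<integral>x. ln (cmod (Complex (x - t) \<epsilon>)) \<partial>F)))
        \<le> ennreal (1 / r) * ennreal (exp (\<integral>x. - ln \<bar>x - t\<bar> * indicator I x \<partial>F))"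
        using r by (subst ennreal_mult'[symmetric]) (auto intro: ennreal_leI)
      also have "ennreal (exp (\<integral>x. - ln \<bar>x - t\<bar> * indicator I x \<partial>F))
         \<le> 1 + ennreal (1 / p) * (\<integral>\<^sup>+x. ennreal (exp (p * - ln \<bar>x - t\<bar>)) * indicator I x \<partial>F)"
        unfolding p_def by (rule exp_integral_indicator_le) (use ln in auto)
      also have "(\<integral>\<^sup>+x. ennreal (exp (p * - ln \<bar>x - t\<bar>)) * indicator I x \<partial>F) \<le> D t"
        unfolding D_def
      proof (intro nn_integral_mono_AE, use AE_neq in eventually_elim)
        case (elim x)
        then show ?case by (auto simp: powr_def indicator_def abs_minus_commute)
      qed
      finally show "ennreal (exp (- (\<integral>x. ln (cmod (Complex (x - t) \<epsilon>)) \<partial>F))) \<le> w t"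
        unfolding w_def by (simp add: mult_left_mono add_left_mono)
    qed
  qed
qed

end

text \<open>The law \<open>\<mu>\<close> plays the part of a Dirichlet mean of total mass one, and \<open>F\<close> that of its parameter.\<close>

locale stieltjes_pair = \<mu>: half_line_law \<mu> + F: log_moment_law F for \<mu> F :: "real measure" +
  assumes stieltjes: "\<And>s. 0 < s \<Longrightarrow> (\<integral>x. 1 / (s + x) \<partial>\<mu>) = exp (- (\<integral>x. ln (s + x) \<partial>F))"
begin

text \<open>The imaginary part of the continued identity at the point \<open>- t + \<i> \<epsilon>\<close>. The left-hand side is \<open>pi\<close>
  times the density at \<open>t\<close> of \<open>\<mu>\<close> convolved with a Cauchy law of scale \<open>\<epsilon>\<close>.\<close>

lemma poisson_integral_eq:
  assumes \<epsilon>: "0 < \<epsilon>"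
  shows "(\<integral>x. \<epsilon> / ((x - t)\<^sup>2 + \<epsilon>\<^sup>2) \<partial>\<mu>)
    = exp (- (\<integral>x. ln (cmod (Complex (x - t) \<epsilon>)) \<partial>F)) * sin (\<integral>x. Im (Ln (Complex (x - t) \<epsilon>)) \<partial>F)"
proof -
  let ?J = "\<integral>x. Ln (Complex (x - t) \<epsilon>) \<partial>F"
  have eq: "(\<integral>x. 1 / Complex (x - t) \<epsilon> \<partial>\<mu>) = exp (- ?J)"
    unfolding F.Complex_shift
    by (intro stieltjes_log_continuation \<mu>.half_line_law_axioms F.log_moment_law_axioms stieltjes F.upper_half_plane_not_nonpos_Real \<epsilon>)
  have int: "integrable \<mu> (\<lambda>x. 1 / Complex (x - t) \<epsilon>)"
    unfolding F.Complex_shift by (intro \<mu>.integrable_inverse_shift F.upper_half_plane_not_nonpos_Real \<epsilon>)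
  have "Im (\<integral>x. 1 / Complex (x - t) \<epsilon> \<partial>\<mu>) = (\<integral>x. Im (1 / Complex (x - t) \<epsilon>) \<partial>\<mu>)"
    by (rule integral_bounded_linear[OF bounded_linear_Im int, symmetric])
  also have "\<dots> = (\<integral>x. - (\<epsilon> / ((x - t)\<^sup>2 + \<epsilon>\<^sup>2)) \<partial>\<mu>)"
    by (simp add: Im_divide)
  finally have "(\<integral>x. \<epsilon> / ((x - t)\<^sup>2 + \<epsilon>\<^sup>2) \<partial>\<mu>) = - Im (exp (- ?J))"
    unfolding eq by simp
  also have "\<dots> = exp (- Re ?J) * sin (Im ?J)" by (simp add: Im_exp)
  also have "Re ?J = (\<integral>x. Re (Ln (Complex (x - t) \<epsilon>)) \<partial>F)"
    by (rule integral_bounded_linear[OF bounded_linear_Re F.integrable_Ln_Complex[OF \<epsilon>], symmetric])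
  also have "\<dots> = (\<integral>x. ln (cmod (Complex (x - t) \<epsilon>)) \<partial>F)" by (simp only: F.Re_Ln_Complex[OF \<epsilon>])
  also have "Im ?J = (\<integral>x. Im (Ln (Complex (x - t) \<epsilon>)) \<partial>F)"
    by (rule integral_bounded_linear[OF bounded_linear_Im F.integrable_Ln_Complex[OF \<epsilon>], symmetric])
  finally show ?thesis .
qed

end

lemma (in half_line_law) nn_integral_poisson:
  assumes \<epsilon>: "0 < \<epsilon>" and ab: "a \<le> b"
  shows "(\<integral>\<^sup>+t. ennreal (\<integral>x. \<epsilon> / ((x - t)\<^sup>2 + \<epsilon>\<^sup>2) \<partial>F) * indicator {a..b} t \<partial>lborel)
    = ennreal (\<integral>x. arctan ((b - x) / \<epsilon>) - arctan ((a - x) / \<epsilon>) \<partial>F)"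
proof -
  have pos: "0 < (x - t)\<^sup>2 + \<epsilon>\<^sup>2" for x t :: real using \<epsilon> by (simp add: add_nonneg_pos)
  have int: "integrable F (\<lambda>x. \<epsilon> / ((x - t)\<^sup>2 + \<epsilon>\<^sup>2))" for t
  proof (rule integrable_const_bound[of _ "\<epsilon> / \<epsilon>\<^sup>2"])
    show "AE x in F. norm (\<epsilon> / ((x - t)\<^sup>2 + \<epsilon>\<^sup>2)) \<le> \<epsilon> / \<epsilon>\<^sup>2"
      using \<epsilon> pos by (intro AE_I2) (simp add: frac_le less_imp_le)
  qed simp
  have "(\<integral>\<^sup>+t. ennreal (\<integral>x. \<epsilon> / ((x - t)\<^sup>2 + \<epsilon>\<^sup>2) \<partial>F) * indicator {a..b} t \<partial>lborel)
    = (\<integral>\<^sup>+t. (\<integral>\<^sup>+x. ennreal (\<epsilon> / ((x - t)\<^sup>2 + \<epsilon>\<^sup>2)) * indicator {a..b} t \<partial>F) \<partial>lborel)"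
    using \<epsilon> pos
    by (intro nn_integral_cong) (simp add: nn_integral_eq_integral[OF int, symmetric] nn_integral_multc less_imp_le)
  also have "\<dots> = (\<integral>\<^sup>+x. (\<integral>\<^sup>+t. ennreal (\<epsilon> / ((x - t)\<^sup>2 + \<epsilon>\<^sup>2)) * indicator {a..b} t \<partial>lborel) \<partial>F)"
    by (rule pair_sigma_finite.Fubini'[symmetric, OF pair_sigma_finite.intro])
      (auto intro: sigma_finite_measure_axioms lborel.sigma_finite_measure_axioms)
  also have "\<dots> = (\<integral>\<^sup>+x. ennreal (arctan ((b - x) / \<epsilon>) - arctan ((a - x) / \<epsilon>)) \<partial>F)"
  proof (intro nn_integral_cong nn_integral_FTC_Icc)
    fix x t :: real
    have "((\<lambda>t. arctan ((t - x) / \<epsilon>)) has_real_derivative inverse (1 + ((t - x) / \<epsilon>)\<^sup>2) * (1 / \<epsilon>)) (at t)"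
      using \<epsilon> by (auto intro!: derivative_eq_intros)
    also have "inverse (1 + ((t - x) / \<epsilon>)\<^sup>2) * (1 / \<epsilon>) = \<epsilon> / ((x - t)\<^sup>2 + \<epsilon>\<^sup>2)"
    proof -
      have "1 + ((t - x) / \<epsilon>)\<^sup>2 = ((x - t)\<^sup>2 + \<epsilon>\<^sup>2) / \<epsilon>\<^sup>2"
        using \<epsilon> by (simp add: power_divide add_divide_distrib power2_commute)
      then show ?thesis using \<epsilon> by (simp add: power2_eq_square)
    qed
    finally show "DERIV (\<lambda>t. arctan ((t - x) / \<epsilon>)) t :> \<epsilon> / ((x - t)\<^sup>2 + \<epsilon>\<^sup>2)" .
    show "0 \<le> \<epsilon> / ((x - t)\<^sup>2 + \<epsilon>\<^sup>2)" using \<epsilon> by simp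
  qed (use ab in auto)
  also have "\<dots> = ennreal (\<integral>x. arctan ((b - x) / \<epsilon>) - arctan ((a - x) / \<epsilon>) \<partial>F)"
  proof (rule nn_integral_eq_integral)
    show "AE x in F. 0 \<le> arctan ((b - x) / \<epsilon>) - arctan ((a - x) / \<epsilon>)"
      using ab \<epsilon> by (intro AE_I2) (simp add: arctan_le_iff divide_right_mono)
    show "integrable F (\<lambda>x. arctan ((b - x) / \<epsilon>) - arctan ((a - x) / \<epsilon>))"
    proof (rule integrable_const_bound[of _ pi])
      show "AE x in F. norm (arctan ((b - x) / \<epsilon>) - arctan ((a - x) / \<epsilon>)) \<le> pi"
      proof (intro AE_I2)
        fix x
        show "norm (arctan ((b - x) / \<epsilon>) - arctan ((a - x) / \<epsilon>)) \<le> pi"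
          using arctan_bounded[of "(b - x) / \<epsilon>"] arctan_bounded[of "(a - x) / \<epsilon>"] by (simp add: abs_le_iff)
      qed
    qed simp
  qed
  finally show ?thesis .
qed

section \<open>Inversion of the Stieltjes transform\<close>

lemma sgn_mono_real: "a \<le> b \<Longrightarrow> sgn a \<le> sgn b" for a b :: real
  by (auto simp: sgn_if)

context stieltjes_pair
begin

text \<open>This is \<open>pi\<close> times the density to be identified. The factor \<open>pi\<close> is kept until the end because the
  limits of the arctangent come with it.\<close>

definition inversion_density :: "real \<Rightarrow> real" where
  "inversion_density t = exp (- Phi F t) * sin (pi * cdf F t)"

lemma measurable_inversion_density [measurable]: "inversion_density \<in> borel_measurable borel"
proof -
  have [measurable]: "cdf F \<in> borel_measurable borel"
    by (intro borel_measurable_mono) (auto simp: mono_def cdf_def intro: F.finite_measure_mono)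
  have [measurable]: "Phi F \<in> borel_measurable borel" unfolding F.Phi_eq[abs_def] by measurable
  show ?thesis unfolding inversion_density_def[abs_def] by measurable
qed

text \<open>Up to an additive constant, \<open>pi\<close> times the distribution function of \<open>\<mu>\<close> with jumps split evenly.
  The even split is what Poisson smoothing yields in the limit, and it makes increments additive
  over adjacent closed intervals even before atoms are excluded.\<close>

definition sym_cdf :: "real \<Rightarrow> real" where
  "sym_cdf b = (\<integral>x. pi / 2 * sgn (b - x) \<partial>\<mu>)"

lemma integrable_sgn: "integrable \<mu> (\<lambda>x. pi / 2 * sgn (b - x))"
  by (rule \<mu>.integrable_const_bound[of _ "pi / 2"]) (auto simp: sgn_if)

lemma sym_cdf_mono: "a \<le> b \<Longrightarrow> sym_cdf a \<le> sym_cdf b"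
  unfolding sym_cdf_def by (intro integral_mono integrable_sgn) (auto simp: sgn_if)

text \<open>Integrate the Poisson smoothing of \<open>\<mu>\<close> over \<open>[a, b]\<close> and let the scale tend to zero. The limit can be
  computed under the integral over \<open>\<mu>\<close>, where the arctangent tends to a sign function, and under the
  Lebesgue integral, where the boundary limit is dominated near \<open>t0\<close>.\<close>

lemma local_inversion:
  assumes atom: "measure F {t0} \<noteq> 1"
  shows "\<exists>r>0. \<forall>a b. t0 - r < a \<and> a \<le> b \<and> b < t0 + r \<longrightarrow>
    ennreal (sym_cdf b - sym_cdf a) = (\<integral>\<^sup>+t. ennreal (inversion_density t) * indicator {a..b} t \<partial>lborel)"
proof -
  obtain r w where r: "0 < r" and [measurable]: "w \<in> borel_measurable borel"
    and w: "\<And>a b. a \<le> b \<Longrightarrow> (\<integral>\<^sup>+t. w t * indicator {a..b} t \<partial>lborel) < \<infinity>"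
    and dom: "AE t in lborel. \<bar>t - t0\<bar> < r \<longrightarrow> (\<forall>\<epsilon>>0. ennreal (exp (- (\<integral>x. ln (cmod (Complex (x - t) \<epsilon>)) \<partial>F))) \<le> w t)"
    by (rule F.local_domination[OF atom]) (rule that)
  define e where "e n = inverse (real (Suc n))" for n
  have e: "0 < e n" "e n \<le> 1" for n by (auto simp: e_def field_simps)
  have e0: "e \<longlonglongrightarrow> 0" unfolding e_def[abs_def] by (rule LIMSEQ_inverse_real_of_nat)
  define h where "h n t = (\<integral>x. e n / ((x - t)\<^sup>2 + (e n)\<^sup>2) \<partial>\<mu>)" for n t
  have h_eq: "h n t = exp (- (\<integral>x. ln (cmod (Complex (x - t) (e n))) \<partial>F)) * sin (\<integral>x. Im (Ln (Complex (x - t) (e n))) \<partial>F)" for n t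
    unfolding h_def by (rule poisson_integral_eq[OF e(1)])
  have [measurable]: "h n \<in> borel_measurable borel" for n unfolding h_def[abs_def] by measurable
  show ?thesis
  proof (intro exI[of _ r] conjI allI impI r)
    fix a b assume ab: "t0 - r < a \<and> a \<le> b \<and> b < t0 + r"
    have "(\<lambda>n. \<integral>\<^sup>+t. ennreal (h n t) * indicator {a..b} t \<partial>lborel) \<longlonglongrightarrow> (\<integral>\<^sup>+t. ennreal (inversion_density t) * indicator {a..b} t \<partial>lborel)"
    proof (rule nn_integral_dominated_convergence[where w = "\<lambda>t. w t * indicator {a..b} t"])
      show "AE t in lborel. ennreal (h n t) * indicator {a..b} t \<le> w t * indicator {a..b} t" for n
        using dom
      proof eventually_elim
        case (elim t)
        show ?case
        proof (cases "t \<in> {a..b}")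
          case True
          then have "\<bar>t - t0\<bar> < r" using ab by auto
          then have "ennreal (exp (- (\<integral>x. ln (cmod (Complex (x - t) (e n))) \<partial>F))) \<le> w t"
            using elim e(1) by blast
          moreover have "h n t \<le> exp (- (\<integral>x. ln (cmod (Complex (x - t) (e n))) \<partial>F)) * 1"
            unfolding h_eq by (intro mult_left_mono) auto
          ultimately show ?thesis using True by (auto intro: order_trans[OF ennreal_leI])
        qed simp
      qed
      show "(\<integral>\<^sup>+t. w t * indicator {a..b} t \<partial>lborel) < \<infinity>" using w ab by simp
      show "AE t in lborel. (\<lambda>n. ennreal (h n t) * indicator {a..b} t) \<longlonglongrightarrow> ennreal (inversion_density t) * indicator {a..b} t"
        using F.AE_integrable_ln_abs F.AE_lborel_no_atom
      proof eventually_elim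
        case (elim t)
        have "(\<lambda>n. h n t) \<longlonglongrightarrow> inversion_density t"
          unfolding h_eq inversion_density_def by (rule F.boundary_limit[OF e e0 elim(2,1)])
        then show ?case by (cases "t \<in> {a..b}") (auto intro: tendsto_ennrealI)
      qed
    qed measurable
    moreover have "(\<lambda>n. \<integral>\<^sup>+t. ennreal (h n t) * indicator {a..b} t \<partial>lborel) \<longlonglongrightarrow> ennreal (sym_cdf b - sym_cdf a)"
    proof -
      have "(\<lambda>n. \<integral>x. arctan ((b - x) / e n) - arctan ((a - x) / e n) \<partial>\<mu>)
        \<longlonglongrightarrow> (\<integral>x. pi / 2 * sgn (b - x) - pi / 2 * sgn (a - x) \<partial>\<mu>)"
      proof (rule integral_dominated_convergence)
        show "AE x in \<mu>. (\<lambda>n. arctan ((b - x) / e n) - arctan ((a - x) / e n)) \<longlonglongrightarrow> pi / 2 * sgn (b - x) - pi / 2 * sgn (a - x)"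
          unfolding e_def divide_inverse inverse_inverse_eq
          by (intro AE_I2 tendsto_diff arctan_tendsto_sgn[unfolded divide_inverse])
        show "AE x in \<mu>. norm (arctan ((b - x) / e n) - arctan ((a - x) / e n)) \<le> pi" for n
        proof (intro AE_I2)
          fix x
          show "norm (arctan ((b - x) / e n) - arctan ((a - x) / e n)) \<le> pi"
            using arctan_bounded[of "(b - x) / e n"] arctan_bounded[of "(a - x) / e n"] by (simp add: abs_le_iff)
        qed
      qed auto
      also have "(\<integral>x. pi / 2 * sgn (b - x) - pi / 2 * sgn (a - x) \<partial>\<mu>) = sym_cdf b - sym_cdf a"
        unfolding sym_cdf_def by (intro Bochner_Integration.integral_diff integrable_sgn)
      finally show ?thesis
        unfolding h_def using ab by (subst \<mu>.nn_integral_poisson[OF e(1)]) (auto intro: tendsto_ennrealI)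
    qed
    ultimately show "ennreal (sym_cdf b - sym_cdf a) = (\<integral>\<^sup>+t. ennreal (inversion_density t) * indicator {a..b} t \<partial>lborel)"
      by (rule LIMSEQ_unique[symmetric])
  qed
qed

text \<open>Bolzano's bisection principle glues the local identities together.\<close>

lemma global_inversion:
  assumes atom: "\<And>t. measure F {t} \<noteq> 1" and ab: "a \<le> b"
  shows "ennreal (sym_cdf b - sym_cdf a) = (\<integral>\<^sup>+t. ennreal (inversion_density t) * indicator {a..b} t \<partial>lborel)"
  using ab
proof (rule Bolzano[where P = "\<lambda>a b. ennreal (sym_cdf b - sym_cdf a) = (\<integral>\<^sup>+t. ennreal (inversion_density t) * indicator {a..b} t \<partial>lborel)"])
  fix a b c :: real
  assume ab: "ennreal (sym_cdf b - sym_cdf a) = (\<integral>\<^sup>+t. ennreal (inversion_density t) * indicator {a..b} t \<partial>lborel)"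
    and bc: "ennreal (sym_cdf c - sym_cdf b) = (\<integral>\<^sup>+t. ennreal (inversion_density t) * indicator {b..c} t \<partial>lborel)" and le: "a \<le> b" "b \<le> c"
  have "(\<integral>\<^sup>+t. ennreal (inversion_density t) * indicator {a..c} t \<partial>lborel)
    = (\<integral>\<^sup>+t. ennreal (inversion_density t) * indicator {a..b} t + ennreal (inversion_density t) * indicator {b..c} t \<partial>lborel)"
  proof (rule nn_integral_cong_AE)
    have "AE t in lborel. t \<noteq> b" by (rule AE_lborel_singleton)
    then show "AE t in lborel. ennreal (inversion_density t) * indicator {a..c} t = ennreal (inversion_density t) * indicator {a..b} t + ennreal (inversion_density t) * indicator {b..c} t"
      by eventually_elim (use le in \<open>auto simp: indicator_def\<close>)
  qed
  also have "\<dots> = ennreal (sym_cdf b - sym_cdf a) + ennreal (sym_cdf c - sym_cdf b)"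
    by (subst nn_integral_add) (simp_all add: ab bc)
  also have "\<dots> = ennreal (sym_cdf c - sym_cdf a)"
    using sym_cdf_mono[OF le(1)] sym_cdf_mono[OF le(2)] by (subst ennreal_plus[symmetric]) auto
  finally show "ennreal (sym_cdf c - sym_cdf a) = (\<integral>\<^sup>+t. ennreal (inversion_density t) * indicator {a..c} t \<partial>lborel)" ..
next
  fix x :: real
  obtain r where r: "0 < r" "\<forall>a b. x - r < a \<and> a \<le> b \<and> b < x + r \<longrightarrow>
    ennreal (sym_cdf b - sym_cdf a) = (\<integral>\<^sup>+t. ennreal (inversion_density t) * indicator {a..b} t \<partial>lborel)"
    using local_inversion[OF atom[of x]] by blast
  show "\<exists>d>0. \<forall>a b. a \<le> x \<and> x \<le> b \<and> b - a < d \<longrightarrow>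
    ennreal (sym_cdf b - sym_cdf a) = (\<integral>\<^sup>+t. ennreal (inversion_density t) * indicator {a..b} t \<partial>lborel)"
  proof (intro exI[of _ r] conjI allI impI r(1))
    fix a b assume "a \<le> x \<and> x \<le> b \<and> b - a < r"
    then have "x - r < a \<and> a \<le> b \<and> b < x + r" by linarith
    then show "ennreal (sym_cdf b - sym_cdf a) = (\<integral>\<^sup>+t. ennreal (inversion_density t) * indicator {a..b} t \<partial>lborel)"
      using r(2) by blast
  qed
qed

text \<open>An atom at \<open>c\<close> would contribute \<open>pi\<close> times its mass to every increment of \<^term>\<open>sym_cdf\<close> across \<open>c\<close>, but
  these increments are Lebesgue integrals over shrinking intervals.\<close>

lemma no_atom:
  assumes atom: "\<And>t. measure F {t} \<noteq> 1"
  shows "measure \<mu> {c} = 0"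
proof -
  let ?\<nu> = "density lborel (\<lambda>t. ennreal (inversion_density t))"
  define A where "A n = {c - inverse (real (Suc n))..c + inverse (real (Suc n))}" for n
  have A_eq: "emeasure ?\<nu> (A n) = ennreal (sym_cdf (c + inverse (real (Suc n))) - sym_cdf (c - inverse (real (Suc n))))" for n
    unfolding A_def by (subst emeasure_density) (auto simp: global_inversion[OF atom])
  have "(\<lambda>n. emeasure ?\<nu> (A n)) \<longlonglongrightarrow> emeasure ?\<nu> (\<Inter>n. A n)"
  proof (rule Lim_emeasure_decseq)
    show "decseq A" unfolding decseq_def
    proof (intro allI impI)
      fix m n :: nat assume "m \<le> n"
      then have "inverse (real (Suc n)) \<le> inverse (real (Suc m))" by (intro le_imp_inverse_le) auto
      then show "A n \<subseteq> A m" unfolding A_def atLeastatMost_subset_iff by linarith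
    qed
  qed (auto simp: A_eq, simp add: A_def)
  also have "(\<Inter>n. A n) = {c}"
  proof safe
    fix x assume x: "x \<in> (\<Inter>n. A n)"
    have "\<bar>x - c\<bar> \<le> inverse (real (Suc n))" for n
    proof -
      have "x \<in> A n" using x by blast
      then show ?thesis unfolding A_def atLeastAtMost_iff by linarith
    qed
    then have "\<bar>x - c\<bar> \<le> 0"
      by (intro LIMSEQ_le_const[OF LIMSEQ_inverse_real_of_nat] exI allI impI)
    then show "x = c" by simp
  qed (auto simp: A_def)
  also have "emeasure ?\<nu> {c} = 0"
    by (subst emeasure_density) (auto intro!: nn_integral_0_iff_AE[THEN iffD2] AE_mp[OF AE_lborel_singleton[of c]])
  finally have lim: "(\<lambda>n. emeasure ?\<nu> (A n)) \<longlonglongrightarrow> 0" .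
  have "ennreal (pi * measure \<mu> {c}) \<le> emeasure ?\<nu> (A n)" for n
  proof -
    let ?e = "inverse (real (Suc n))"
    have e: "0 < ?e" by simp
    have "pi * measure \<mu> {c} = (\<integral>x. pi * indicator {c} x \<partial>\<mu>)" by simp
    also have "\<dots> \<le> (\<integral>x. pi / 2 * sgn (c + ?e - x) - pi / 2 * sgn (c - ?e - x) \<partial>\<mu>)"
    proof (intro integral_mono Bochner_Integration.integrable_diff integrable_sgn)
      fix x
      show "pi * indicator {c} x \<le> pi / 2 * sgn (c + ?e - x) - pi / 2 * sgn (c - ?e - x)"
      proof (cases "x = c")
        case True
        then show ?thesis using e by simp
      next
        case False
        moreover have "sgn (c - ?e - x) \<le> sgn (c + ?e - x)"
          by (rule sgn_mono_real) (use e in linarith)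
        ultimately show ?thesis by (simp add: mult_left_mono)
      qed
    qed (simp add: less_top[symmetric])
    also have "\<dots> = sym_cdf (c + ?e) - sym_cdf (c - ?e)"
      unfolding sym_cdf_def by (intro Bochner_Integration.integral_diff integrable_sgn)
    finally show ?thesis unfolding A_eq by (rule ennreal_leI)
  qed
  then have "ennreal (pi * measure \<mu> {c}) \<le> 0"
    by (intro LIMSEQ_le_const[OF lim]) auto
  then have "pi * measure \<mu> {c} \<le> 0" by (simp add: ennreal_eq_0_iff)
  then show ?thesis using measure_nonneg[of \<mu> "{c}"] pi_gt_zero by (simp add: mult_le_0_iff)
qed

text \<open>Without atoms, the increments of \<^term>\<open>sym_cdf\<close> are \<open>pi\<close> times the masses of intervals, and half-lines
  are increasing unions of bounded intervals.\<close>

lemma stieltjes_inversion: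
  assumes atom: "\<And>t. measure F {t} \<noteq> 1"
  shows "\<mu> = density lborel (\<lambda>t. ennreal (sin (pi * cdf F t) * exp (- Phi F t) / pi))"
proof (rule measure_eqI_lessThan)
  let ?\<nu> = "density lborel (\<lambda>t. ennreal (inversion_density t))"
  have Ioc: "ennreal pi * emeasure \<mu> {a<..b} = emeasure ?\<nu> {a<..b}" if "a \<le> b" for a b
  proof -
    have "AE x in \<mu>. x \<notin> {c}" for c using no_atom[OF atom, of c] by (subst \<mu>.prob_eq_0[symmetric]) auto
    from this[of a] this[of b]
    have "(\<integral>x. pi / 2 * sgn (b - x) - pi / 2 * sgn (a - x) \<partial>\<mu>) = (\<integral>x. pi * indicator {a<..b} x \<partial>\<mu>)"
    proof (intro integral_cong_AE, goal_cases)
      case 3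
      then show ?case by eventually_elim (use that in \<open>auto simp: sgn_if indicator_def\<close>)
    qed auto
    also have "(\<integral>x. pi / 2 * sgn (b - x) - pi / 2 * sgn (a - x) \<partial>\<mu>) = sym_cdf b - sym_cdf a"
      unfolding sym_cdf_def by (intro Bochner_Integration.integral_diff integrable_sgn)
    finally have "ennreal (sym_cdf b - sym_cdf a) = ennreal pi * emeasure \<mu> {a<..b}"
      by (simp add: \<mu>.emeasure_eq_measure ennreal_mult')
    also have "ennreal (sym_cdf b - sym_cdf a) = (\<integral>\<^sup>+t. ennreal (inversion_density t) * indicator {a<..b} t \<partial>lborel)"
      unfolding global_inversion[OF atom that]
      by (intro nn_integral_cong_AE, use AE_lborel_singleton[of a] in eventually_elim) (auto simp: indicator_def)
    also have "\<dots> = emeasure ?\<nu> {a<..b}" by (subst emeasure_density) auto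
    finally show ?thesis ..
  qed
  have Ioi: "ennreal pi * emeasure \<mu> {x<..} = emeasure ?\<nu> {x<..}" for x
  proof -
    have un: "(\<Union>n. {x<..x + real n}) = {x<..}"
    proof safe
      fix y assume "x < y"
      moreover obtain n where "y - x \<le> real n" using real_arch_simple by blast
      ultimately show "y \<in> (\<Union>n. {x<..x + real n})" by (intro UN_I[of n]) auto
    qed auto
    have inc: "incseq (\<lambda>n. {x<..x + real n})" by (auto simp: incseq_def)
    have sets: "range (\<lambda>n. {x<..x + real n}) \<subseteq> sets borel" by auto
    have "(\<lambda>n. ennreal pi * emeasure \<mu> {x<..x + real n}) \<longlonglongrightarrow> ennreal pi * emeasure \<mu> {x<..}"
      using Lim_emeasure_incseq[OF _ inc, of \<mu>] sets by (intro ennreal_tendsto_cmult) (simp_all add: un)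
    moreover have "(\<lambda>n. emeasure ?\<nu> {x<..x + real n}) \<longlonglongrightarrow> emeasure ?\<nu> {x<..}"
      using Lim_emeasure_incseq[OF _ inc, of ?\<nu>] sets by (simp add: un)
    ultimately show ?thesis by (simp add: Ioc LIMSEQ_unique)
  qed
  have scale: "ennreal (sin (pi * cdf F t) * exp (- Phi F t) / pi) = ennreal (1 / pi) * ennreal (inversion_density t)" for t
    by (subst ennreal_mult'[symmetric]) (auto simp: inversion_density_def mult.commute)
  show "emeasure \<mu> {x<..} = emeasure (density lborel (\<lambda>t. ennreal (sin (pi * cdf F t) * exp (- Phi F t) / pi))) {x<..}" for x
  proof -
    have "emeasure (density lborel (\<lambda>t. ennreal (sin (pi * cdf F t) * exp (- Phi F t) / pi))) {x<..}
       = ennreal (1 / pi) * emeasure ?\<nu> {x<..}"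
      unfolding scale by (subst (1 2) emeasure_density) (auto simp: mult.assoc nn_integral_cmult)
    also have "\<dots> = ennreal (1 / pi) * ennreal pi * emeasure \<mu> {x<..}"
      by (simp add: Ioi[symmetric] mult.assoc)
    also have "ennreal (1 / pi) * ennreal pi = 1" by (subst ennreal_mult'[symmetric]) auto
    finally show ?thesis by simp
  qed
qed (auto simp: less_top[symmetric])

end

section \<open>Products of independent variables\<close>

text \<open>Multiplicative convolution.\<close>

definition mult_law :: "real measure \<Rightarrow> real measure \<Rightarrow> real measure" where
  "mult_law \<mu> \<nu> = distr (\<mu> \<Otimes>\<^sub>M \<nu>) borel (\<lambda>(x, y). x * y)"

lemma sets_mult_law [simp, measurable_cong]: "sets (mult_law \<mu> \<nu>) = sets borel"
  by (simp add: mult_law_def)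

lemma measurable_mult_pair:
  assumes [measurable_cong]: "sets \<mu> = sets (borel :: real measure)" "sets \<nu> = sets (borel :: real measure)"
  shows "(\<lambda>(x, y). x * y) \<in> borel_measurable (\<mu> \<Otimes>\<^sub>M \<nu>)"
  by measurable

lemma prob_space_mult_law:
  assumes "prob_space \<mu>" "prob_space \<nu>" "sets \<mu> = sets borel" "sets \<nu> = sets borel"
  shows "prob_space (mult_law \<mu> \<nu>)"
proof -
  interpret \<mu>: prob_space \<mu> by fact
  interpret \<nu>: prob_space \<nu> by fact
  interpret pair_prob_space \<mu> \<nu> ..
  show ?thesis unfolding mult_law_def by (rule prob_space_distr[OF measurable_mult_pair[OF assms(3,4)]])
qed

lemma nn_integral_mult_law:
  assumes "prob_space \<mu>" "prob_space \<nu>" and sets: "sets \<mu> = sets borel" "sets \<nu> = sets borel"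
    and f[measurable]: "f \<in> borel_measurable borel"
  shows "(\<integral>\<^sup>+z. f z \<partial>mult_law \<mu> \<nu>) = (\<integral>\<^sup>+y. \<integral>\<^sup>+x. f (x * y) \<partial>\<mu> \<partial>\<nu>)"
proof -
  interpret \<mu>: prob_space \<mu> by fact
  interpret \<nu>: prob_space \<nu> by fact
  interpret pair_prob_space \<mu> \<nu> ..
  note [measurable_cong] = sets
  have "(\<integral>\<^sup>+z. f z \<partial>mult_law \<mu> \<nu>) = (\<integral>\<^sup>+p. (case p of (x, y) \<Rightarrow> f (x * y)) \<partial>(\<mu> \<Otimes>\<^sub>M \<nu>))"
    unfolding mult_law_def using measurable_mult_pair[OF sets] by (subst nn_integral_distr) (auto intro!: nn_integral_cong)
  also have "\<dots> = (\<integral>\<^sup>+y. \<integral>\<^sup>+x. f (x * y) \<partial>\<mu> \<partial>\<nu>)"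
    by (subst nn_integral_snd[symmetric]) (simp_all, measurable)
  finally show ?thesis .
qed

lemma mult_law_assoc:
  assumes p: "prob_space \<mu>" "prob_space \<nu>" "prob_space \<kappa>"
    and s: "sets \<mu> = sets borel" "sets \<nu> = sets borel" "sets \<kappa> = sets borel"
  shows "mult_law (mult_law \<mu> \<nu>) \<kappa> = mult_law \<mu> (mult_law \<nu> \<kappa>)"
proof (rule measure_eqI)
  interpret \<mu>: prob_space \<mu> by fact
  note [measurable_cong] = s
  fix A assume "A \<in> sets (mult_law (mult_law \<mu> \<nu>) \<kappa>)"
  then have [measurable]: "A \<in> sets borel" by simp
  have "emeasure (mult_law (mult_law \<mu> \<nu>) \<kappa>) A = (\<integral>\<^sup>+z. indicator A z \<partial>mult_law (mult_law \<mu> \<nu>) \<kappa>)" by simp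
  also have "\<dots> = (\<integral>\<^sup>+w. \<integral>\<^sup>+y. \<integral>\<^sup>+x. indicator A (x * y * w) \<partial>\<mu> \<partial>\<nu> \<partial>\<kappa>)"
    by (simp add: nn_integral_mult_law prob_space_mult_law p s del: nn_integral_indicator)
  also have "\<dots> = (\<integral>\<^sup>+z. indicator A z \<partial>mult_law \<mu> (mult_law \<nu> \<kappa>))"
    by (simp add: nn_integral_mult_law prob_space_mult_law p s mult.assoc del: nn_integral_indicator)
  finally show "emeasure (mult_law (mult_law \<mu> \<nu>) \<kappa>) A = emeasure (mult_law \<mu> (mult_law \<nu> \<kappa>)) A" by simp
qed simp

lemma (in prob_space) distr_mult_indep_var:
  assumes "indep_var borel U borel V"
  shows "distr M borel (\<lambda>\<omega>. U \<omega> * V \<omega>) = mult_law (distr M borel U) (distr M borel (V :: 'a \<Rightarrow> real))"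
proof -
  have [measurable]: "random_variable borel U" "random_variable borel V"
    and eq: "distr M borel U \<Otimes>\<^sub>M distr M borel V = distr M (borel \<Otimes>\<^sub>M borel) (\<lambda>\<omega>. (U \<omega>, V \<omega>))"
    using assms by (auto simp: indep_var_distribution_eq)
  show ?thesis unfolding mult_law_def eq by (subst distr_distr) (auto simp: o_def)
qed

text \<open>Conditionally on the second factor, the first is only rescaled.\<close>

lemma mult_law_density:
  fixes u :: "real \<Rightarrow> real"
  assumes [measurable]: "u \<in> borel_measurable borel" and u: "prob_space (density lborel (\<lambda>x. ennreal (u x)))" "\<And>x. 0 \<le> u x"
    and \<nu>: "prob_space \<nu>" "sets \<nu> = sets borel" and pos: "AE v in \<nu>. 0 < v"
  shows "mult_law (density lborel (\<lambda>x. ennreal (u x))) \<nu> = density lborel (\<lambda>x. \<integral>\<^sup>+v. ennreal (u (x / v) / v) \<partial>\<nu>)"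
proof (rule measure_eqI)
  let ?\<mu> = "density lborel (\<lambda>x. ennreal (u x))"
  interpret \<nu>: prob_space \<nu> by fact
  note [measurable_cong] = \<nu>(2)
  fix A assume "A \<in> sets (mult_law ?\<mu> \<nu>)"
  then have [measurable]: "A \<in> sets borel" by simp
  have "emeasure (mult_law ?\<mu> \<nu>) A = (\<integral>\<^sup>+z. indicator A z \<partial>mult_law ?\<mu> \<nu>)" by simp
  also have "\<dots> = (\<integral>\<^sup>+v. \<integral>\<^sup>+x. indicator A (x * v) \<partial>?\<mu> \<partial>\<nu>)"
    using u \<nu> by (intro nn_integral_mult_law) auto
  also have "\<dots> = (\<integral>\<^sup>+v. \<integral>\<^sup>+x. ennreal (u (x / v) / v) * indicator A x \<partial>lborel \<partial>\<nu>)"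
  proof (intro nn_integral_cong_AE, use pos in eventually_elim)
    case (elim v)
    have "(\<integral>\<^sup>+x. indicator A (x * v) \<partial>?\<mu>) = (\<integral>\<^sup>+x. ennreal (u x) * indicator A (x * v) \<partial>lborel)"
      by (subst nn_integral_density) auto
    also have "\<dots> = ennreal \<bar>1 / v\<bar> * (\<integral>\<^sup>+x. ennreal (u (0 + 1 / v * x)) * indicator A ((0 + 1 / v * x) * v) \<partial>lborel)"
      using elim by (intro nn_integral_real_affine) auto
    also have "\<dots> = (\<integral>\<^sup>+x. ennreal \<bar>1 / v\<bar> * (ennreal (u (0 + 1 / v * x)) * indicator A ((0 + 1 / v * x) * v)) \<partial>lborel)"
      by (rule nn_integral_cmult[symmetric]) measurable
    also have "\<dots> = (\<integral>\<^sup>+x. ennreal (u (x / v) / v) * indicator A x \<partial>lborel)"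
      using elim u(2) by (intro nn_integral_cong) (simp add: mult.assoc[symmetric] ennreal_mult'[symmetric])
    finally show ?case .
  qed
  also have "\<dots> = (\<integral>\<^sup>+x. \<integral>\<^sup>+v. ennreal (u (x / v) / v) * indicator A x \<partial>\<nu> \<partial>lborel)"
    by (rule pair_sigma_finite.Fubini'[OF pair_sigma_finite.intro])
      (auto intro: \<nu>.sigma_finite_measure_axioms lborel.sigma_finite_measure_axioms)
  also have "\<dots> = emeasure (density lborel (\<lambda>x. \<integral>\<^sup>+v. ennreal (u (x / v) / v) \<partial>\<nu>)) A"
    by (subst emeasure_density) (auto simp: nn_integral_multc)
  finally show "emeasure (mult_law ?\<mu> \<nu>) A = emeasure (density lborel (\<lambda>x. \<integral>\<^sup>+v. ennreal (u (x / v) / v) \<partial>\<nu>)) A" .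
qed simp

lemma sets_beta_law [simp, measurable_cong]: "sets (beta_law a b) = sets borel"
  by (simp add: beta_law_def)

lemma measurable_beta_density [measurable]: "beta_density a b \<in> borel_measurable borel"
  unfolding beta_density_def[abs_def] by measurable

lemma AE_beta_law_pos: "AE x in beta_law a b. 0 < x"
proof (cases "b = 0")
  case True
  then show ?thesis using AE_return[of "1::real" borel "\<lambda>x. 0 < x"] unfolding beta_law_def by simp
next
  case False
  then show ?thesis unfolding beta_law_def by (auto simp: AE_density beta_density_def)
qed

lemma gamma_law_eq_density: "0 < a \<Longrightarrow> gamma_law a = density lborel (\<lambda>x. ennreal (gamma_density a x))"
  by (simp add: gamma_law_def)

text \<open>The substitution \<open>t = x / v - x\<close> turns the mixture density at \<open>x\<close> into a gamma integral with
  parameter \<open>1 - \<sigma>\<close>. The case \<open>\<sigma> = 1\<close> is separate because the beta law is then a point mass.\<close>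

lemma gamma_beta_mult_law:
  assumes \<sigma>: "0 < \<sigma>" "\<sigma> \<le> 1" and beta: "prob_space (beta_law \<sigma> (1 - \<sigma>))"
  shows "mult_law (gamma_law 1) (beta_law \<sigma> (1 - \<sigma>)) = gamma_law \<sigma>"
proof -
  interpret beta: prob_space "beta_law \<sigma> (1 - \<sigma>)" by fact
  have "mult_law (gamma_law 1) (beta_law \<sigma> (1 - \<sigma>))
    = density lborel (\<lambda>x. \<integral>\<^sup>+v. ennreal (gamma_density 1 (x / v) / v) \<partial>beta_law \<sigma> (1 - \<sigma>))"
    using prob_space_gamma_law[of 1] unfolding gamma_law_eq_density[OF zero_less_one]
    by (intro mult_law_density beta AE_beta_law_pos gamma_density_nonneg) auto
  also have "\<dots> = density lborel (\<lambda>x. ennreal (gamma_density \<sigma> x))"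
  proof (rule density_cong)
    show "AE x in lborel. (\<integral>\<^sup>+v. ennreal (gamma_density 1 (x / v) / v) \<partial>beta_law \<sigma> (1 - \<sigma>)) = ennreal (gamma_density \<sigma> x)"
    proof (intro AE_I2)
      fix x :: real
      show "(\<integral>\<^sup>+v. ennreal (gamma_density 1 (x / v) / v) \<partial>beta_law \<sigma> (1 - \<sigma>)) = ennreal (gamma_density \<sigma> x)"
      proof (cases "\<sigma> = 1")
        case True
        then show ?thesis by (simp add: beta_law_def nn_integral_return)
      next
        case False
        then have \<sigma>1: "\<sigma> < 1" using \<sigma> by simp
        have G: "0 < Gamma \<sigma>" "0 < Gamma (1 - \<sigma>)" using \<sigma> \<sigma>1 by (auto intro: Gamma_real_pos)
        have Beta_eq: "Beta \<sigma> (1 - \<sigma>) = Gamma \<sigma> * Gamma (1 - \<sigma>)" by (simp add: Beta_def)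
        have "(\<integral>\<^sup>+v. ennreal (gamma_density 1 (x / v) / v) \<partial>beta_law \<sigma> (1 - \<sigma>))
          = (\<integral>\<^sup>+v. ennreal (beta_density \<sigma> (1 - \<sigma>) v) * ennreal (gamma_density 1 (x / v) / v) \<partial>lborel)"
          using False by (simp add: beta_law_def nn_integral_density)
        also have "\<dots> = ennreal (gamma_density \<sigma> x)"
        proof (cases "0 < x")
          case x: True
          let ?g = "\<lambda>v. x / v - x" and ?f = "\<lambda>t. t powr ((1 - \<sigma>) - 1) / exp t"
          have img: "?g ` {0<..<1} = {0<..}"
          proof (intro equalityI subsetI)
            fix t assume "t \<in> ?g ` {0<..<1}"
            then show "t \<in> {0<..}" using x by (auto simp: field_simps)
          next
            fix t :: real assume "t \<in> {0<..}"
            then have "0 < t" by simp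
            then show "t \<in> ?g ` {0<..<1}"
              using x by (intro image_eqI[of _ _ "x / (x + t)"]) (auto simp: field_simps)
          qed
          have "(\<integral>\<^sup>+v. ennreal (\<bar>- x / v\<^sup>2\<bar> * ?f (?g v)) * indicator {0<..<1} v \<partial>lborel) = ennreal (Gamma (1 - \<sigma>))"
          proof (rule nn_integral_change_of_variables[where f = ?f and g = ?g and g' = "\<lambda>v. - x / v\<^sup>2"])
            show "(?f has_integral Gamma (1 - \<sigma>)) (?g ` {0<..<1})"
              unfolding img using \<sigma>1 by (intro Gamma_integral_real_open) simp
            show "inj_on ?g {0<..<1}" using x by (auto intro!: inj_onI simp: field_simps)
          qed (auto intro!: derivative_eq_intros simp: power2_eq_square)
          then have "ennreal (exp (- x) * x powr (\<sigma> - 1) / Beta \<sigma> (1 - \<sigma>)) * (\<integral>\<^sup>+v. ennreal (\<bar>- x / v\<^sup>2\<bar> * ?f (?g v)) * indicator {0<..<1} v \<partial>lborel)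
            = ennreal (gamma_density \<sigma> x)"
            using x G by (simp add: ennreal_mult''[symmetric] gamma_density_def Beta_eq)
          moreover have "ennreal (exp (- x) * x powr (\<sigma> - 1) / Beta \<sigma> (1 - \<sigma>)) * (\<integral>\<^sup>+v. ennreal (\<bar>- x / v\<^sup>2\<bar> * ?f (?g v)) * indicator {0<..<1} v \<partial>lborel)
            = (\<integral>\<^sup>+v. ennreal (exp (- x) * x powr (\<sigma> - 1) / Beta \<sigma> (1 - \<sigma>)) * (ennreal (\<bar>- x / v\<^sup>2\<bar> * ?f (?g v)) * indicator {0<..<1} v) \<partial>lborel)"
            by (rule nn_integral_cmult[symmetric]) measurable
          moreover have "ennreal (exp (- x) * x powr (\<sigma> - 1) / Beta \<sigma> (1 - \<sigma>)) * (ennreal (\<bar>- x / v\<^sup>2\<bar> * ?f (?g v)) * indicator {0<..<1} v)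
             = ennreal (beta_density \<sigma> (1 - \<sigma>) v) * ennreal (gamma_density 1 (x / v) / v)" for v
          proof (cases "v \<in> {0<..<1}")
            case True
            then have v: "0 < v" "v < 1" by auto
            have one: "x powr (\<sigma> - 1) * x * x powr - \<sigma> = 1"
              using x by (simp add: powr_diff powr_minus)
            have "?g v = x * (1 - v) / v" using v by (simp add: field_simps)
            then have "?g v powr ((1 - \<sigma>) - 1) = x powr - \<sigma> * (1 - v) powr - \<sigma> / v powr - \<sigma>"
              using v x by (simp add: powr_divide powr_mult)
            moreover have "v powr (\<sigma> - 1) / v = inverse (v\<^sup>2) / v powr - \<sigma>"
              using v by (simp add: powr_diff powr_minus power2_eq_square field_simps)
            moreover have "exp (- x) / exp (?g v) = exp (- (x / v))"
              by (simp add: exp_diff exp_minus field_simps)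
            moreover have "exp (- x) * x powr (\<sigma> - 1) / Beta \<sigma> (1 - \<sigma>) * (\<bar>- x / v\<^sup>2\<bar> * ?f (?g v))
               = x powr (\<sigma> - 1) * x * ?g v powr ((1 - \<sigma>) - 1) * inverse (v\<^sup>2) * (exp (- x) / exp (?g v)) / Beta \<sigma> (1 - \<sigma>)"
              using x by (simp add: divide_inverse mult_ac abs_mult)
            moreover have "beta_density \<sigma> (1 - \<sigma>) v * (gamma_density 1 (x / v) / v)
               = v powr (\<sigma> - 1) / v * (1 - v) powr - \<sigma> * exp (- (x / v)) / Beta \<sigma> (1 - \<sigma>)"
              using x v by (simp add: beta_density_def gamma_density_def)
            ultimately have "exp (- x) * x powr (\<sigma> - 1) / Beta \<sigma> (1 - \<sigma>) * (\<bar>- x / v\<^sup>2\<bar> * ?f (?g v))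
               = (x powr (\<sigma> - 1) * x * x powr - \<sigma>) * (beta_density \<sigma> (1 - \<sigma>) v * (gamma_density 1 (x / v) / v))"
              by (simp only:) (simp add: divide_inverse mult_ac)
            then have "exp (- x) * x powr (\<sigma> - 1) / Beta \<sigma> (1 - \<sigma>) * (\<bar>- x / v\<^sup>2\<bar> * ?f (?g v))
               = beta_density \<sigma> (1 - \<sigma>) v * (gamma_density 1 (x / v) / v)"
              unfolding one mult_1_left .
            moreover have "0 \<le> exp (- x) * x powr (\<sigma> - 1) / Beta \<sigma> (1 - \<sigma>)" "0 \<le> beta_density \<sigma> (1 - \<sigma>) v"
              using G by (auto simp: Beta_eq beta_density_def)
            moreover have "indicator {0<..<1} v = (1 :: ennreal)" using True by simp
            ultimately show ?thesis by (simp only: mult_1_right ennreal_mult'[symmetric])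
          qed (auto simp: beta_density_def)
          ultimately show ?thesis by simp
        next
          case x: False
          have "(\<integral>\<^sup>+v. ennreal (beta_density \<sigma> (1 - \<sigma>) v) * ennreal (gamma_density 1 (x / v) / v) \<partial>lborel) = (\<integral>\<^sup>+v. 0 \<partial>(lborel :: real measure))"
            using x by (intro nn_integral_cong) (auto simp: beta_density_def gamma_density_def zero_less_divide_iff)
          then show ?thesis using x by (simp add: gamma_density_def)
        qed
        finally show ?thesis .
      qed
    qed
    show "(\<lambda>x. \<integral>\<^sup>+v. ennreal (gamma_density 1 (x / v) / v) \<partial>beta_law \<sigma> (1 - \<sigma>)) \<in> borel_measurable lborel"
      unfolding measurable_lborel1 by (rule beta.borel_measurable_nn_integral) measurable
  qed simp
  also have "\<dots> = gamma_law \<sigma>" using \<sigma> by (simp add: gamma_law_eq_density)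
  finally show ?thesis .
qed

text \<open>Compare the Laplace transforms at \<open>c\<close> of both sides of \<open>G\<^sub>1 \<beta> = G\<^sub>\<sigma>\<close>: conditionally on \<open>\<beta> = b\<close>, the
  left-hand side yields \<open>1 / (1 + c b)\<close>.\<close>

lemma nn_integral_beta_law_stieltjes:
  assumes \<sigma>: "0 < \<sigma>" "\<sigma> \<le> 1" and beta: "prob_space (beta_law \<sigma> (1 - \<sigma>))" and c: "0 \<le> c"
  shows "(\<integral>\<^sup>+b. ennreal ((1 + c * b) powr - 1) \<partial>beta_law \<sigma> (1 - \<sigma>)) = ennreal ((1 + c) powr - \<sigma>)"
proof -
  have "ennreal ((1 + c) powr - \<sigma>) = (\<integral>\<^sup>+x. ennreal (exp (- c * x)) \<partial>gamma_law \<sigma>)"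
    using \<sigma> c by (subst nn_integral_gamma_law_exp) auto
  also have "\<dots> = (\<integral>\<^sup>+b. \<integral>\<^sup>+x. ennreal (exp (- c * (x * b))) \<partial>gamma_law 1 \<partial>beta_law \<sigma> (1 - \<sigma>))"
    unfolding gamma_beta_mult_law[OF \<sigma> beta, symmetric]
    by (intro nn_integral_mult_law prob_space_gamma_law beta) auto
  also have "\<dots> = (\<integral>\<^sup>+b. ennreal ((1 + c * b) powr - 1) \<partial>beta_law \<sigma> (1 - \<sigma>))"
  proof (intro nn_integral_cong_AE, use AE_beta_law_pos in eventually_elim)
    case (elim b)
    then have "0 \<le> c * b" using c by simp
    then have "- 1 < c * b" by linarith
    then show ?case using nn_integral_gamma_law_exp[of 1 "c * b"] by (simp add: mult_ac)
  qed
  finally show ?thesis ..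
qed

section \<open>Dirichlet means of mass one and Bernoulli products\<close>

text \<open>Almost surely \<open>Y\<close> is \<open>0\<close> or \<open>1\<close>, so \<open>f (X Y)\<close> is \<open>f (X)\<close> on one event and \<open>f 0\<close> on the other, and
  the first event is independent of \<open>X\<close>.\<close>

lemma (in prob_space) bernoulli_mult_mixture:
  fixes X Y :: "'a \<Rightarrow> real" and f :: "real \<Rightarrow> real"
  assumes indep: "indep_var borel X borel Y"
    and \<sigma>: "0 \<le> \<sigma>" "\<sigma> \<le> 1"
    and Y: "distr M borel Y = distr (measure_pmf (bernoulli_pmf \<sigma>)) borel of_bool"
    and f[measurable]: "f \<in> borel_measurable borel" and int: "integrable (distr M borel X) f"
  shows "integrable (distr M borel (\<lambda>\<omega>. X \<omega> * Y \<omega>)) f"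
    and "(\<integral>x. f x \<partial>distr M borel (\<lambda>\<omega>. X \<omega> * Y \<omega>)) = \<sigma> * (\<integral>x. f x \<partial>distr M borel X) + (1 - \<sigma>) * f 0"
proof -
  have [measurable]: "random_variable borel X" "random_variable borel Y"
    using indep by (auto dest: indep_var_rv1 indep_var_rv2)
  have int_X: "integrable M (\<lambda>\<omega>. f (X \<omega>))" using int by (simp add: integrable_distr_eq)
  have Y_law: "prob (Y -` A \<inter> space M) = measure (measure_pmf (bernoulli_pmf \<sigma>)) (of_bool -` A)" if [measurable]: "A \<in> sets borel" for A
    using arg_cong[OF Y, of "\<lambda>N. measure N A"] by (simp add: measure_distr)
  have Y_1: "(\<integral>\<omega>. indicator {1} (Y \<omega>) \<partial>M) = \<sigma>"
  proof -
    have "of_bool -` {1::real} = {True}" by auto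
    then have "prob (Y -` {1} \<inter> space M) = \<sigma>" using Y_law[of "{1}"] \<sigma> by (simp add: measure_pmf_single)
    moreover have "(\<integral>\<omega>. indicat_real {1} (Y \<omega>) \<partial>M) = (\<integral>\<omega>. indicator (Y -` {1} \<inter> space M) \<omega> \<partial>M)"
      by (intro Bochner_Integration.integral_cong) (auto simp: indicator_def)
    ultimately show ?thesis by simp
  qed
  have Y_0: "(\<integral>\<omega>. indicator {0} (Y \<omega>) \<partial>M) = 1 - \<sigma>"
  proof -
    have "of_bool -` {0::real} = {False}" by auto
    then have "prob (Y -` {0} \<inter> space M) = 1 - \<sigma>" using Y_law[of "{0}"] \<sigma> by (simp add: measure_pmf_single)
    moreover have "(\<integral>\<omega>. indicat_real {0} (Y \<omega>) \<partial>M) = (\<integral>\<omega>. indicator (Y -` {0} \<inter> space M) \<omega> \<partial>M)"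
      by (intro Bochner_Integration.integral_cong) (auto simp: indicator_def)
    ultimately show ?thesis by simp
  qed
  have AE_Y: "AE \<omega> in M. Y \<omega> \<in> {0, 1}"
  proof -
    have "of_bool -` {0, 1::real} = UNIV" by auto
    then have "prob (Y -` {0, 1} \<inter> space M) = 1" using Y_law[of "{0, 1}"] by simp
    then have "AE \<omega> in M. \<omega> \<in> Y -` {0, 1} \<inter> space M" by (subst AE_in_set_eq_1) auto
    then show ?thesis by eventually_elim simp
  qed
  have eq: "AE \<omega> in M. f (X \<omega> * Y \<omega>) = f (X \<omega>) * indicator {1} (Y \<omega>) + f 0 * indicator {0} (Y \<omega>)"
    using AE_Y by eventually_elim auto
  have int_ind: "integrable M (\<lambda>\<omega>. indicator {c} (Y \<omega>) :: real)" for c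
    by (rule integrable_const_bound[of _ 1]) auto
  have indep': "indep_var borel (\<lambda>\<omega>. f (X \<omega>)) borel (\<lambda>\<omega>. indicator {1} (Y \<omega>) :: real)"
    using indep_var_compose[OF indep f, of "indicator {1} :: real \<Rightarrow> real" borel] by (simp add: o_def)
  have int_1: "integrable M (\<lambda>\<omega>. f (X \<omega>) * indicator {1} (Y \<omega>))"
    by (rule indep_var_integrable[OF indep' int_X int_ind])
  have int_all: "integrable M (\<lambda>\<omega>. f (X \<omega>) * indicator {1} (Y \<omega>) + f 0 * indicator {0} (Y \<omega>))"
    using int_1 int_ind[of 0] by simp
  have "integrable M (\<lambda>\<omega>. f (X \<omega> * Y \<omega>))"
    using int_all by (rule integrable_cong_AE_imp) (use eq in \<open>auto elim!: eventually_mono\<close>)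
  then show "integrable (distr M borel (\<lambda>\<omega>. X \<omega> * Y \<omega>)) f" by (simp add: integrable_distr_eq)
  have "(\<integral>x. f x \<partial>distr M borel (\<lambda>\<omega>. X \<omega> * Y \<omega>)) = (\<integral>\<omega>. f (X \<omega> * Y \<omega>) \<partial>M)"
    by (rule integral_distr) auto
  also have "\<dots> = (\<integral>\<omega>. f (X \<omega>) * indicator {1} (Y \<omega>) + f 0 * indicator {0} (Y \<omega>) \<partial>M)"
    by (rule integral_cong_AE[OF _ _ eq]) auto
  also have "\<dots> = (\<integral>\<omega>. f (X \<omega>) * indicator {1} (Y \<omega>) \<partial>M) + f 0 * (\<integral>\<omega>. indicator {0} (Y \<omega>) \<partial>M)"
    using int_1 int_ind[of 0] by simp
  also have "(\<integral>\<omega>. f (X \<omega>) * indicator {1} (Y \<omega>) \<partial>M) = (\<integral>\<omega>. f (X \<omega>) \<partial>M) * (\<integral>\<omega>. indicator {1} (Y \<omega>) \<partial>M)"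
    by (rule indep_var_lebesgue_integral[OF indep' int_X int_ind])
  also have "(\<integral>\<omega>. f (X \<omega>) \<partial>M) = (\<integral>x. f x \<partial>distr M borel X)"
    by (rule integral_distr[symmetric]) auto
  finally show "(\<integral>x. f x \<partial>distr M borel (\<lambda>\<omega>. X \<omega> * Y \<omega>)) = \<sigma> * (\<integral>x. f x \<partial>distr M borel X) + (1 - \<sigma>) * f 0"
    unfolding Y_1 Y_0 by (simp add: mult.commute)
qed

text \<open>Pass from \<open>l\<close> to \<open>s = 1 / l\<close>: the factors \<open>1 / s\<close> on both sides match because \<open>F\<close> has mass one.\<close>

lemma stieltjes_pairI:
  assumes \<mu>: "half_line_law \<mu>" and F: "half_line_law F"
    and log: "\<And>l. 0 < l \<Longrightarrow> integrable F (\<lambda>x. ln (1 + l * x))"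
    and eq: "\<And>l. 0 < l \<Longrightarrow> (\<integral>\<^sup>+x. ennreal ((1 + l * x) powr - 1) \<partial>\<mu>) = ennreal (exp (- (\<integral>x. ln (1 + l * x) \<partial>F)))"
  shows "stieltjes_pair \<mu> F"
proof -
  interpret \<mu>: half_line_law \<mu> by fact
  interpret F: half_line_law F by fact
  show ?thesis
  proof (intro stieltjes_pair.intro \<mu> log_moment_law.intro F log_moment_law_axioms.intro stieltjes_pair_axioms.intro)
    show "integrable F (\<lambda>x. ln (1 + x))" using log[of 1] by simp
    fix s :: real assume s: "0 < s"
    have "(\<integral>x. 1 / (s + x) \<partial>\<mu>) = (\<integral>x. 1 / s * (1 + 1 / s * x) powr - 1 \<partial>\<mu>)"
    proof (rule integral_cong_AE)
      show "AE x in \<mu>. 1 / (s + x) = 1 / s * (1 + 1 / s * x) powr - 1"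
        using \<mu>.AE_nonneg
      proof eventually_elim
        case (elim x)
        then have "0 < 1 + 1 / s * x" using s by (intro add_pos_nonneg) auto
        then show ?case using s elim by (simp add: powr_minus_divide field_simps)
      qed
    qed auto
    also have "\<dots> = 1 / s * (\<integral>x. (1 + 1 / s * x) powr - 1 \<partial>\<mu>)" by (rule integral_mult_right_zero)
    also have "(\<integral>x. (1 + 1 / s * x) powr - 1 \<partial>\<mu>) = exp (- (\<integral>x. ln (1 + 1 / s * x) \<partial>F))"
      using eq[of "1 / s"] s by (subst integral_eq_nn_integral) auto
    also have "1 / s * exp (- (\<integral>x. ln (1 + 1 / s * x) \<partial>F)) = exp (- (ln s + (\<integral>x. ln (1 + 1 / s * x) \<partial>F)))"
      using s by (simp only: minus_add_distrib exp_add exp_minus exp_ln divide_inverse mult_1_left)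
    also have "ln s + (\<integral>x. ln (1 + 1 / s * x) \<partial>F) = (\<integral>x. ln s + ln (1 + 1 / s * x) \<partial>F)"
      using log[of "1 / s"] s F.prob_space by (subst Bochner_Integration.integral_add) auto
    also have "\<dots> = (\<integral>x. ln (s + x) \<partial>F)"
    proof (rule integral_cong_AE)
      show "AE x in F. ln s + ln (1 + 1 / s * x) = ln (s + x)"
        using F.AE_nonneg
      proof eventually_elim
        case (elim x)
        then have "0 < 1 + 1 / s * x" using s by (intro add_pos_nonneg) auto
        then have "ln s + ln (1 + 1 / s * x) = ln (s * (1 + 1 / s * x))" using s by (intro ln_mult_pos[symmetric]) auto
        also have "s * (1 + 1 / s * x) = s + x" using s by (simp add: field_simps)
        finally show ?case .
      qed
    qed auto
    finally show "(\<integral>x. 1 / (s + x) \<partial>\<mu>) = exp (- (\<integral>x. ln (s + x) \<partial>F))" .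
  qed
qed

text \<open>The kernel \<open>exp (- x / v) / v\<close> is at most \<open>1 / x\<close>, so the mixed density is finite at every \<open>x > 0\<close>.\<close>

lemma integrable_exp_divide_kernel:
  fixes \<xi> :: "real \<Rightarrow> real"
  assumes [measurable]: "\<xi> \<in> borel_measurable borel" and nn: "\<And>v. 0 \<le> \<xi> v"
    and \<xi>: "prob_space (density lborel (\<lambda>v. ennreal (\<xi> v)))" and pos: "\<And>v. v \<le> 0 \<Longrightarrow> \<xi> v = 0" and x: "0 < x"
  shows "integrable lborel (\<lambda>v. \<xi> v * (exp (- x / v) / v))"
proof (rule integrableI_nonneg)
  have *: "0 \<le> \<xi> v * (exp (- x / v) / v) \<and> \<xi> v * (exp (- x / v) / v) \<le> \<xi> v * (1 / x)" for v
  proof (cases "0 < v")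
    case True
    have "x / v * exp (- x / v) \<le> 1"
    proof -
      have "x / v \<le> exp (x / v)" using exp_ge_add_one_self[of "x / v"] by linarith
      then have "x / v * exp (- (x / v)) \<le> exp (x / v) * exp (- (x / v))" by (intro mult_right_mono) auto
      then show ?thesis by (simp add: exp_minus_inverse)
    qed
    then have "exp (- x / v) / v \<le> 1 / x" using x True by (simp add: field_simps)
    then have "\<xi> v * (exp (- x / v) / v) \<le> \<xi> v * (1 / x)" using nn by (rule mult_left_mono)
    then show ?thesis using nn[of v] True by simp
  qed (use pos[of v] in auto)
  show "AE v in lborel. 0 \<le> \<xi> v * (exp (- x / v) / v)" using * by auto
  have "(\<integral>\<^sup>+v. ennreal (\<xi> v * (exp (- x / v) / v)) \<partial>lborel) \<le> (\<integral>\<^sup>+v. ennreal (1 / x) * ennreal (\<xi> v) \<partial>lborel)"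
  proof (rule nn_integral_mono)
    fix v
    have "ennreal (\<xi> v * (exp (- x / v) / v)) \<le> ennreal (\<xi> v * (1 / x))" using * by (intro ennreal_leI) blast
    also have "\<dots> = ennreal (1 / x) * ennreal (\<xi> v)" using nn x by (simp add: ennreal_mult'[symmetric])
    finally show "ennreal (\<xi> v * (exp (- x / v) / v)) \<le> ennreal (1 / x) * ennreal (\<xi> v)" .
  qed
  also have "\<dots> = ennreal (1 / x) * emeasure (density lborel (\<lambda>v. ennreal (\<xi> v))) UNIV"
    by (simp add: nn_integral_cmult emeasure_density)
  also have "\<dots> < \<infinity>"
    using prob_space.emeasure_space_1[OF \<xi>] by simp
  finally show "(\<integral>\<^sup>+v. ennreal (\<xi> v * (exp (- x / v) / v)) \<partial>lborel) < \<infinity>" .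
qed measurable

lemma half_line_lawI:
  assumes "prob_space F" "sets F = sets (borel :: real measure)" "measure F {0..} = 1"
  shows "half_line_law F"
proof -
  interpret prob_space F by fact
  have "AE x in F. x \<in> {0..}" using assms by (subst AE_in_set_eq_1) auto
  then show ?thesis using assms by (intro half_line_law.intro half_line_law_axioms.intro) auto
qed

lemma (in half_line_law) cdf_jump_eq: "cdf_jump F t = measure F {t}"
proof -
  interpret finite_borel_measure F by unfold_locales simp
  have "Lim (at_left t) (cdf F) = measure F {..<t}"
    by (intro tendsto_Lim cdf_at_left) simp
  moreover have "measure F ({..<t} \<union> {t}) = measure F {..<t} + measure F {t}"
    by (rule finite_measure_Union) auto
  moreover have "{..<t} \<union> {t} = {..t}" by auto
  ultimately show ?thesis by (simp only: cdf_jump_def cdf_def)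
qed

lemma AE_mult_law_nonneg:
  assumes "prob_space \<mu>" "prob_space \<nu>" "sets \<mu> = sets borel" "sets \<nu> = sets borel"
    and "AE x in \<mu>. 0 \<le> x" "AE y in \<nu>. 0 \<le> y"
  shows "AE z in mult_law \<mu> \<nu>. 0 \<le> z"
proof -
  have "(\<integral>\<^sup>+z. indicator {..<0} z \<partial>mult_law \<mu> \<nu>) = (\<integral>\<^sup>+y. \<integral>\<^sup>+x. indicator {..<0} (x * y) \<partial>\<mu> \<partial>\<nu>)"
    using assms by (intro nn_integral_mult_law) auto
  also have "\<dots> = (\<integral>\<^sup>+y. 0 \<partial>\<nu>)"
  proof (intro nn_integral_cong_AE, use assms(6) in eventually_elim)
    case (elim y)
    have "(\<integral>\<^sup>+x. indicator {..<0} (x * y) \<partial>\<mu>) = (\<integral>\<^sup>+x. 0 \<partial>\<mu>)"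
      using elim by (intro nn_integral_cong_AE, use assms(5) in eventually_elim) (simp add: not_less)
    then show ?case by simp
  qed
  finally have "emeasure (mult_law \<mu> \<nu>) {..<0} = 0" by simp
  then show ?thesis by (intro AE_I'[of "{..<0}"]) (auto simp: null_sets_def)
qed

text \<open>The density of \<open>M\<^sub>1(F\<^sub>X\<^sub>Y)\<close> comes out of the inversion formula in terms of \<open>\<Phi>\<close> of \<open>F\<^sub>X\<^sub>Y\<close>. For almost every
  \<open>x > 0\<close> the atom of weight \<open>1 - \<sigma>\<close> at zero contributes \<open>(1 - \<sigma>) ln x\<close> to it, which is the power
  \<open>x\<^sup>\<sigma>\<^sup>-\<^sup>1\<close> in the statement. The exceptional \<open>x\<close>, for which \<open>ln \<bar>x - X\<bar>\<close> is not integrable, form a null set.\<close>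

theorem theorem2p2:
  fixes M :: "'m measure" and X Y :: "'m \<Rightarrow> real" and \<sigma> :: real
    and F\<^sub>X F\<^sub>X\<^sub>Y :: "real measure"
    and \<Omega>\<^sub>\<sigma> :: "'a measure" and P\<^sub>\<sigma> :: "'a \<Rightarrow> real measure" and B G\<^sub>\<sigma> :: "'a \<Rightarrow> real"
    and \<Omega>\<^sub>1 :: "'b measure" and P\<^sub>1 :: "'b \<Rightarrow> real measure" and G\<^sub>1 :: "'b \<Rightarrow> real"
  assumes "prob_space M"
    and "X \<in> borel_measurable M" and "AE \<omega> in M. 0 \<le> X \<omega>"
    and "\<And>l::real. 0 < l \<Longrightarrow> integrable M (\<lambda>\<omega>. ln (1 + l * X \<omega>))"
    and "0 < \<sigma>" and "\<sigma> \<le> 1"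
    and "Y \<in> borel_measurable M"
    and "distr M borel Y = distr (measure_pmf (bernoulli_pmf \<sigma>)) borel of_bool"
    and "prob_space.indep_var M borel X borel Y"
    and F\<^sub>X: "F\<^sub>X = distr M borel X"
    and F\<^sub>X\<^sub>Y: "F\<^sub>X\<^sub>Y = distr M borel (\<lambda>\<omega>. X \<omega> * Y \<omega>)"
    and "\<forall>x. cdf_jump F\<^sub>X\<^sub>Y x \<noteq> 1"
    and "prob_space \<Omega>\<^sub>\<sigma>" and "dirichlet_process \<Omega>\<^sub>\<sigma> \<sigma> F\<^sub>X P\<^sub>\<sigma>"
    and "distr \<Omega>\<^sub>\<sigma> borel B = beta_law \<sigma> (1 - \<sigma>)"
    and "prob_space.indep_var \<Omega>\<^sub>\<sigma> borel B borel (random_mean P\<^sub>\<sigma>)"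
    and "distr \<Omega>\<^sub>\<sigma> borel G\<^sub>\<sigma> = gamma_law \<sigma>"
    and "prob_space.indep_var \<Omega>\<^sub>\<sigma> borel G\<^sub>\<sigma> borel (random_mean P\<^sub>\<sigma>)"
    and "prob_space \<Omega>\<^sub>1" and "dirichlet_process \<Omega>\<^sub>1 1 F\<^sub>X\<^sub>Y P\<^sub>1"
    and "distr \<Omega>\<^sub>1 borel G\<^sub>1 = gamma_law 1"
    and "prob_space.indep_var \<Omega>\<^sub>1 borel G\<^sub>1 borel (random_mean P\<^sub>1)"
  shows "distr \<Omega>\<^sub>1 borel (random_mean P\<^sub>1) = distr \<Omega>\<^sub>\<sigma> borel (\<lambda>\<omega>. B \<omega> * random_mean P\<^sub>\<sigma> \<omega>) \<and>
    distributed \<Omega>\<^sub>1 lborel (random_mean P\<^sub>1)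
           (\<lambda>x. ennreal (if 0 < x
              then x powr (\<sigma> - 1) / pi * sin (pi * cdf F\<^sub>X\<^sub>Y x) * exp (- \<sigma> * Phi F\<^sub>X x) else 0)) \<and>
    (\<forall>x>0. sin (pi * cdf F\<^sub>X\<^sub>Y x) =
           (if 0 < cdf F\<^sub>X x then sin (pi * \<sigma> * (1 - cdf F\<^sub>X x)) else sin (pi * (1 - \<sigma>)))) \<and>
    distr \<Omega>\<^sub>\<sigma> borel (\<lambda>\<omega>. G\<^sub>\<sigma> \<omega> * random_mean P\<^sub>\<sigma> \<omega>)
           = distr \<Omega>\<^sub>1 borel (\<lambda>\<omega>. G\<^sub>1 \<omega> * random_mean P\<^sub>1 \<omega>) \<and>
    distributed \<Omega>\<^sub>\<sigma> lborel (\<lambda>\<omega>. G\<^sub>\<sigma> \<omega> * random_mean P\<^sub>\<sigma> \<omega>)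
           (\<lambda>x. ennreal (if 0 < x
              then 1 / pi * (LINT y:{0<..}|lborel.
                exp (- x / y) * y powr (\<sigma> - 2) * sin (pi * cdf F\<^sub>X\<^sub>Y y) * exp (- \<sigma> * Phi F\<^sub>X y)) else 0))"
proof -
  interpret M: prob_space M by fact
  interpret O\<sigma>: prob_space \<Omega>\<^sub>\<sigma> by fact
  interpret O1: prob_space \<Omega>\<^sub>1 by fact
  note \<sigma> = \<open>0 < \<sigma>\<close> \<open>\<sigma> \<le> 1\<close>
  note D\<sigma> = \<open>dirichlet_process \<Omega>\<^sub>\<sigma> \<sigma> F\<^sub>X P\<^sub>\<sigma>\<close> and D1 = \<open>dirichlet_process \<Omega>\<^sub>1 1 F\<^sub>X\<^sub>Y P\<^sub>1\<close>
  have [measurable]: "X \<in> borel_measurable M" "Y \<in> borel_measurable M" by fact+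
  have mean\<sigma>[measurable]: "random_mean P\<^sub>\<sigma> \<in> borel_measurable \<Omega>\<^sub>\<sigma>"
    using \<open>O\<sigma>.indep_var borel B borel (random_mean P\<^sub>\<sigma>)\<close> by (rule O\<sigma>.indep_var_rv2)
  have B[measurable]: "B \<in> borel_measurable \<Omega>\<^sub>\<sigma>"
    using \<open>O\<sigma>.indep_var borel B borel (random_mean P\<^sub>\<sigma>)\<close> by (rule O\<sigma>.indep_var_rv1)
  have G\<sigma>[measurable]: "G\<^sub>\<sigma> \<in> borel_measurable \<Omega>\<^sub>\<sigma>"
    using \<open>O\<sigma>.indep_var borel G\<^sub>\<sigma> borel (random_mean P\<^sub>\<sigma>)\<close> by (rule O\<sigma>.indep_var_rv1)
  have mean1[measurable]: "random_mean P\<^sub>1 \<in> borel_measurable \<Omega>\<^sub>1"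
    using \<open>O1.indep_var borel G\<^sub>1 borel (random_mean P\<^sub>1)\<close> by (rule O1.indep_var_rv2)

  have mix: "integrable F\<^sub>X\<^sub>Y f" "(\<integral>x. f x \<partial>F\<^sub>X\<^sub>Y) = \<sigma> * (\<integral>x. f x \<partial>F\<^sub>X) + (1 - \<sigma>) * f 0"
    if "f \<in> borel_measurable borel" "integrable F\<^sub>X f" for f :: "real \<Rightarrow> real"
    using M.bernoulli_mult_mixture[OF \<open>M.indep_var borel X borel Y\<close> _ \<sigma>(2) \<open>distr M borel Y = _\<close>] \<sigma>(1) that
    unfolding F\<^sub>X F\<^sub>X\<^sub>Y by (auto simp: less_imp_le)
  have law_X: "half_line_law F\<^sub>X"
    using D\<sigma> by (intro half_line_lawI) (auto simp: dirichlet_process_def space_prob_algebra)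
  have law_XY: "half_line_law F\<^sub>X\<^sub>Y"
    using D1 by (intro half_line_lawI) (auto simp: dirichlet_process_def space_prob_algebra)
  interpret FX: half_line_law F\<^sub>X by (rule law_X)
  interpret FXY: half_line_law F\<^sub>X\<^sub>Y by (rule law_XY)
  have log_X: "integrable F\<^sub>X (\<lambda>x. ln (1 + l * x))" if "0 < l" for l
    unfolding F\<^sub>X using that by (simp add: integrable_distr_eq assms)
  have log_XY: "integrable F\<^sub>X\<^sub>Y (\<lambda>x. ln (1 + l * x))" if "0 < l" for l
    using log_X[OF that] by (intro mix(1)) auto
  have log_int: "(\<integral>x. ln (1 + l * x) \<partial>F\<^sub>X\<^sub>Y) = \<sigma> * (\<integral>x. ln (1 + l * x) \<partial>F\<^sub>X)" if "0 < l" for l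
    using mix(2)[OF _ log_X[OF that]] by simp
  have cdf_XY: "cdf F\<^sub>X\<^sub>Y x = \<sigma> * cdf F\<^sub>X x + (1 - \<sigma>)" if "0 \<le> x" for x
    using mix(2)[of "indicator {..x}"] that by (simp add: cdf_def less_top[symmetric])
  interpret LX: log_moment_law F\<^sub>X
    by standard (use log_X[of 1] in simp)
  interpret LXY: log_moment_law F\<^sub>X\<^sub>Y
    by standard (use log_XY[of 1] in simp)
  have atom: "measure F\<^sub>X\<^sub>Y {t} \<noteq> 1" for t
    using \<open>\<forall>x. cdf_jump F\<^sub>X\<^sub>Y x \<noteq> 1\<close>[THEN spec, of t] unfolding FXY.cdf_jump_eq .

  define m\<sigma> where "m\<sigma> = distr \<Omega>\<^sub>\<sigma> borel (random_mean P\<^sub>\<sigma>)"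
  define m1 where "m1 = distr \<Omega>\<^sub>1 borel (random_mean P\<^sub>1)"
  have m\<sigma>: "prob_space m\<sigma>" "sets m\<sigma> = sets borel" and m1: "prob_space m1" "sets m1 = sets borel"
    by (simp_all add: m\<sigma>_def m1_def O\<sigma>.prob_space_distr O1.prob_space_distr)
  have m\<sigma>_nonneg: "AE x in m\<sigma>. 0 \<le> x"
    unfolding m\<sigma>_def by (subst AE_distr_iff) (auto intro!: AE_I2 random_mean_nonneg[OF D\<sigma>])
  have m1_nonneg: "AE x in m1. 0 \<le> x"
    unfolding m1_def by (subst AE_distr_iff) (auto intro!: AE_I2 random_mean_nonneg[OF D1])
  have beta: "prob_space (beta_law \<sigma> (1 - \<sigma>))"
    using O\<sigma>.prob_space_distr[OF B] \<open>distr \<Omega>\<^sub>\<sigma> borel B = beta_law \<sigma> (1 - \<sigma>)\<close> by simp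
  define \<mu> where "\<mu> = mult_law (beta_law \<sigma> (1 - \<sigma>)) m\<sigma>"
  have \<mu>: "prob_space \<mu>" "sets \<mu> = sets borel"
    unfolding \<mu>_def by (rule prob_space_mult_law[OF beta m\<sigma>(1) sets_beta_law m\<sigma>(2)]) (rule sets_mult_law)
  have BM: "distr \<Omega>\<^sub>\<sigma> borel (\<lambda>\<omega>. B \<omega> * random_mean P\<^sub>\<sigma> \<omega>) = \<mu>"
    unfolding \<mu>_def m\<sigma>_def O\<sigma>.distr_mult_indep_var[OF \<open>O\<sigma>.indep_var borel B borel (random_mean P\<^sub>\<sigma>)\<close>]
    by (simp only: \<open>distr \<Omega>\<^sub>\<sigma> borel B = beta_law \<sigma> (1 - \<sigma>)\<close>)

  have S1: "stieltjes_pair m1 F\<^sub>X\<^sub>Y"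
  proof (rule stieltjes_pairI[OF _ law_XY log_XY])
    show "half_line_law m1"
      by (intro half_line_law.intro half_line_law_axioms.intro m1 m1_nonneg)
    fix l :: real assume "0 < l"
    from markov_krein[OF \<open>prob_space \<Omega>\<^sub>1\<close> D1 log_XY mean1 this]
    show "(\<integral>\<^sup>+x. ennreal ((1 + l * x) powr - 1) \<partial>m1) = ennreal (exp (- (\<integral>x. ln (1 + l * x) \<partial>F\<^sub>X\<^sub>Y)))"
      unfolding m1_def by (subst nn_integral_distr) auto
  qed
  have S\<sigma>: "stieltjes_pair \<mu> F\<^sub>X\<^sub>Y"
  proof (rule stieltjes_pairI[OF _ law_XY log_XY])
    have "AE x in beta_law \<sigma> (1 - \<sigma>). 0 \<le> x"
      using AE_beta_law_pos[of \<sigma> "1 - \<sigma>"] by eventually_elim simp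
    then have "AE x in \<mu>. 0 \<le> x"
      unfolding \<mu>_def by (intro AE_mult_law_nonneg m\<sigma> beta m\<sigma>_nonneg sets_beta_law)
    then show "half_line_law \<mu>"
      by (intro half_line_law.intro half_line_law_axioms.intro \<mu>)
    fix l :: real assume l: "0 < l"
    have "(\<integral>\<^sup>+x. ennreal ((1 + l * x) powr - 1) \<partial>\<mu>) = (\<integral>\<^sup>+y. \<integral>\<^sup>+b. ennreal ((1 + l * (b * y)) powr - 1) \<partial>beta_law \<sigma> (1 - \<sigma>) \<partial>m\<sigma>)"
      unfolding \<mu>_def using beta m\<sigma> by (intro nn_integral_mult_law) auto
    also have "\<dots> = (\<integral>\<^sup>+y. ennreal ((1 + l * y) powr - \<sigma>) \<partial>m\<sigma>)"
    proof (intro nn_integral_cong_AE, use m\<sigma>_nonneg in eventually_elim)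
      case (elim y)
      then show ?case using nn_integral_beta_law_stieltjes[OF \<sigma> beta, of "l * y"] l by (simp add: mult_ac)
    qed
    also have "\<dots> = ennreal (exp (- (\<integral>x. ln (1 + l * x) \<partial>F\<^sub>X\<^sub>Y)))"
      unfolding m\<sigma>_def log_int[OF l]
      using markov_krein[OF \<open>prob_space \<Omega>\<^sub>\<sigma>\<close> D\<sigma> log_X mean\<sigma> l] by (subst nn_integral_distr) auto
    finally show "(\<integral>\<^sup>+x. ennreal ((1 + l * x) powr - 1) \<partial>\<mu>) = ennreal (exp (- (\<integral>x. ln (1 + l * x) \<partial>F\<^sub>X\<^sub>Y)))" .
  qed
  note inv1 = stieltjes_pair.stieltjes_inversion[OF S1 atom]
  have m1_eq: "m1 = \<mu>"
    using inv1 stieltjes_pair.stieltjes_inversion[OF S\<sigma> atom] by simp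

  define \<xi> where "\<xi> x = (if 0 < x then x powr (\<sigma> - 1) / pi * sin (pi * cdf F\<^sub>X\<^sub>Y x) * exp (- \<sigma> * Phi F\<^sub>X x) else 0)" for x
  have cdf01: "0 \<le> cdf F\<^sub>X\<^sub>Y x" "cdf F\<^sub>X\<^sub>Y x \<le> 1" for x by (simp_all add: cdf_def)
  have sin_nonneg: "0 \<le> sin (pi * cdf F\<^sub>X\<^sub>Y x)" for x
    using cdf01[of x] by (intro sin_ge_zero) (auto simp: mult_left_le)
  have \<xi>_nonneg: "0 \<le> \<xi> x" for x using sin_nonneg[of x] by (simp add: \<xi>_def)
  have [measurable]: "cdf F\<^sub>X\<^sub>Y \<in> borel_measurable borel"
    by (intro borel_measurable_mono) (auto simp: mono_def cdf_def intro: FXY.finite_measure_mono)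
  have [measurable]: "Phi F\<^sub>X \<in> borel_measurable borel" unfolding LX.Phi_eq[abs_def] by measurable
  have [measurable]: "\<xi> \<in> borel_measurable borel" unfolding \<xi>_def[abs_def] by measurable
  have [measurable]: "Phi F\<^sub>X\<^sub>Y \<in> borel_measurable borel" unfolding LXY.Phi_eq[abs_def] by measurable
  have dens1: "m1 = density lborel (\<lambda>x. ennreal (\<xi> x))"
    unfolding inv1
  proof (rule density_cong)
    have "AE x in lborel. x \<noteq> (0::real)" by (rule AE_lborel_singleton)
    then show "AE x in lborel. ennreal (sin (pi * cdf F\<^sub>X\<^sub>Y x) * exp (- Phi F\<^sub>X\<^sub>Y x) / pi) = ennreal (\<xi> x)"
      using LX.AE_integrable_ln_abs
    proof eventually_elim
      case (elim x)
      show ?case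
      proof (cases "0 < x")
        case True
        have "Phi F\<^sub>X\<^sub>Y x = \<sigma> * Phi F\<^sub>X x + (1 - \<sigma>) * ln x"
          unfolding LX.Phi_eq LXY.Phi_eq using mix(2)[OF _ elim(2)] True by simp
        then have "exp (- Phi F\<^sub>X\<^sub>Y x) = exp ((\<sigma> - 1) * ln x) * exp (- \<sigma> * Phi F\<^sub>X x)"
          by (simp add: exp_add[symmetric] algebra_simps)
        then show ?thesis using True by (simp add: \<xi>_def powr_def mult_ac)
      next
        case False
        then have neg: "x < 0" using elim by simp
        have "AE y in F\<^sub>X\<^sub>Y. y \<notin> {..x}" using FXY.AE_nonneg by eventually_elim (use neg in auto)
        then have "cdf F\<^sub>X\<^sub>Y x = 0" unfolding cdf_def by (subst FXY.prob_eq_0) auto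
        then show ?thesis using False by (simp add: \<xi>_def)
      qed
    qed
  qed measurable

  have G1: "distr \<Omega>\<^sub>1 borel (\<lambda>\<omega>. G\<^sub>1 \<omega> * random_mean P\<^sub>1 \<omega>) = mult_law (gamma_law 1) m1"
    unfolding m1_def O1.distr_mult_indep_var[OF \<open>O1.indep_var borel G\<^sub>1 borel (random_mean P\<^sub>1)\<close>]
    by (simp only: \<open>distr \<Omega>\<^sub>1 borel G\<^sub>1 = gamma_law 1\<close>)
  have "distr \<Omega>\<^sub>\<sigma> borel (\<lambda>\<omega>. G\<^sub>\<sigma> \<omega> * random_mean P\<^sub>\<sigma> \<omega>) = mult_law (gamma_law \<sigma>) m\<sigma>"
    unfolding m\<sigma>_def O\<sigma>.distr_mult_indep_var[OF \<open>O\<sigma>.indep_var borel G\<^sub>\<sigma> borel (random_mean P\<^sub>\<sigma>)\<close>]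
    by (simp only: \<open>distr \<Omega>\<^sub>\<sigma> borel G\<^sub>\<sigma> = gamma_law \<sigma>\<close>)
  also have "\<dots> = mult_law (gamma_law 1) m1"
    unfolding gamma_beta_mult_law[OF \<sigma> beta, symmetric] m1_eq \<mu>_def
    by (intro mult_law_assoc prob_space_gamma_law beta m\<sigma>) auto
  finally have G\<sigma>_law: "distr \<Omega>\<^sub>\<sigma> borel (\<lambda>\<omega>. G\<^sub>\<sigma> \<omega> * random_mean P\<^sub>\<sigma> \<omega>) = mult_law (gamma_law 1) m1" .
  let ?g = "\<lambda>x. if 0 < x
              then 1 / pi * (LINT y:{0<..}|lborel.
                exp (- x / y) * y powr (\<sigma> - 2) * sin (pi * cdf F\<^sub>X\<^sub>Y y) * exp (- \<sigma> * Phi F\<^sub>X y)) else 0"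
  have m1_pos: "AE v in m1. 0 < v"
    unfolding dens1 by (auto simp: AE_density \<xi>_def)
  have "mult_law (gamma_law 1) m1 = density lborel (\<lambda>x. \<integral>\<^sup>+v. ennreal (gamma_density 1 (x / v) / v) \<partial>m1)"
    using prob_space_gamma_law[of 1] unfolding gamma_law_eq_density[OF zero_less_one]
    by (intro mult_law_density m1 m1_pos gamma_density_nonneg) auto
  also have "(\<lambda>x. \<integral>\<^sup>+v. ennreal (gamma_density 1 (x / v) / v) \<partial>m1) = (\<lambda>x. ennreal (?g x))"
  proof
    fix x :: real
    have "(\<integral>\<^sup>+v. ennreal (gamma_density 1 (x / v) / v) \<partial>m1) = (\<integral>\<^sup>+v. ennreal (\<xi> v) * ennreal (gamma_density 1 (x / v) / v) \<partial>lborel)"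
      unfolding dens1 by (subst nn_integral_density) auto
    also have "\<dots> = ennreal (?g x)"
    proof (cases "0 < x")
      case x: True
      have int: "integrable lborel (\<lambda>v. \<xi> v * (exp (- x / v) / v))"
        using m1(1) by (intro integrable_exp_divide_kernel \<xi>_nonneg x) (auto simp: dens1 \<xi>_def)
      have nn: "0 \<le> \<xi> v * (exp (- x / v) / v)" for v
      proof (cases "0 < v")
        case True
        then show ?thesis by (intro mult_nonneg_nonneg \<xi>_nonneg) auto
      qed (simp add: \<xi>_def)
      have "(\<integral>\<^sup>+v. ennreal (\<xi> v) * ennreal (gamma_density 1 (x / v) / v) \<partial>lborel) = (\<integral>\<^sup>+v. ennreal (\<xi> v * (exp (- x / v) / v)) \<partial>lborel)"
      proof (intro nn_integral_cong)
        fix v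
        show "ennreal (\<xi> v) * ennreal (gamma_density 1 (x / v) / v) = ennreal (\<xi> v * (exp (- x / v) / v))"
        proof (cases "0 < v")
          case True
          then show ?thesis using x \<xi>_nonneg[of v] by (simp add: gamma_density_def ennreal_mult'[symmetric])
        qed (simp add: \<xi>_def)
      qed
      also have "\<dots> = ennreal (\<integral>v. \<xi> v * (exp (- x / v) / v) \<partial>lborel)"
        using int nn by (intro nn_integral_eq_integral) auto
      also have "(\<integral>v. \<xi> v * (exp (- x / v) / v) \<partial>lborel) = ?g x"
      proof -
        have "(\<integral>v. \<xi> v * (exp (- x / v) / v) \<partial>lborel)
          = (\<integral>v. 1 / pi * (indicator {0<..} v *\<^sub>R (exp (- x / v) * v powr (\<sigma> - 2) * sin (pi * cdf F\<^sub>X\<^sub>Y v) * exp (- \<sigma> * Phi F\<^sub>X v))) \<partial>lborel)"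
        proof (rule Bochner_Integration.integral_cong[OF refl])
          fix v :: real
          show "\<xi> v * (exp (- x / v) / v) = 1 / pi * (indicator {0<..} v *\<^sub>R (exp (- x / v) * v powr (\<sigma> - 2) * sin (pi * cdf F\<^sub>X\<^sub>Y v) * exp (- \<sigma> * Phi F\<^sub>X v)))"
          proof (cases "0 < v")
            case True
            then have "v powr (\<sigma> - 2) = v powr (\<sigma> - 1) / v"
              using powr_diff[of v "\<sigma> - 1" 1] by simp
            then show ?thesis using True by (simp add: \<xi>_def)
          qed (simp add: \<xi>_def)
        qed
        also have "\<dots> = ?g x" using x by (simp only: integral_mult_right_zero set_lebesgue_integral_def if_True)
        finally show ?thesis .
      qed
      finally show ?thesis .
    next
      case False
      have "(\<integral>\<^sup>+v. ennreal (\<xi> v) * ennreal (gamma_density 1 (x / v) / v) \<partial>lborel) = (\<integral>\<^sup>+v. 0 \<partial>(lborel :: real measure))"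
        using False by (intro nn_integral_cong) (auto simp: \<xi>_def gamma_density_def zero_less_divide_iff)
      then show ?thesis using False by simp
    qed
    finally show "(\<integral>\<^sup>+v. ennreal (gamma_density 1 (x / v) / v) \<partial>m1) = ennreal (?g x)" .
  qed
  finally have dens\<sigma>: "mult_law (gamma_law 1) m1 = density lborel (\<lambda>x. ennreal (?g x))" .

  have sin_eq: "sin (pi * cdf F\<^sub>X\<^sub>Y x) = (if 0 < cdf F\<^sub>X x then sin (pi * \<sigma> * (1 - cdf F\<^sub>X x)) else sin (pi * (1 - \<sigma>)))"
    if "0 < x" for x
  proof -
    have "pi * cdf F\<^sub>X\<^sub>Y x = pi - pi * \<sigma> * (1 - cdf F\<^sub>X x)"
      using that by (simp add: cdf_XY algebra_simps)
    then have "sin (pi * cdf F\<^sub>X\<^sub>Y x) = sin (pi * \<sigma> * (1 - cdf F\<^sub>X x))" by (simp only: sin_pi_minus)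
    moreover have "cdf F\<^sub>X x = 0" if "\<not> 0 < cdf F\<^sub>X x" using that by (simp add: cdf_def zero_less_measure_iff)
    ultimately show ?thesis using that by (auto simp: cdf_XY)
  qed
  have dist1: "distributed \<Omega>\<^sub>1 lborel (random_mean P\<^sub>1) (\<lambda>x. ennreal (\<xi> x))"
    using dens1 unfolding distributed_def m1_def by (simp cong: distr_cong)
  have dist\<sigma>: "distributed \<Omega>\<^sub>\<sigma> lborel (\<lambda>\<omega>. G\<^sub>\<sigma> \<omega> * random_mean P\<^sub>\<sigma> \<omega>) (\<lambda>x. ennreal (?g x))"
    unfolding distributed_def
  proof (intro conjI)
    show "distr \<Omega>\<^sub>\<sigma> lborel (\<lambda>\<omega>. G\<^sub>\<sigma> \<omega> * random_mean P\<^sub>\<sigma> \<omega>) = density lborel (\<lambda>x. ennreal (?g x))"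
      using G\<sigma>_law dens\<sigma> by (simp cong: distr_cong)
    show "(\<lambda>x. ennreal (?g x)) \<in> borel_measurable lborel"
      unfolding set_lebesgue_integral_def measurable_lborel1 by measurable
  qed simp
  show ?thesis
  proof (intro conjI)
    show "distr \<Omega>\<^sub>1 borel (random_mean P\<^sub>1) = distr \<Omega>\<^sub>\<sigma> borel (\<lambda>\<omega>. B \<omega> * random_mean P\<^sub>\<sigma> \<omega>)"
      unfolding BM m1_def[symmetric] by (rule m1_eq)
    show "distr \<Omega>\<^sub>\<sigma> borel (\<lambda>\<omega>. G\<^sub>\<sigma> \<omega> * random_mean P\<^sub>\<sigma> \<omega>) = distr \<Omega>\<^sub>1 borel (\<lambda>\<omega>. G\<^sub>1 \<omega> * random_mean P\<^sub>1 \<omega>)"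
      by (simp only: G\<sigma>_law G1)
  qed (rule dist1[unfolded \<xi>_def], intro allI impI, erule sin_eq, rule dist\<sigma>)
qed

end
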